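(* Let $N\ge 1$, $p>1$, $m\ge 0$, $\mu\ge 0$, $\nu\ge 0$, and assume $\delta:=(\mu-1)^2-4\nu^2\ge 0$. Let $R>0$ and let $u_0\in H^1(\mathbb{R}^N)$, $u_1\in L^2(\mathbb{R}^N)$ be non-negative, supported in the ball $B_{\mathbb{R}^N}(0,R)$, not both identically zero, and such that $$\frac{\mu-1-\sqrt{\delta}}{2}u_0(x)+u_1(x)>0 \quad\text{for a.e. } x\in B_{\mathbb{R}^N}(0,R).$$ Then there exists $\varepsilon_0=\varepsilon_0(u_0,u_1,N,R,p,m,\mu,\nu)>0$ such that for every $0<\varepsilon\le\varepsilon_0$, any weak solution $u$ of the Cauchy problem (P) on $[1,T)$ satisfying $$\operatorname{supp}(u)\subset\{(x,t)\in\mathbb{R}^N\times[1,\infty): |x|\le R+\phi_m(t)-\phi_m(1)\}$$ blows up in finite time, i.e. its maximal existence time $T_\varepsilon$ is finite, and it satisfies the following upper bounds, where $C>0$ is a constant independent of $\varepsilon$: For $N\ge 2$: $$T_\varepsilon\le \begin{cases} C\,\varepsilon^{-\frac{2(p-1)}{2-((1+m)(N-1)-m+\mu)(p-1)}} & \text{if } 1<p<p_T\big(N+\tfrac{\mu}{m+1},m\big),\\[1mm] \exp\big(C\varepsilon^{-(p-1)}\big) & \text{if } p=p_T\big(N+\tfrac{\mu}{m+1},m\big),\end{cases}$$ where $p_T(N',m):=1+\frac{2}{(1+m)(N'-1)-m}$, so that $p_T(N+\frac{\mu}{m+1},m)=1+\frac{2}{(1+m)(N-1)-m+\mu}$. For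 $N=1$: $$T_\varepsilon\le C\,\varepsilon^{-\frac{2(p-1)}{2-(\mu-m)(p-1)}}$$ if either $\mu\le m$ (and $p>1$ arbitrary), or $\mu>m$ and $1<p<1+\frac{2}{\mu-m}$; and $$T_\varepsilon\le \exp\big(C\varepsilon^{-(p-1)}\big)$$ if $\mu>m$ and $p=1+\frac{2}{\mu-m}$.
   Context: The Cauchy problem (P) is $$u_{tt}-t^{2m}\Delta u+\frac{\mu}{t}u_t+\frac{\nu^2}{t^2}u=|u_t|^p \ \text{ in } \mathbb{R}^N\times[1,\infty),\qquad u(x,1)=\varepsilon u_0(x),\ u_t(x,1)=\varepsilon u_1(x).$$ Notation: $\phi_m(t):=\frac{t^{1+m}}{1+m}$. A weak solution of (P) on $[1,T)$ is a function $u\in C([1,T),H^1(\mathbb{R}^N))\cap C^1([1,T),L^2(\mathbb{R}^N))$ with $u_t\in L^p_{loc}((1,T)\times\mathbb{R}^N)$, such that $u(\cdot,1)=\varepsilon u_0$ in $H^1(\mathbb{R}^N)$ and, for all $\Phi\in C_0^\infty(\mathbb{R}^N\times[1,T))$ and all $t\in[1,T)$, $$\int_{\mathbb{R}^N}u_t(x,t)\Phi(x,t)dx-\varepsilon\int_{\mathbb{R}^N}u_1(x)\Phi(x,1)dx-\int_1^t\!\!\int_{\mathbb{R}^N}u_t\Phi_t\,dx\,ds+\int_1^t\!\!\int_{\mathbb{R}^N}s^{2m}\nabla u\cdot\nabla\Phi\,dx\,ds+\int_1^t\!\!\int_{\mathbb{R}^N}\frac{\mu}{s}u_t\Phi\,dx\,ds+\int_1^t\!\!\int_{\mathbb{R}^N}\frac{\nu^2}{s^2}u\Phi\,dx\,ds=\int_1^t\!\!\int_{\mathbb{R}^N}|u_t|^p\Phi\,dx\,ds.$$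 *)

theory Defs
  imports "HOL-Analysis.Analysis"
begin

coinductive smooth_fun :: "('a::euclidean_space \<Rightarrow> real) \<Rightarrow> bool" where
  "(\<forall>x. f differentiable (at x)) \<Longrightarrow>
   (\<forall>i\<in>Basis. smooth_fun (\<lambda>x. frechet_derivative f (at x) i)) \<Longrightarrow> smooth_fun f"

definition test_fn :: "(real^'n \<Rightarrow> real) \<Rightarrow> bool" where
  "test_fn \<phi> \<longleftrightarrow> smooth_fun \<phi> \<and> (\<exists>r. \<forall>x. r \<le> norm x \<longrightarrow> \<phi> x = 0)"

definition pdx :: "(real^'n \<Rightarrow> real) \<Rightarrow> 'n \<Rightarrow> real^'n \<Rightarrow> real" where
  "pdx \<phi> i x = frechet_derivative \<phi> (at x) (axis i 1)"

definition L2 :: "(real^'n \<Rightarrow> real) \<Rightarrow> bool" where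
  "L2 f \<longleftrightarrow> f \<in> borel_measurable lborel \<and> integrable lborel (\<lambda>x. (f x)^2)"

definition L2dist2 :: "(real^'n \<Rightarrow> real) \<Rightarrow> (real^'n \<Rightarrow> real) \<Rightarrow> real" where
  "L2dist2 f g = (LINT x|lborel. (f x - g x)^2)"

definition weak_grad :: "(real^'n \<Rightarrow> real) \<Rightarrow> (real^'n \<Rightarrow> real^'n) \<Rightarrow> bool" where
  "weak_grad f g \<longleftrightarrow> (\<forall>\<phi>. test_fn \<phi> \<longrightarrow> (\<forall>i.
      (LINT x|lborel. f x * pdx \<phi> i x) = - (LINT x|lborel. g x $ i * \<phi> x)))"

definition H1 :: "(real^'n \<Rightarrow> real) \<Rightarrow> bool" where
  "H1 f \<longleftrightarrow> L2 f \<and> (\<exists>g. weak_grad f g \<and> (\<forall>i. L2 (\<lambda>x. g x $ i)))"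

text \<open>Test functions in C_0^infinity(R^N x [1,T)): (restrictions of) smooth functions on
  R^{N+1} vanishing for |x| large and for t near T.\<close>
definition test_fn_T :: "real \<Rightarrow> (real^'n \<Rightarrow> real \<Rightarrow> real) \<Rightarrow> bool" where
  "test_fn_T T \<Phi> \<longleftrightarrow> smooth_fun (\<lambda>z. \<Phi> (fst z) (snd z)) \<and>
     (\<exists>r T'. T' < T \<and> (\<forall>x t. r \<le> norm x \<or> T' \<le> t \<longrightarrow> \<Phi> x t = 0))"

definition dt_T :: "(real^'n \<Rightarrow> real \<Rightarrow> real) \<Rightarrow> real^'n \<Rightarrow> real \<Rightarrow> real" where
  "dt_T \<Phi> x t = frechet_derivative (\<lambda>z. \<Phi> (fst z) (snd z)) (at (x, t)) (0, 1)"

definition dx_T :: "(real^'n \<Rightarrow> real \<Rightarrow> real) \<Rightarrow> 'n \<Rightarrow> real^'n \<Rightarrow> real \<Rightarrow> real" where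
  "dx_T \<Phi> i x t = frechet_derivative (\<lambda>z. \<Phi> (fst z) (snd z)) (at (x, t)) (axis i 1, 0)"

definition phi_m :: "real \<Rightarrow> real \<Rightarrow> real" where
  "phi_m m t = t powr (1 + m) / (1 + m)"

definition weak_sol ::
  "real \<Rightarrow> real \<Rightarrow> real \<Rightarrow> real \<Rightarrow> real \<Rightarrow> (real^'n \<Rightarrow> real) \<Rightarrow> (real^'n \<Rightarrow> real)
   \<Rightarrow> real \<Rightarrow> (real^'n \<Rightarrow> real \<Rightarrow> real) \<Rightarrow> bool" where
  "weak_sol m \<mu> \<nu> p \<epsilon> u0 u1 T u \<longleftrightarrow> 1 < T \<and>
   (\<exists>G :: real^'n \<Rightarrow> real \<Rightarrow> real^'n. \<exists>v :: real^'n \<Rightarrow> real \<Rightarrow> real.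
     \<comment> \<open>u in C([1,T),H^1), with gradient G\<close>
     (\<forall>t\<in>{1..<T}. L2 (\<lambda>x. u x t) \<and> weak_grad (\<lambda>x. u x t) (\<lambda>x. G x t)
        \<and> (\<forall>i. L2 (\<lambda>x. G x t $ i)) \<and> L2 (\<lambda>x. v x t)) \<and>
     (\<forall>t\<in>{1..<T}. ((\<lambda>s. L2dist2 (\<lambda>x. u x s) (\<lambda>x. u x t)) \<longlongrightarrow> 0) (at t within {1..<T})) \<and>
     (\<forall>t\<in>{1..<T}. \<forall>i. ((\<lambda>s. L2dist2 (\<lambda>x. G x s $ i) (\<lambda>x. G x t $ i)) \<longlongrightarrow> 0) (at t within {1..<T})) \<and>
     \<comment> \<open>u in C^1([1,T),L^2), with derivative v\<close>
     (\<forall>t\<in>{1..<T}. ((\<lambda>s. L2dist2 (\<lambda>x. (u x s - u x t) / (s - t)) (\<lambda>x. v x t)) \<longlongrightarrow> 0) (at t within {1..<T})) \<and>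
     (\<forall>t\<in>{1..<T}. ((\<lambda>s. L2dist2 (\<lambda>x. v x s) (\<lambda>x. v x t)) \<longlongrightarrow> 0) (at t within {1..<T})) \<and>
     \<comment> \<open>u_t in L^p_loc((1,T) x R^N)\<close>
     (\<forall>K. compact K \<and> K \<subseteq> UNIV \<times> {1<..<T} \<longrightarrow>
        set_borel_measurable lborel K (\<lambda>z. v (fst z) (snd z)) \<and>
        set_integrable lborel K (\<lambda>z. \<bar>v (fst z) (snd z)\<bar> powr p)) \<and>
     \<comment> \<open>initial datum\<close>
     (AE x in lborel. u x 1 = \<epsilon> * u0 x) \<and>
     \<comment> \<open>weak formulation\<close>
     (\<forall>\<Phi>. test_fn_T T \<Phi> \<longrightarrow> (\<forall>t\<in>{1..<T}.
        (LINT x|lborel. v x t * \<Phi> x t)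
        - \<epsilon> * (LINT x|lborel. u1 x * \<Phi> x 1)
        - (LINT s:{1..t}|lborel. (LINT x|lborel. v x s * dt_T \<Phi> x s))
        + (LINT s:{1..t}|lborel. (LINT x|lborel. s powr (2 * m) * (\<Sum>i\<in>UNIV. G x s $ i * dx_T \<Phi> i x s)))
        + (LINT s:{1..t}|lborel. (LINT x|lborel. \<mu> / s * v x s * \<Phi> x s))
        + (LINT s:{1..t}|lborel. (LINT x|lborel. \<nu>^2 / s^2 * u x s * \<Phi> x s))
        = (LINT s:{1..t}|lborel. (LINT x|lborel. \<bar>v x s\<bar> powr p * \<Phi> x s)))))"

end

theory Submission
  imports Defs
begin

text \<open>
  Let \<open>eig\<close> be the positive radial solution of \<open>\<Delta> eig = eig\<close>. Testing the equation with \<open>eig\<close>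
  reduces it to a scalar problem: \<open>U t = \<integral> u eig\<close> has derivative \<open>V t = \<integral> u\<^sub>t eig\<close> and
  \<open>V' + (\<mu> / t) V + (\<nu>\<^sup>2 / t\<^sup>2 - t\<^sup>2\<^sup>m) U = \<integral> |u\<^sub>t|\<^sup>p eig\<close>. Since \<open>u\<close> lives in the light cone and the
  mass of \<open>eig\<close> in a ball of radius \<open>r\<close> is \<open>O(r\<^bsup>(N - 1) / 2\<^esup> e\<^sup>r)\<close>, Hoelder's inequality bounds the
  right-hand side from below by a multiple of
  \<open>|V|\<^sup>p (e\<^bsup>phi_m m t\<^esup> t\<^bsup>(1 + m) (N - 1) / 2\<^esup>)\<^bsup>1 - p\<^esup>\<close>.

  The condition \<open>\<delta> \<ge> 0\<close> factorises the Euler part of the scalar operator over the reals. With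
  \<open>\<alpha>\<close> the smaller root of its indicial polynomial, \<open>t V + \<alpha> U\<close> is positive at \<open>t = 1\<close> by the sign
  condition on the data, and it stays positive together with \<open>U\<close>. After the Liouville transform,
  with \<open>g\<close> the transformed function and \<open>\<gamma>\<close> its derivative in the new time \<open>phi_m m t\<close>, first
  \<open>\<gamma> \<ge> g / 6\<close> for large times; then \<open>Z\<close>, which is \<open>g + \<gamma>\<close> divided by its linear growth, satisfies
  \<open>Z' \<ge> c t\<^bsup>- \<kappa> (p - 1) / 2\<^esup> Z\<^sup>p\<close> with \<open>\<kappa> = (1 + m) (N - 1) - m + \<mu>\<close>. Integrating this inequality
  gives the lifespan bounds. As \<open>V\<close> need not be differentiable, differential inequalities for it
  are understood for the lower right Dini derivative.
\<close>

section \<open>Smooth functions\<close>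

lemma smooth_fun_differentiable: "smooth_fun f \<Longrightarrow> f differentiable (at x)"
  by (erule smooth_fun.cases) blast

lemma smooth_fun_partial:
  "smooth_fun f \<Longrightarrow> i \<in> Basis \<Longrightarrow> smooth_fun (\<lambda>x. frechet_derivative f (at x) i)"
  by (erule smooth_fun.cases) blast

lemma smooth_fun_continuous_on: "smooth_fun f \<Longrightarrow> continuous_on S f"
  by (simp add: differentiable_imp_continuous_on differentiable_at_imp_differentiable_on
      smooth_fun_differentiable)

lemma smooth_fun_DERIV:
  fixes f :: "real \<Rightarrow> real"
  assumes "smooth_fun f"
  shows "(f has_real_derivative deriv f x) (at x)"
  using smooth_fun_differentiable[OF assms] by (simp add: DERIV_deriv_iff_real_differentiable)

lemma frechet_derivative_real:
  fixes f :: "real \<Rightarrow> real"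
  assumes "(f has_real_derivative D) (at x)"
  shows "frechet_derivative f (at x) 1 = D"
  using frechet_derivative_at[OF assms[unfolded has_field_derivative_def], symmetric] by simp

lemma smooth_fun_deriv:
  fixes f :: "real \<Rightarrow> real"
  assumes "smooth_fun f"
  shows "smooth_fun (deriv f)"
  using smooth_fun_partial[OF assms, of 1] frechet_derivative_real[OF smooth_fun_DERIV[OF assms]]
  by simp

lemma smooth_fun_realI:
  fixes f :: "real \<Rightarrow> real"
  assumes "P f"
    and step: "\<And>f. P f \<Longrightarrow> \<exists>f'. P f' \<and> (\<forall>x. (f has_real_derivative f' x) (at x))"
  shows "smooth_fun f"
  using assms(1)
proof (coinduction arbitrary: f)
  case (smooth_fun f)
  then obtain f' where "P f'" and deriv: "\<And>x. (f has_real_derivative f' x) (at x)"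
    using step by blast
  moreover have "(\<lambda>x. frechet_derivative f (at x) 1) = f'"
    using frechet_derivative_real[OF deriv] by auto
  ultimately show ?case
    by (auto simp: real_differentiable_def)
qed

lemma smooth_fun_const: "smooth_fun (\<lambda>x. c)"
proof -
  have "\<exists>c. f = (\<lambda>x. c) \<Longrightarrow> smooth_fun f" for f :: "'a \<Rightarrow> real"
    by (coinduction arbitrary: f) auto
  thus ?thesis by blast
qed

lemma smooth_fun_bounded_linear:
  fixes f :: "'a::euclidean_space \<Rightarrow> real"
  assumes "bounded_linear f"
  shows "smooth_fun f"
proof (rule smooth_fun.intros)
  have deriv: "(f has_derivative f) (at x)" for x
    using assms by (rule bounded_linear_imp_has_derivative)
  show "\<forall>x. f differentiable (at x)"
    using deriv unfolding differentiable_def by blast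
  show "\<forall>i\<in>Basis. smooth_fun (\<lambda>x. frechet_derivative f (at x) i)"
    using frechet_derivative_at[OF deriv, symmetric] by (simp add: smooth_fun_const)
qed

lemma frechet_derivative_add:
  assumes "f differentiable (at x)" "g differentiable (at x)"
  shows "frechet_derivative (\<lambda>x. f x + g x) (at x) =
    (\<lambda>h. frechet_derivative f (at x) h + frechet_derivative g (at x) h)"
  using assms
  by (intro frechet_derivative_at[symmetric] has_derivative_add)
    (simp_all add: frechet_derivative_works)

lemma frechet_derivative_mult:
  fixes f g :: "'a::real_normed_vector \<Rightarrow> 'b::real_normed_algebra"
  assumes "f differentiable (at x)" "g differentiable (at x)"
  shows "frechet_derivative (\<lambda>x. f x * g x) (at x) =
    (\<lambda>h. f x * frechet_derivative g (at x) h + frechet_derivative f (at x) h * g x)"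
  using assms
  by (intro frechet_derivative_at[symmetric] has_derivative_mult)
    (simp_all add: frechet_derivative_works)

lemma frechet_derivative_inverse:
  fixes f :: "'a::real_normed_vector \<Rightarrow> 'b::real_normed_div_algebra"
  assumes "f differentiable (at x)" "f x \<noteq> 0"
  shows "frechet_derivative (\<lambda>x. inverse (f x)) (at x) =
    (\<lambda>h. - (inverse (f x) * frechet_derivative f (at x) h * inverse (f x)))"
  using assms
  by (intro frechet_derivative_at[symmetric] Deriv.has_derivative_inverse)
    (simp_all add: frechet_derivative_works)

lemma has_derivative_compose_real:
  fixes g :: "real \<Rightarrow> real"
  assumes "(g has_real_derivative D) (at (f x))" "(f has_derivative f') (at x)"
  shows "((\<lambda>x. g (f x)) has_derivative (\<lambda>h. D * f' h)) (at x)"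
  using has_derivative_compose[OF assms(2) assms(1)[unfolded has_field_derivative_def]] .

lemma frechet_derivative_compose_real:
  fixes g :: "real \<Rightarrow> real"
  assumes "(g has_real_derivative D) (at (f x))" "f differentiable (at x)"
  shows "frechet_derivative (\<lambda>x. g (f x)) (at x) = (\<lambda>h. D * frechet_derivative f (at x) h)"
  using assms
  by (intro frechet_derivative_at[symmetric] has_derivative_compose_real)
    (simp_all add: frechet_derivative_works)

text \<open>The class of smooth functions is closed under the algebraic operations only up to further such
  operations on the derivatives, so the coinduction runs over the whole generated algebra.\<close>

inductive smooth_alg :: "('a::euclidean_space \<Rightarrow> real) \<Rightarrow> bool" where
  base: "smooth_fun f \<Longrightarrow> smooth_alg f"
| add: "smooth_alg f \<Longrightarrow> smooth_alg g \<Longrightarrow> smooth_alg (\<lambda>x. f x + g x)"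
| mult: "smooth_alg f \<Longrightarrow> smooth_alg g \<Longrightarrow> smooth_alg (\<lambda>x. f x * g x)"
| compose: "smooth_fun (g :: real \<Rightarrow> real) \<Longrightarrow> smooth_alg f \<Longrightarrow> smooth_alg (\<lambda>x. g (f x))"
| inverse: "smooth_alg f \<Longrightarrow> (\<And>x. f x \<noteq> 0) \<Longrightarrow> smooth_alg (\<lambda>x. inverse (f x))"

lemma smooth_alg_uminus: "smooth_alg f \<Longrightarrow> smooth_alg (\<lambda>x. - f x)"
  using smooth_alg.mult[OF smooth_alg.base[OF smooth_fun_const[of "-1"]], of f] by simp

lemma smooth_alg_step:
  assumes "smooth_alg f"
  shows "(\<forall>x. f differentiable (at x)) \<and>
    (\<forall>i\<in>Basis. smooth_alg (\<lambda>x. frechet_derivative f (at x) i))"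
  using assms
proof induction
  case (base f)
  then show ?case
    by (auto intro: smooth_alg.base smooth_fun_differentiable smooth_fun_partial)
next
  case (add f g)
  then show ?case
    by (auto simp: frechet_derivative_add intro: smooth_alg.add)
next
  case (mult f g)
  then show ?case
    by (auto simp: frechet_derivative_mult intro!: smooth_alg.add smooth_alg.mult)
next
  case (compose g f)
  have "(\<lambda>x. g (f x)) differentiable (at x)" for x
    using compose frechet_derivative_works
    by (intro differentiableI[OF has_derivative_compose_real[OF smooth_fun_DERIV[of g]]]) blast+
  moreover have "smooth_alg (\<lambda>x. deriv g (f x) * frechet_derivative f (at x) i)"
    if "i \<in> Basis" for i
    using that compose
    by (intro smooth_alg.mult smooth_alg.compose[of "deriv g" f] smooth_fun_deriv) auto
  ultimately show ?case
    using compose by (simp add: frechet_derivative_compose_real[OF smooth_fun_DERIV])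
next
  case (inverse f)
  have "smooth_alg (\<lambda>x. - (inverse (f x) * frechet_derivative f (at x) i * inverse (f x)))"
    if "i \<in> Basis" for i
    using that inverse by (intro smooth_alg_uminus smooth_alg.mult smooth_alg.inverse) auto
  with inverse show ?case
    by (simp add: frechet_derivative_inverse differentiable_inverse)
qed

lemma smooth_alg_imp_smooth_fun: "smooth_alg f \<Longrightarrow> smooth_fun f"
  by (coinduction arbitrary: f) (use smooth_alg_step in auto)

lemma smooth_fun_add: "smooth_fun f \<Longrightarrow> smooth_fun g \<Longrightarrow> smooth_fun (\<lambda>x. f x + g x)"
  by (rule smooth_alg_imp_smooth_fun) (auto intro: smooth_alg.intros)

lemma smooth_fun_mult: "smooth_fun f \<Longrightarrow> smooth_fun g \<Longrightarrow> smooth_fun (\<lambda>x. f x * g x)"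
  by (rule smooth_alg_imp_smooth_fun) (auto intro: smooth_alg.intros)

lemma smooth_fun_compose:
  fixes g :: "real \<Rightarrow> real"
  shows "smooth_fun g \<Longrightarrow> smooth_fun f \<Longrightarrow> smooth_fun (\<lambda>x. g (f x))"
  by (rule smooth_alg_imp_smooth_fun) (auto intro: smooth_alg.intros)

lemma smooth_fun_inverse:
  "smooth_fun f \<Longrightarrow> (\<And>x. f x \<noteq> 0) \<Longrightarrow> smooth_fun (\<lambda>x. inverse (f x))"
  by (rule smooth_alg_imp_smooth_fun) (auto intro: smooth_alg.intros)

lemma smooth_fun_sum:
  assumes "\<And>i. i \<in> I \<Longrightarrow> smooth_fun (f i)"
  shows "smooth_fun (\<lambda>x. \<Sum>i\<in>I. f i x)"
  using assms
  by (induction I rule: infinite_finite_induct) (auto intro: smooth_fun_const smooth_fun_add)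

lemma smooth_fun_inner_self: "smooth_fun (\<lambda>x. x \<bullet> x)"
  unfolding euclidean_inner[of x x for x]
  by (intro smooth_fun_sum smooth_fun_mult smooth_fun_bounded_linear bounded_linear_inner_left)

lemma smooth_fun_frechet_derivative:
  assumes "smooth_fun f"
  shows "smooth_fun (\<lambda>x. frechet_derivative f (at x) h)"
proof -
  have linear: "linear (frechet_derivative f (at x))" for x
    by (rule linear_frechet_derivative[OF smooth_fun_differentiable[OF assms]])
  have "frechet_derivative f (at x) h = frechet_derivative f (at x) (\<Sum>b\<in>Basis. (h \<bullet> b) *\<^sub>R b)" for x
    by (simp add: euclidean_representation)
  then have "frechet_derivative f (at x) h =
      (\<Sum>b\<in>Basis. (h \<bullet> b) * frechet_derivative f (at x) b)" for x
    by (simp only: linear_sum[OF linear] linear_scale[OF linear] real_scaleR_def)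
  moreover have "smooth_fun (\<lambda>x. \<Sum>b\<in>Basis. (h \<bullet> b) * frechet_derivative f (at x) b)"
    by (intro smooth_fun_sum smooth_fun_mult smooth_fun_const smooth_fun_partial assms)
  ultimately show ?thesis
    by simp
qed

lemma has_derivative_compose_linear:
  assumes "bounded_linear L" "f differentiable (at (L x))"
  shows "((\<lambda>x. f (L x)) has_derivative (\<lambda>h. frechet_derivative f (at (L x)) (L h))) (at x)"
  using has_derivative_compose[OF bounded_linear_imp_has_derivative[OF assms(1)]] assms(2)
  by (simp add: frechet_derivative_works)

lemma smooth_fun_compose_linear:
  fixes L :: "'a::euclidean_space \<Rightarrow> 'b::euclidean_space"
  assumes linear: "bounded_linear L" and "smooth_fun f"
  shows "smooth_fun (\<lambda>x. f (L x))"
  using assms(2)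
proof (coinduction arbitrary: f)
  case (smooth_fun f)
  have deriv: "((\<lambda>x. f (L x)) has_derivative
      (\<lambda>h. frechet_derivative f (at (L x)) (L h))) (at x)" for x
    by (rule has_derivative_compose_linear[OF linear smooth_fun_differentiable[OF smooth_fun]])
  have "\<exists>g. (\<lambda>x. frechet_derivative (\<lambda>x. f (L x)) (at x) i) = (\<lambda>x. g (L x)) \<and> smooth_fun g" for i
    using smooth_fun_frechet_derivative[OF smooth_fun, of "L i"]
    by (intro exI[of _ "\<lambda>y. frechet_derivative f (at y) (L i)"])
      (simp add: frechet_derivative_at[OF deriv, symmetric])
  with deriv show ?case
    by (auto simp: differentiable_def)
qed

lemma poly_exp_inverse_tendsto_0:
  "((\<lambda>s::real. poly q (inverse s) * exp (- inverse s)) \<longlongrightarrow> 0) (at_right 0)"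
proof -
  have "((\<lambda>s::real. inverse s ^ k * exp (- inverse s)) \<longlongrightarrow> 0) (at_right 0)" for k
    using filterlim_compose[OF tendsto_power_div_exp_0 filterlim_inverse_at_top_right, of k]
    by (simp add: exp_minus divide_inverse)
  hence "((\<lambda>s::real. \<Sum>i\<le>degree q. coeff q i * (inverse s ^ i * exp (- inverse s))) \<longlongrightarrow> 0)
      (at_right 0)"
    by (intro tendsto_null_sum tendsto_mult_right_zero)
  thus ?thesis
    by (simp add: poly_altdef sum_distrib_right mult.assoc)
qed

definition exp_flat :: "real poly \<Rightarrow> real \<Rightarrow> real" where
  "exp_flat q s = (if s > 0 then poly q (inverse s) * exp (- inverse s) else 0)"

lemma exp_flat_DERIV:
  "(exp_flat q has_real_derivative exp_flat ([:0, 0, 1:] * (q - pderiv q)) s) (at s)"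
proof (cases s "0::real" rule: linorder_cases)
  case less
  have "\<forall>\<^sub>F x in nhds s. exp_flat q x = 0"
    using eventually_nhds_in_open[of "{..<0}" s] less
    by (auto simp: exp_flat_def elim!: eventually_mono)
  with less show ?thesis
    by (subst DERIV_cong_ev[OF refl _ refl, where g = "\<lambda>_. 0"]) (auto simp: exp_flat_def)
next
  case greater
  have ev: "\<forall>\<^sub>F x in nhds s. exp_flat q x = poly q (inverse x) * exp (- inverse x)"
    using eventually_nhds_in_open[of "{0<..}" s] greater
    by (auto simp: exp_flat_def elim!: eventually_mono)
  have "((\<lambda>x. poly q (inverse x) * exp (- inverse x)) has_real_derivative
      exp_flat ([:0, 0, 1:] * (q - pderiv q)) s) (at s)"
    using greater
    by (auto intro!: derivative_eq_intros DERIV_chain2[OF poly_DERIV]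
        simp: exp_flat_def algebra_simps power2_eq_square divide_simps)
  then show ?thesis
    by (subst DERIV_cong_ev[OF refl ev refl])
next
  case equal
  have "((\<lambda>h. exp_flat q h / h) \<longlongrightarrow> 0) (at_left 0)"
    by (rule tendsto_eventually) (auto simp: exp_flat_def eventually_at_filter)
  moreover have "((\<lambda>h. exp_flat q h / h) \<longlongrightarrow> 0) (at_right 0)"
  proof (rule Lim_transform_eventually[OF poly_exp_inverse_tendsto_0[of "[:0,1:] * q"]])
    show "\<forall>\<^sub>F s in at_right 0. poly ([:0, 1:] * q) (inverse s) * exp (- inverse s) =
        exp_flat q s / s"
      by (auto simp: exp_flat_def eventually_at_filter divide_inverse)
  qed
  ultimately have "((\<lambda>h. exp_flat q h / h) \<longlongrightarrow> 0) (at 0)"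
    by (rule filterlim_split_at)
  with equal show ?thesis
    by (simp add: DERIV_def exp_flat_def[of _ 0])
qed

lemma smooth_fun_exp_flat: "smooth_fun (exp_flat q)"
  by (rule smooth_fun_realI[where P = "\<lambda>f. \<exists>q. f = exp_flat q"]) (use exp_flat_DERIV in blast)+

lemma smooth_cutoff_exists:
  fixes a b :: real
  assumes "a < b"
  obtains \<zeta> :: "real \<Rightarrow> real" where "smooth_fun \<zeta>" "\<And>x. x \<le> a \<Longrightarrow> \<zeta> x = 1"
    "\<And>x. b \<le> x \<Longrightarrow> \<zeta> x = 0"
proof -
  define f where "f = (\<lambda>x. exp_flat 1 (b + - 1 * x))"
  define g where "g = (\<lambda>x. exp_flat 1 (- a + 1 * x))"
  have "smooth_fun (\<lambda>x. exp_flat 1 (c + d * x))" for c d :: real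
    by (intro smooth_fun_compose[OF smooth_fun_exp_flat] smooth_fun_add smooth_fun_const
        smooth_fun_bounded_linear bounded_linear_mult_right)
  hence smooth: "smooth_fun f" "smooth_fun g"
    unfolding f_def g_def by blast+
  have nonneg: "f x \<ge> 0" "g x \<ge> 0" for x
    by (auto simp: f_def g_def exp_flat_def)
  have pos: "f x + g x > 0" for x
    using assms nonneg[of x] by (cases "x > a") (auto simp: f_def g_def exp_flat_def add_pos_nonneg)
  show ?thesis
  proof (rule that[of "\<lambda>x. f x * inverse (f x + g x)"])
    show "smooth_fun (\<lambda>x. f x * inverse (f x + g x))"
      by (intro smooth_fun_mult smooth_fun_inverse smooth_fun_add smooth) (metis pos less_irrefl)
    show "f x * inverse (f x + g x) = 1" if "x \<le> a" for x
      using that pos[of x] by (auto simp: g_def exp_flat_def)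
    show "f x * inverse (f x + g x) = 0" if "b \<le> x" for x
      using that by (auto simp: f_def exp_flat_def)
  qed
qed

lemma smooth_bump_exists:
  fixes a b c d :: real
  assumes "a < b" "c < d"
  obtains \<eta> :: "real \<Rightarrow> real" where "smooth_fun \<eta>" "\<And>x. x \<le> a \<Longrightarrow> \<eta> x = 0"
    "\<And>x. b \<le> x \<Longrightarrow> x \<le> c \<Longrightarrow> \<eta> x = 1" "\<And>x. d \<le> x \<Longrightarrow> \<eta> x = 0"
proof -
  obtain \<zeta> :: "real \<Rightarrow> real" where \<zeta>_cutoff: "smooth_fun \<zeta>" "\<And>x. x \<le> - b \<Longrightarrow> \<zeta> x = 1"
    "\<And>x. - a \<le> x \<Longrightarrow> \<zeta> x = 0"
    by (rule smooth_cutoff_exists[of "- b" "- a"]) (use assms(1) in auto)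
  obtain \<xi> :: "real \<Rightarrow> real" where \<xi>_cutoff: "smooth_fun \<xi>" "\<And>x. x \<le> c \<Longrightarrow> \<xi> x = 1"
    "\<And>x. d \<le> x \<Longrightarrow> \<xi> x = 0"
    by (rule smooth_cutoff_exists[OF assms(2)]) blast
  have "smooth_fun (\<lambda>x. \<zeta> (- x) * \<xi> x)"
    by (intro smooth_fun_mult smooth_fun_compose[OF \<zeta>_cutoff(1) smooth_fun_bounded_linear]
        \<xi>_cutoff(1) bounded_linear_minus bounded_linear_ident)
  then show ?thesis
    by (rule that) (use \<zeta>_cutoff \<xi>_cutoff in auto)
qed

lemma smooth_fun_power_series:
  fixes c :: "nat \<Rightarrow> real"
  assumes "\<And>x. summable (\<lambda>n. c n * x ^ n)"
  shows "smooth_fun (\<lambda>x. \<Sum>n. c n * x ^ n)"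
proof (rule smooth_fun_realI[where P = "\<lambda>f. \<exists>c::nat \<Rightarrow> real.
      (\<forall>x. summable (\<lambda>n. c n * x ^ n)) \<and> f = (\<lambda>x. \<Sum>n. c n * x ^ n)"])
  fix f :: "real \<Rightarrow> real"
  assume "\<exists>c::nat \<Rightarrow> real. (\<forall>x. summable (\<lambda>n. c n * x ^ n)) \<and> f = (\<lambda>x. \<Sum>n. c n * x ^ n)"
  then obtain c :: "nat \<Rightarrow> real" where summable_c: "\<And>x. summable (\<lambda>n. c n * x ^ n)"
    and f_eq: "f = (\<lambda>x. \<Sum>n. c n * x ^ n)" by blast
  show "\<exists>f'. (\<exists>c::nat \<Rightarrow> real. (\<forall>x. summable (\<lambda>n. c n * x ^ n)) \<and> f' = (\<lambda>x. \<Sum>n. c n * x ^ n)) \<and>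
      (\<forall>x. (f has_real_derivative f' x) (at x))"
    unfolding f_eq
    using termdiffs_strong_converges_everywhere[OF summable_c] termdiff_converges_all[OF summable_c]
    by blast
qed (use assms in blast)

section \<open>The radial eigenfunction of the Laplacian\<close>

fun radial_coeff :: "nat \<Rightarrow> nat \<Rightarrow> real" where
  "radial_coeff N 0 = 1"
| "radial_coeff N (Suc k) = radial_coeff N k / (real (k + 1) * (4 * real k + 2 * real N))"

definition radial_fun :: "nat \<Rightarrow> real \<Rightarrow> real" where
  "radial_fun N z = (\<Sum>k. radial_coeff N k * z ^ k)"

lemma radial_coeff_pos: "N > 0 \<Longrightarrow> radial_coeff N k > 0"
  by (induction k) (auto intro!: divide_pos_pos mult_pos_pos add_nonneg_pos)

lemma radial_coeff_le:
  assumes "N > 0"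
  shows "radial_coeff N k \<le> inverse (fact k)"
proof (induction k)
  case (Suc k)
  have "real (k + 1) * 1 \<le> real (k + 1) * (4 * real k + 2 * real N)"
    using assms by (intro mult_left_mono) auto
  then have "radial_coeff N k / (real (k + 1) * (4 * real k + 2 * real N))
      \<le> inverse (fact k) / (real (k + 1) * 1)"
    using Suc radial_coeff_pos[OF assms, of k] by (intro frac_le) auto
  then show ?case
    by (simp add: divide_inverse)
qed simp

lemma summable_radial_coeff:
  assumes "N > 0"
  shows "summable (\<lambda>k. radial_coeff N k * z ^ k)"
proof (rule summable_comparison_test'[OF summable_exp, of 0])
  fix k :: nat
  show "norm (radial_coeff N k * z ^ k) \<le> inverse (fact k) * \<bar>z\<bar> ^ k"
    using radial_coeff_pos[OF assms, of k] radial_coeff_le[OF assms, of k]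
    by (simp add: abs_mult power_abs mult_right_mono)
qed

lemma radial_fun_pos:
  assumes "N > 0" "z \<ge> 0"
  shows "radial_fun N z > 0"
  unfolding radial_fun_def
  by (rule suminf_pos2[of _ 0])
    (use radial_coeff_pos[OF assms(1), THEN less_imp_le] assms(2) in
      \<open>auto intro!: mult_nonneg_nonneg summable_radial_coeff[OF assms(1)]\<close>)

lemma radial_fun_mono:
  assumes "N > 0" "0 \<le> y" "y \<le> z"
  shows "radial_fun N y \<le> radial_fun N z"
  unfolding radial_fun_def
  using radial_coeff_pos[OF assms(1), THEN less_imp_le] assms
  by (intro suminf_le summable_radial_coeff[OF assms(1)]) (auto intro!: mult_left_mono power_mono)

lemma smooth_radial_fun: "N > 0 \<Longrightarrow> smooth_fun (radial_fun N)"
  using smooth_fun_power_series[OF summable_radial_coeff] by (simp add: radial_fun_def[abs_def])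

lemma sums_power_series_shift:
  fixes c :: "nat \<Rightarrow> real"
  assumes "summable (\<lambda>n. diffs c n * z ^ n)"
  shows "(\<lambda>n. real n * c n * z ^ n) sums (z * (\<Sum>n. diffs c n * z ^ n))"
proof -
  have "(\<lambda>n. z * (diffs c n * z ^ n)) sums (z * (\<Sum>n. diffs c n * z ^ n))"
    using assms by (intro sums_mult summable_sums)
  also have "(\<lambda>n. z * (diffs c n * z ^ n)) = (\<lambda>n. real (Suc n) * c (Suc n) * z ^ Suc n)"
    by (auto simp: diffs_def mult_ac)
  finally show ?thesis
    by (subst (asm) sums_Suc_iff) simp
qed

lemma radial_fun_ode:
  assumes "N > 0"
  shows "4 * z * deriv (deriv (radial_fun N)) z + 2 * real N * deriv (radial_fun N) z =
      radial_fun N z"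
proof -
  define c where "c = radial_coeff N"
  have summable_c: "summable (\<lambda>n. c n * x ^ n)" for x
    unfolding c_def by (rule summable_radial_coeff[OF assms])
  note summable_diffs_c = termdiff_converges_all[OF summable_c]
  have deriv_series: "deriv (\<lambda>x. \<Sum>n. a n * x ^ n) = (\<lambda>x. \<Sum>n. diffs a n * x ^ n)"
    if "\<And>x. summable (\<lambda>n. a n * x ^ n)" for a :: "nat \<Rightarrow> real"
    using termdiffs_strong_converges_everywhere[OF that] DERIV_imp_deriv by blast
  have radial_fun_eq: "radial_fun N = (\<lambda>x. \<Sum>n. c n * x ^ n)"
    by (auto simp: radial_fun_def c_def)
  have "(\<lambda>n. 4 * (real n * diffs c n * z ^ n) + 2 * real N * (diffs c n * z ^ n)) sums
      (4 * (z * (\<Sum>n. diffs (diffs c) n * z ^ n)) + 2 * real N * (\<Sum>n. diffs c n * z ^ n))"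
    by (intro sums_add sums_mult sums_power_series_shift summable_sums summable_diffs_c
        termdiff_converges_all[OF summable_diffs_c])
  also have "(\<lambda>n. 4 * (real n * diffs c n * z ^ n) + 2 * real N * (diffs c n * z ^ n)) =
      (\<lambda>n. c n * z ^ n)"
  proof
    fix n
    have "c n = (real n + 1) * (4 * real n + 2 * real N) * c (Suc n)"
      using assms by (simp add: c_def add_nonneg_eq_0_iff add.commute)
    then show "4 * (real n * diffs c n * z ^ n) + 2 * real N * (diffs c n * z ^ n) = c n * z ^ n"
      by (simp add: diffs_def algebra_simps)
  qed
  finally have "radial_fun N z =
      4 * (z * (\<Sum>n. diffs (diffs c) n * z ^ n)) + 2 * real N * (\<Sum>n. diffs c n * z ^ n)"
    unfolding radial_fun_eq by (rule sums_unique[symmetric])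
  then show ?thesis
    by (simp add: radial_fun_eq deriv_series summable_c summable_diffs_c mult.assoc)
qed

text \<open>Says that \<open>radial_coeff N k * (2 * k)!\<close> decays like \<open>k\<close> to the power \<open>- (N - 1) / 2\<close>, which is
  where the polynomial factor in the growth of \<open>radial_fun N (r\<^sup>2)\<close> comes from.\<close>

lemma radial_coeff_square_le:
  assumes "N > 0"
  shows "(radial_coeff N k)\<^sup>2 * (fact (2 * k) * fact (2 * k + (N - 1))) \<le> fact (N - 1)"
proof (induction k)
  case (Suc k)
  define x j where "x = 2 * real k" and "j = real (N - 1)"
  define c c' where "c = radial_coeff N k" and "c' = radial_coeff N (Suc k)"
  define F :: real where "F = fact (2 * k) * fact (2 * k + (N - 1))"
  have nonneg: "x \<ge> 0" "j \<ge> 0" "F \<ge> 0"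
    by (auto simp: x_def j_def F_def)
  have c_eq: "c' * ((x + 2) * (x + 1 + j)) = c"
    using assms nonneg
    by (simp add: c_def c'_def x_def j_def of_nat_diff field_simps add_nonneg_eq_0_iff)
  have "fact (2 * Suc k) * fact (2 * Suc k + (N - 1)) =
      ((x + 2) * (x + 1 + j)) * ((x + 1) * (x + 2 + j)) * F"
    by (simp add: F_def x_def j_def algebra_simps)
  then have "c'\<^sup>2 * (fact (2 * Suc k) * fact (2 * Suc k + (N - 1))) =
      c'\<^sup>2 * (((x + 2) * (x + 1 + j)) * ((x + 1) * (x + 2 + j)) * F)"
    by simp
  also have "\<dots> \<le> c'\<^sup>2 * (((x + 2) * (x + 1 + j)) * ((x + 2) * (x + 1 + j)) * F)"
    using nonneg by (intro mult_left_mono mult_right_mono) (auto simp: algebra_simps)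
  also have "\<dots> = c\<^sup>2 * F"
    unfolding c_eq[symmetric] by (simp add: power2_eq_square mult_ac)
  also have "\<dots> \<le> fact (N - 1)"
    using Suc by (simp add: c_def F_def)
  finally show ?case
    by (simp only: c'_def)
qed simp

lemma radial_term_le:
  assumes "N > 0" "r \<ge> 0"
  shows "radial_coeff N k * (r\<^sup>2) ^ k * sqrt (r ^ (N - 1)) \<le>
    sqrt (fact (N - 1)) *
      ((r ^ (2 * k) / fact (2 * k) + r ^ (2 * k + (N - 1)) / fact (2 * k + (N - 1))) / 2)"
proof -
  define x y where "x = r ^ (2 * k) / fact (2 * k)"
    and "y = r ^ (2 * k + (N - 1)) / fact (2 * k + (N - 1))"
  have nonneg: "x \<ge> 0" "y \<ge> 0"
    using assms by (auto simp: x_def y_def)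
  have "(radial_coeff N k * (r\<^sup>2) ^ k * sqrt (r ^ (N - 1)))\<^sup>2 =
      (radial_coeff N k)\<^sup>2 * (fact (2 * k) * fact (2 * k + (N - 1))) * (x * y)"
    using assms(2)
    by (simp add: x_def y_def power_mult_distrib power_add power2_eq_square power_mult)
  also have "\<dots> \<le> fact (N - 1) * (x * y)"
    using radial_coeff_square_le[OF assms(1)] nonneg by (intro mult_right_mono) auto
  finally have "radial_coeff N k * (r\<^sup>2) ^ k * sqrt (r ^ (N - 1)) \<le> sqrt (fact (N - 1) * (x * y))"
    by (rule real_le_rsqrt)
  also have "\<dots> \<le> sqrt (fact (N - 1)) * ((x + y) / 2)"
    unfolding real_sqrt_mult[of "fact (N - 1)"]
    using arith_geo_mean_sqrt[OF nonneg] by (intro mult_left_mono) auto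
  finally show ?thesis
    by (simp only: x_def y_def)
qed

lemma
  fixes r :: real
  assumes "inj h" "r \<ge> 0"
  shows summable_exp_reindex: "summable (\<lambda>k. r ^ h k / fact (h k))"
    and suminf_exp_reindex_le: "(\<Sum>k. r ^ h k / fact (h k)) \<le> exp r"
proof -
  have exp: "(\<lambda>n. r ^ n / fact n) sums exp r"
    using exp_converges[of r] by (simp add: divide_inverse mult.commute)
  note nonneg = divide_nonneg_pos[OF zero_le_power[OF assms(2)] fact_gt_zero]
  show "summable (\<lambda>k. r ^ h k / fact (h k))"
    using summable_reindex[OF sums_summable[OF exp] assms(1) nonneg] by (simp add: o_def)
  show "(\<Sum>k. r ^ h k / fact (h k)) \<le> exp r"
    using suminf_reindex_mono[OF sums_summable[OF exp] assms(1) nonneg] sums_unique[OF exp]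
    by (simp add: o_def)
qed

lemma radial_fun_le:
  assumes "N > 0" "r \<ge> 0"
  shows "radial_fun N (r\<^sup>2) * sqrt (r ^ (N - 1)) \<le> sqrt (fact (N - 1)) * exp r"
proof -
  define e where "e j k = r ^ (2 * k + j) / fact (2 * k + j)" for j k
  have "inj (\<lambda>k. 2 * k + j)" for j :: nat
    by (auto simp: inj_def)
  note summable_e = summable_exp_reindex[OF this assms(2), folded e_def]
    and suminf_e_le = suminf_exp_reindex_le[OF this assms(2), folded e_def]
  have "radial_fun N (r\<^sup>2) * sqrt (r ^ (N - 1)) =
      (\<Sum>k. radial_coeff N k * (r\<^sup>2) ^ k * sqrt (r ^ (N - 1)))"
    unfolding radial_fun_def by (rule suminf_mult2[OF summable_radial_coeff[OF assms(1)]])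
  also have "\<dots> \<le> (\<Sum>k. sqrt (fact (N - 1)) * ((e 0 k + e (N - 1) k) / 2))"
    using radial_term_le[OF assms] summable_radial_coeff[OF assms(1)]
    by (intro suminf_le summable_mult summable_mult2 summable_divide summable_add summable_e)
      (simp_all add: e_def)
  also have "\<dots> = sqrt (fact (N - 1)) * ((suminf (e 0) + suminf (e (N - 1))) / 2)"
    by (simp only: suminf_mult suminf_divide suminf_add summable_divide summable_add summable_e)
  also have "\<dots> \<le> sqrt (fact (N - 1)) * exp r"
    using suminf_e_le[of 0] suminf_e_le[of "N - 1"] by (intro mult_left_mono) auto
  finally show ?thesis .
qed

definition eig :: "'a::euclidean_space \<Rightarrow> real" where
  "eig x = radial_fun DIM('a) (x \<bullet> x)"

lemma eig_pos: "eig x > 0"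
  by (simp add: eig_def radial_fun_pos DIM_positive)

lemma eig_le:
  fixes x :: "'a::euclidean_space"
  assumes "norm x \<le> r"
  shows "eig x \<le> radial_fun DIM('a) (r\<^sup>2)"
  unfolding eig_def using assms
  by (intro radial_fun_mono DIM_positive) (auto simp: dot_square_norm intro: power_mono)

lemma continuous_on_eig: "continuous_on S eig"
  unfolding eig_def[abs_def]
  by (intro continuous_on_compose2[OF smooth_fun_continuous_on[OF
          smooth_radial_fun[OF DIM_positive]]] continuous_intros) auto

lemma borel_measurable_eig [measurable]: "eig \<in> borel_measurable borel"
  by (rule borel_measurable_continuous_onI[OF continuous_on_eig])

lemma set_integrable_eig: "compact K \<Longrightarrow> set_integrable lborel K eig"
  unfolding set_integrable_def by (intro borel_integrable_compact continuous_on_eig)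

definition ball_eig :: "real \<Rightarrow> 'a::euclidean_space \<Rightarrow> real" where
  "ball_eig r x = indicator (cball 0 r) x * eig x"

lemma ball_eig_nonneg: "ball_eig r x \<ge> 0"
  by (simp add: ball_eig_def less_imp_le[OF eig_pos])

lemma ball_eig_inside: "norm x \<le> r \<Longrightarrow> ball_eig r x = eig x"
  by (simp add: ball_eig_def)

lemma borel_measurable_ball_eig [measurable]: "ball_eig r \<in> borel_measurable borel"
  unfolding ball_eig_def[abs_def]
  by (intro borel_measurable_times borel_measurable_indicator borel_measurable_eig) simp

lemma integrable_ball_eig: "integrable lborel (ball_eig r)"
  using set_integrable_eig[OF compact_cball, of 0 r]
  by (simp add: set_integrable_def ball_eig_def[abs_def])

definition eig_mass :: "'a::euclidean_space itself \<Rightarrow> real \<Rightarrow> real" where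
  "eig_mass _ r = (LINT x|lborel. ball_eig r (x :: 'a))"

lemma eig_mass_eq_set_integral:
  "eig_mass TYPE('a::euclidean_space) r = (LINT x:cball 0 r|lborel. eig (x :: 'a))"
  by (simp add: eig_mass_def ball_eig_def set_lebesgue_integral_def)

lemma eig_mass_mono: "r \<le> s \<Longrightarrow> eig_mass TYPE('a::euclidean_space) r \<le> eig_mass TYPE('a) s"
  unfolding eig_mass_def
  by (rule integral_mono[OF integrable_ball_eig integrable_ball_eig])
    (auto simp: ball_eig_def indicator_def less_imp_le[OF eig_pos])

lemma integral_pos_if_pos_on_ball:
  fixes f :: "'a::euclidean_space \<Rightarrow> real"
  assumes int: "integrable lborel f" and nonneg: "AE x in lborel. 0 \<le> f x"
    and pos: "AE x in lborel. x \<in> ball c r \<longrightarrow> 0 < f x" and r_pos: "r > 0"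
  shows "0 < (LINT x|lborel. f x)"
proof -
  have "(LINT x|lborel. f x) \<noteq> 0"
  proof
    assume "(LINT x|lborel. f x) = 0"
    then have "AE x in lborel. f x = 0"
      by (simp add: integral_nonneg_eq_0_iff_AE[OF int nonneg])
    with pos have "AE x in lborel. x \<notin> ball c r"
      by eventually_elim auto
    then have "emeasure lborel (ball c r) = 0"
      by (subst AE_iff_measurable[symmetric, of _ _ "\<lambda>x. x \<notin> ball c r"]) (auto simp del: mem_ball)
    moreover have "unit_ball_vol (real DIM('a)) * r ^ DIM('a) > 0"
      using r_pos by simp
    ultimately show False
      using r_pos by (simp add: emeasure_ball ennreal_eq_0_iff)
  qed
  with integral_nonneg_AE[OF nonneg] show ?thesis
    by simp
qed

lemma eig_mass_pos: "r > 0 \<Longrightarrow> eig_mass TYPE('a::euclidean_space) r > 0"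
  unfolding eig_mass_def
  by (rule integral_pos_if_pos_on_ball[OF integrable_ball_eig, where c = 0 and r = r])
    (auto simp: ball_eig_nonneg ball_eig_inside eig_pos)

lemma power_diff_le_mult:
  fixes x y :: "'a::linordered_idom"
  assumes "0 \<le> y" "y \<le> x"
  shows "x ^ n - y ^ n \<le> of_nat n * (x - y) * x ^ (n - 1)"
proof (cases n)
  case (Suc k)
  have "(\<Sum>i<Suc k. x ^ i * y ^ (k - i)) \<le> (\<Sum>i<Suc k. x ^ i * x ^ (k - i))"
    using assms by (intro sum_mono mult_left_mono power_mono) auto
  also have "\<dots> = (\<Sum>i<Suc k. x ^ k)"
    by (intro sum.cong) (simp_all add: power_add[symmetric])
  finally have "(x - y) * (\<Sum>i<Suc k. x ^ i * y ^ (k - i)) \<le> (x - y) * (of_nat (Suc k) * x ^ k)"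
    using assms
    by (intro mult_left_mono) (auto simp only: sum_constant card_lessThan diff_ge_0_iff_ge)
  then show ?thesis
    unfolding Suc diff_power_eq_sum by (simp add: mult_ac)
qed simp

lemma measure_cball_shell_le:
  assumes "0 \<le> r" "r \<le> s"
  shows "measure lborel (cball (0 :: 'a::euclidean_space) s - cball 0 r)
    \<le> unit_ball_vol DIM('a) * (real DIM('a) * (s - r) * s ^ (DIM('a) - 1))"
proof -
  have "measure lborel (cball (0 :: 'a) s - cball 0 r) =
      unit_ball_vol DIM('a) * (s ^ DIM('a) - r ^ DIM('a))"
    using assms emeasure_lborel_cball_finite[of "0 :: 'a" s]
    by (subst measure_Diff) (auto simp: content_cball right_diff_distrib)
  also have "\<dots> \<le> unit_ball_vol DIM('a) * (real DIM('a) * (s - r) * s ^ (DIM('a) - 1))"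
    using power_diff_le_mult[OF assms, of "DIM('a)"] by (intro mult_left_mono) auto
  finally show ?thesis .
qed

definition eig_mass_const :: "'a::euclidean_space itself \<Rightarrow> real" where
  "eig_mass_const _ = unit_ball_vol DIM('a) * real DIM('a) * sqrt (fact (DIM('a) - 1))"

lemma eig_mass_const_pos: "eig_mass_const TYPE('a::euclidean_space) > 0"
  by (simp add: eig_mass_const_def)

lemma eig_mass_diff_le:
  assumes "0 \<le> r" "r \<le> s"
  shows "eig_mass TYPE('a::euclidean_space) s - eig_mass TYPE('a) r
    \<le> eig_mass_const TYPE('a) * (s - r) * (sqrt (s ^ (DIM('a) - 1)) * exp s)"
proof -
  define A where "A = cball (0 :: 'a) s - cball 0 r"
  define P where "P = s ^ (DIM('a) - 1)"
  have finite_A: "emeasure lborel A < \<infinity>"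
    using emeasure_mono[of A "cball 0 s" lborel] emeasure_lborel_cball_finite[of "0 :: 'a" s]
    by (auto simp: A_def)
  have eig_A: "set_integrable lborel A (eig :: 'a \<Rightarrow> real)"
    using set_integrable_eig[OF compact_cball, of "0 :: 'a" s]
    by (rule set_integrable_subset) (auto simp: A_def)
  have "cball 0 s = cball (0 :: 'a) r \<union> A"
    using assms by (auto simp: A_def)
  then have "eig_mass TYPE('a) s - eig_mass TYPE('a) r = (LINT x:A|lborel. eig x)"
    using set_integral_Un[OF _ set_integrable_eig[OF compact_cball] eig_A, of 0 r]
    by (simp add: eig_mass_eq_set_integral A_def)
  also have "\<dots> \<le> (LINT x:A|lborel. radial_fun DIM('a) (s\<^sup>2))"
    by (intro set_integral_mono eig_A eig_le)
      (use finite_A in \<open>auto simp: A_def set_integrable_def\<close>)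
  also have "\<dots> = radial_fun DIM('a) (s\<^sup>2) * measure lborel A"
    using finite_A by (subst set_integral_const) (auto simp: A_def)
  also have "\<dots> \<le> radial_fun DIM('a) (s\<^sup>2) * (unit_ball_vol DIM('a) * (real DIM('a) * (s - r) * P))"
    unfolding A_def P_def using radial_fun_pos[OF DIM_positive[where 'a = 'a], of "s\<^sup>2"] assms
    by (intro mult_left_mono measure_cball_shell_le) auto
  also have "\<dots> =
      unit_ball_vol DIM('a) * real DIM('a) * (s - r) * sqrt P * (radial_fun DIM('a) (s\<^sup>2) * sqrt P)"
    using assms by (simp add: P_def)
  also have "\<dots>
      \<le> unit_ball_vol DIM('a) * real DIM('a) * (s - r) * sqrt P *
        (sqrt (fact (DIM('a) - 1)) * exp s)"
    unfolding P_def using assms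
    by (intro mult_left_mono radial_fun_le DIM_positive mult_nonneg_nonneg) auto
  finally show ?thesis
    by (simp add: eig_mass_const_def P_def mult_ac)
qed

lemma eig_mass_nat_le:
  "eig_mass TYPE('a::euclidean_space) (real n) \<le>
    2 * eig_mass_const TYPE('a) * (sqrt (real n ^ (DIM('a) - 1)) * exp (real n))"
proof (induction n)
  case 0
  have "AE x in lborel. ball_eig 0 (x :: 'a) = 0"
    using AE_lborel_singleton[of "0 :: 'a"] by eventually_elim (simp add: ball_eig_def)
  then have "eig_mass TYPE('a) 0 = 0"
    unfolding eig_mass_def by (rule integral_eq_zero_AE)
  then show ?case
    using eig_mass_const_pos[where 'a = 'a] by simp
next
  case (Suc n)
  define C where "C = eig_mass_const TYPE('a)"
  define B where "B k = sqrt (real k ^ (DIM('a) - 1)) * exp (real k)" for k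
  have "2 * exp (real n) \<le> exp (real (Suc n))"
    using exp_ge_add_one_self[of "1 :: real"] by (simp add: exp_add)
  then have "sqrt (real n ^ (DIM('a) - 1)) * (2 * exp (real n)) \<le> B (Suc n)"
    unfolding B_def by (intro mult_mono real_sqrt_le_mono power_mono) auto
  then have "C * (2 * B n) \<le> C * B (Suc n)"
    using eig_mass_const_pos[where 'a = 'a] by (intro mult_left_mono) (auto simp: B_def C_def)
  moreover have "eig_mass TYPE('a) (real (Suc n)) \<le> eig_mass TYPE('a) (real n) + C * B (Suc n)"
    using eig_mass_diff_le[of "real n" "real (Suc n)", where 'a = 'a] by (simp add: C_def B_def)
  ultimately show ?case
    using Suc by (simp only: B_def[symmetric] C_def[symmetric])
qed

lemma eig_mass_le:
  assumes "r \<ge> 0"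
  shows "eig_mass TYPE('a::euclidean_space) r \<le>
    2 * eig_mass_const TYPE('a) * (sqrt ((r + 1) ^ (DIM('a) - 1)) * exp (r + 1))"
proof -
  define n where "n = nat \<lceil>r\<rceil>"
  have n_bounds: "r \<le> real n" "real n \<le> r + 1"
    using assms by (auto simp: n_def)
  have "eig_mass TYPE('a) r
      \<le> 2 * eig_mass_const TYPE('a) * (sqrt (real n ^ (DIM('a) - 1)) * exp (real n))"
    using eig_mass_mono[OF n_bounds(1)] eig_mass_nat_le by (rule order_trans)
  also have "\<dots> \<le> 2 * eig_mass_const TYPE('a) * (sqrt ((r + 1) ^ (DIM('a) - 1)) * exp (r + 1))"
    using n_bounds eig_mass_const_pos[where 'a = 'a]
    by (intro mult_left_mono mult_mono real_sqrt_le_mono power_mono) auto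
  finally show ?thesis .
qed

section \<open>Weighted means and square integrable functions\<close>

lemma powr_tangent_le:
  fixes x l p :: real
  assumes "p > 1" "x \<ge> 0" "l \<ge> 0"
  shows "p * l powr (p - 1) * x \<le> x powr p + (p - 1) * l powr p"
proof -
  have "x * l powr (p - 1) \<le> x powr p / p + (l powr (p - 1)) powr (p / (p - 1)) / (p / (p - 1))"
    using assms by (intro Youngs_inequality) (auto simp: field_simps)
  also have "(l powr (p - 1)) powr (p / (p - 1)) = l powr p"
    using assms by (simp add: powr_powr)
  finally have "p * (x * l powr (p - 1)) \<le> p * (x powr p / p + l powr p / (p / (p - 1)))"
    using assms by (intro mult_left_mono) auto
  also have "\<dots> = x powr p + (p - 1) * l powr p"
    using assms by (simp add: field_simps)
  finally show ?thesis by (simp add: mult_ac)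
qed

lemma weighted_power_mean:
  fixes f w :: "'a \<Rightarrow> real"
  assumes p_gt_1: "p > 1" and int_powr: "integrable M (\<lambda>x. \<bar>f x\<bar> powr p * w x)"
    and int_f: "integrable M (\<lambda>x. f x * w x)" and w_props: "integrable M w" "\<And>x. w x \<ge> 0"
    and mass: "(LINT x|M. w x) > 0"
  shows "\<bar>LINT x|M. f x * w x\<bar> powr p * (LINT x|M. w x) powr (1 - p)
      \<le> (LINT x|M. \<bar>f x\<bar> powr p * w x)"
proof -
  define A where "A = \<bar>LINT x|M. f x * w x\<bar>"
  define J where "J = (LINT x|M. w x)"
  define l where "l = A / J"
  have l_nonneg: "l \<ge> 0" and J_pos: "J > 0"
    using mass by (auto simp: l_def A_def J_def)
  have abs_fw: "integrable M (\<lambda>x. \<bar>f x\<bar> * w x)"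
    using integrable_abs[OF int_f] w_props(2) by (simp add: abs_mult)
  have "A \<le> (LINT x|M. \<bar>f x\<bar> * w x)"
    using integral_abs_bound[of M "\<lambda>x. f x * w x"] w_props(2) by (simp add: A_def abs_mult)
  then have "p * l powr (p - 1) * A - (p - 1) * l powr p * J
      \<le> p * l powr (p - 1) * (LINT x|M. \<bar>f x\<bar> * w x) - (p - 1) * l powr p * J"
    using p_gt_1 by (intro diff_right_mono mult_left_mono) auto
  also have "\<dots> = (LINT x|M. p * l powr (p - 1) * (\<bar>f x\<bar> * w x) - (p - 1) * l powr p * w x)"
    using abs_fw w_props(1) by (simp add: J_def)
  also have "\<dots> \<le> (LINT x|M. \<bar>f x\<bar> powr p * w x)"
  proof (rule integral_mono)
    fix x
    have "(p * l powr (p - 1) * \<bar>f x\<bar> - (p - 1) * l powr p) * w x \<le> \<bar>f x\<bar> powr p * w x"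
      using powr_tangent_le[OF p_gt_1, of "\<bar>f x\<bar>" l] l_nonneg w_props(2)
      by (intro mult_right_mono) auto
    then show "p * l powr (p - 1) * (\<bar>f x\<bar> * w x) - (p - 1) * l powr p * w x \<le> \<bar>f x\<bar> powr p * w x"
      by (simp add: algebra_simps)
  qed (use abs_fw w_props int_powr in auto)
  also have "p * l powr (p - 1) * A - (p - 1) * l powr p * J = A powr p * J powr (1 - p)"
  proof (cases "A = 0")
    case False
    then have A_pos: "A > 0" by (simp add: A_def)
    have "l powr (p - 1) * A = A powr p * J powr (1 - p)" "l powr p * J = A powr p * J powr (1 - p)"
      using A_pos J_pos by (simp_all add: l_def powr_divide powr_diff divide_simps)
    then show ?thesis by (simp add: algebra_simps)
  qed (simp add: l_def)
  finally show ?thesis by (simp add: A_def J_def)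
qed

lemma integrable_mult_square_integrable:
  fixes f g :: "'a \<Rightarrow> real"
  assumes [measurable]: "f \<in> borel_measurable M" "g \<in> borel_measurable M"
    and "integrable M (\<lambda>x. (f x)\<^sup>2)" "integrable M (\<lambda>x. (g x)\<^sup>2)"
  shows "integrable M (\<lambda>x. f x * g x)"
proof (rule Bochner_Integration.integrable_bound)
  show "integrable M (\<lambda>x. (f x)\<^sup>2 + (g x)\<^sup>2)"
    using assms by simp
  have "\<bar>a * b\<bar> \<le> a\<^sup>2 + b\<^sup>2" for a b :: real
    using sum_squares_bound[of "\<bar>a\<bar>" "\<bar>b\<bar>"]
      mult_nonneg_nonneg[OF abs_ge_zero[of a] abs_ge_zero[of b]]
    by (simp only: abs_mult power2_abs)
  then show "AE x in M. norm (f x * g x) \<le> norm ((f x)\<^sup>2 + (g x)\<^sup>2)"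
    by simp
qed measurable

lemma integral_Cauchy_Schwarz:
  fixes f g :: "'a \<Rightarrow> real"
  assumes meas [measurable]: "f \<in> borel_measurable M" "g \<in> borel_measurable M"
    and int: "integrable M (\<lambda>x. (f x)\<^sup>2)" "integrable M (\<lambda>x. (g x)\<^sup>2)"
  shows "(LINT x|M. f x * g x)\<^sup>2 \<le> (LINT x|M. (f x)\<^sup>2) * (LINT x|M. (g x)\<^sup>2)"
proof -
  have nn_eq: "(\<integral>\<^sup>+x. ennreal \<bar>f x\<bar> * ennreal \<bar>g x\<bar> \<partial>M) = ennreal (LINT x|M. \<bar>f x * g x\<bar>)"
    "(\<integral>\<^sup>+x. (ennreal \<bar>f x\<bar>)\<^sup>2 \<partial>M) = ennreal (LINT x|M. (f x)\<^sup>2)"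
    "(\<integral>\<^sup>+x. (ennreal \<bar>g x\<bar>)\<^sup>2 \<partial>M) = ennreal (LINT x|M. (g x)\<^sup>2)"
    using integrable_abs[OF integrable_mult_square_integrable[OF meas int]] int
    by (simp_all add: ennreal_mult[symmetric] ennreal_power abs_mult nn_integral_eq_integral)
  have "(ennreal (LINT x|M. \<bar>f x * g x\<bar>))\<^sup>2
      \<le> ennreal (LINT x|M. (f x)\<^sup>2) * ennreal (LINT x|M. (g x)\<^sup>2)"
    using Cauchy_Schwarz_nn_integral[of "\<lambda>x. ennreal \<bar>f x\<bar>" M "\<lambda>x. ennreal \<bar>g x\<bar>"]
    unfolding nn_eq by simp
  then have "(LINT x|M. \<bar>f x * g x\<bar>)\<^sup>2 \<le> (LINT x|M. (f x)\<^sup>2) * (LINT x|M. (g x)\<^sup>2)"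
    by (simp add: ennreal_power ennreal_mult[symmetric])
  moreover have "\<bar>LINT x|M. f x * g x\<bar>\<^sup>2 \<le> (LINT x|M. \<bar>f x * g x\<bar>)\<^sup>2"
    by (intro power_mono integral_abs_bound) simp
  ultimately show ?thesis by simp
qed

lemma L2_mult_integrable: "L2 f \<Longrightarrow> L2 g \<Longrightarrow> integrable lborel (\<lambda>x. f x * g x)"
  unfolding L2_def by (intro integrable_mult_square_integrable) auto

lemma L2_cmult: "L2 f \<Longrightarrow> L2 (\<lambda>x. c * f x)"
  by (auto simp: L2_def power_mult_distrib)

lemma L2_diff:
  assumes "L2 f" "L2 g"
  shows "L2 (\<lambda>x. f x - g x)"
proof -
  have "integrable lborel (\<lambda>x. (f x)\<^sup>2 + (g x)\<^sup>2 - 2 * (f x * g x))"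
    using assms L2_mult_integrable[OF assms] by (auto simp: L2_def)
  then have "integrable lborel (\<lambda>x. (f x - g x)\<^sup>2)"
    by (simp add: power2_diff mult.assoc)
  with assms show ?thesis by (auto simp: L2_def)
qed

lemma L2_tendsto_integral:
  assumes lim: "((\<lambda>s. L2dist2 (f s) f0) \<longlongrightarrow> 0) F" and L2_f: "\<forall>\<^sub>F s in F. L2 (f s)"
    and L2_f0: "L2 f0" and L2_\<psi>: "L2 \<psi>"
  shows "((\<lambda>s. LINT x|lborel. f s x * \<psi> x) \<longlongrightarrow> (LINT x|lborel. f0 x * \<psi> x)) F"
proof -
  define C where "C = (LINT x|lborel. (\<psi> x)\<^sup>2)"
  have "((\<lambda>s. sqrt (L2dist2 (f s) f0 * C)) \<longlongrightarrow> sqrt (0 * C)) F"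
    by (intro tendsto_intros lim)
  then have bound_lim: "((\<lambda>s. sqrt (L2dist2 (f s) f0 * C)) \<longlongrightarrow> 0) F" by simp
  have "\<forall>\<^sub>F s in F. norm ((LINT x|lborel. f s x * \<psi> x) - (LINT x|lborel. f0 x * \<psi> x))
      \<le> sqrt (L2dist2 (f s) f0 * C)"
    using L2_f
  proof eventually_elim
    case (elim s)
    have "(LINT x|lborel. f s x * \<psi> x) - (LINT x|lborel. f0 x * \<psi> x) =
        (LINT x|lborel. (f s x - f0 x) * \<psi> x)"
      using L2_mult_integrable[OF elim L2_\<psi>] L2_mult_integrable[OF L2_f0 L2_\<psi>]
      by (simp add: left_diff_distrib)
    moreover have "(LINT x|lborel. (f s x - f0 x) * \<psi> x)\<^sup>2 \<le> L2dist2 (f s) f0 * C"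
      using L2_diff[OF elim L2_f0] L2_\<psi> unfolding L2dist2_def C_def L2_def
      by (intro integral_Cauchy_Schwarz) auto
    ultimately show ?case by (simp add: real_le_rsqrt)
  qed
  then have "((\<lambda>s. (LINT x|lborel. f s x * \<psi> x) - (LINT x|lborel. f0 x * \<psi> x)) \<longlongrightarrow> 0) F"
    by (rule Lim_null_comparison[OF _ bound_lim])
  then show ?thesis by (simp add: LIM_zero_iff)
qed

lemma L2_limit_vanishes:
  assumes lim: "((\<lambda>s. L2dist2 (f s) f0) \<longlongrightarrow> 0) F" and F_not_bot: "F \<noteq> bot"
    and f_vanishes: "\<forall>\<^sub>F s in F. L2 (f s) \<and> (AE x in lborel. P x \<longrightarrow> f s x = 0)"
    and L2_f0: "L2 f0" and sets_P: "{x. P x} \<in> sets borel"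
  shows "AE x in lborel. P x \<longrightarrow> f0 x = 0"
proof -
  define E where "E = {x. P x}"
  have int: "integrable lborel (\<lambda>x. indicator E x * (f0 x)\<^sup>2)"
    using integrable_mult_indicator[of E lborel "\<lambda>x. (f0 x)\<^sup>2"] L2_f0 sets_P
    by (simp add: L2_def E_def)
  have "\<forall>\<^sub>F s in F. (LINT x|lborel. indicator E x * (f0 x)\<^sup>2) \<le> L2dist2 (f s) f0"
    using f_vanishes
  proof eventually_elim
    case (elim s)
    show ?case
      unfolding L2dist2_def
    proof (rule integral_mono_AE[OF int])
      show "integrable lborel (\<lambda>x. (f s x - f0 x)\<^sup>2)"
        using L2_diff[of "f s" f0] elim L2_f0 by (simp add: L2_def)
      show "AE x in lborel. indicator E x * (f0 x)\<^sup>2 \<le> (f s x - f0 x)\<^sup>2"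
        using elim[THEN conjunct2] by eventually_elim (auto simp: E_def indicator_def)
    qed
  qed
  then have "(LINT x|lborel. indicator E x * (f0 x)\<^sup>2) \<le> 0"
    by (rule tendsto_lowerbound[OF lim _ F_not_bot])
  then have "(LINT x|lborel. indicator E x * (f0 x)\<^sup>2) = 0"
    by (intro antisym integral_nonneg_AE) auto
  then have "AE x in lborel. indicator E x * (f0 x)\<^sup>2 = 0"
    by (subst (asm) integral_nonneg_eq_0_iff_AE[OF int]) auto
  then show ?thesis
    by eventually_elim (auto simp: E_def indicator_def split: if_splits)
qed

section \<open>Test functions\<close>

definition laplacian :: "(real^'n \<Rightarrow> real) \<Rightarrow> real^'n \<Rightarrow> real" where
  "laplacian \<phi> x = (\<Sum>i\<in>UNIV. pdx (pdx \<phi> i) i x)"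

lemma smooth_fun_pdx: "smooth_fun \<phi> \<Longrightarrow> smooth_fun (pdx \<phi> i)"
  unfolding pdx_def[abs_def] by (rule smooth_fun_frechet_derivative)

lemma pdx_cong_open:
  assumes "smooth_fun f" "open S" "x \<in> S" "\<And>y. y \<in> S \<Longrightarrow> f y = g y"
  shows "pdx f i x = pdx g i x"
  using frechet_derivative_transform_within_open[OF
      smooth_fun_differentiable[OF assms(1)] assms(2-4)]
  by (simp add: pdx_def)

lemma laplacian_cong_open:
  assumes "smooth_fun f" "open S" "x \<in> S" "\<And>y. y \<in> S \<Longrightarrow> f y = g y"
  shows "laplacian f x = laplacian g x"
  unfolding laplacian_def
  by (intro sum.cong refl pdx_cong_open[OF smooth_fun_pdx[OF assms(1)] assms(2,3)]
      pdx_cong_open[OF assms(1,2)] assms(4))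

lemma test_fn_smooth: "test_fn \<phi> \<Longrightarrow> smooth_fun \<phi>"
  by (simp add: test_fn_def)

lemma test_fn_pdx:
  assumes "test_fn \<phi>"
  shows "test_fn (pdx \<phi> i)"
proof -
  obtain r where vanishes: "\<And>x. r \<le> norm x \<Longrightarrow> \<phi> x = 0"
    using assms by (auto simp: test_fn_def)
  have "pdx \<phi> i x = 0" if "r + 1 \<le> norm x" for x
  proof -
    have "pdx \<phi> i x = pdx (\<lambda>_. 0) i x"
      by (rule pdx_cong_open[OF test_fn_smooth[OF assms], of "{y. r < norm y}"])
        (use that vanishes in \<open>auto intro!: open_Collect_less continuous_intros\<close>)
    then show ?thesis
      by (simp add: pdx_def)
  qed
  then show ?thesis
    using smooth_fun_pdx[OF test_fn_smooth[OF assms]] unfolding test_fn_def by blast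
qed

lemma test_fn_add:
  assumes "test_fn \<phi>" "test_fn \<psi>"
  shows "test_fn (\<lambda>x. \<phi> x + \<psi> x)"
proof -
  obtain r s where \<phi>_vanishes: "\<And>x. r \<le> norm x \<Longrightarrow> \<phi> x = 0" and \<psi>_vanishes: "\<And>x. s \<le> norm x \<Longrightarrow> \<psi> x = 0"
    using assms by (auto simp: test_fn_def)
  have "\<forall>x. max r s \<le> norm x \<longrightarrow> \<phi> x + \<psi> x = 0"
    using \<phi>_vanishes \<psi>_vanishes by auto
  with assms show ?thesis
    unfolding test_fn_def by (intro conjI smooth_fun_add) blast+
qed

lemma test_fn_sum:
  assumes "\<And>i. i \<in> I \<Longrightarrow> test_fn (f i)"
  shows "test_fn (\<lambda>x. \<Sum>i\<in>I. f i x)"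
  using assms
proof (induction I rule: infinite_finite_induct)
  case (insert i I)
  then show ?case
    using test_fn_add[of "f i" "\<lambda>x. \<Sum>i\<in>I. f i x"] by simp
qed (auto simp: test_fn_def smooth_fun_const)

lemma test_fn_laplacian: "test_fn \<phi> \<Longrightarrow> test_fn (laplacian \<phi>)"
  unfolding laplacian_def[abs_def] by (intro test_fn_sum test_fn_pdx)

lemma test_fn_borel_measurable: "test_fn \<phi> \<Longrightarrow> \<phi> \<in> borel_measurable borel"
  by (intro borel_measurable_continuous_onI smooth_fun_continuous_on test_fn_smooth)

lemma test_fn_L2:
  assumes "test_fn \<phi>"
  shows "L2 \<phi>"
proof -
  obtain r where vanishes: "\<And>x. r \<le> norm x \<Longrightarrow> \<phi> x = 0"
    using assms by (auto simp: test_fn_def)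
  have "integrable lborel (\<lambda>x. indicator (cball 0 r) x *\<^sub>R (\<phi> x)\<^sup>2)"
    by (intro borel_integrable_compact compact_cball continuous_intros smooth_fun_continuous_on
        test_fn_smooth assms)
  also have "(\<lambda>x. indicator (cball 0 r) x *\<^sub>R (\<phi> x)\<^sup>2) = (\<lambda>x. (\<phi> x)\<^sup>2)"
    using vanishes by (intro ext) (force simp: indicator_def)
  finally show ?thesis
    unfolding L2_def using test_fn_borel_measurable[OF assms] by simp
qed

lemma test_fn_T_mult:
  fixes \<psi> :: "real^'n \<Rightarrow> real"
  assumes test_\<psi>: "test_fn \<psi>" and smooth_\<eta>: "smooth_fun \<eta>"
    and \<eta>_vanishes: "T' < T" "\<And>s. T' \<le> s \<Longrightarrow> \<eta> s = 0"
  shows "test_fn_T T (\<lambda>x s. \<psi> x * \<eta> s)"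
proof -
  have "smooth_fun (\<lambda>z :: (real^'n) \<times> real. \<psi> (fst z) * \<eta> (snd z))"
    by (intro smooth_fun_mult
        smooth_fun_compose_linear[OF bounded_linear_fst test_fn_smooth[OF test_\<psi>]]
        smooth_fun_compose_linear[OF bounded_linear_snd smooth_\<eta>])
  with test_\<psi> \<eta>_vanishes show ?thesis
    unfolding test_fn_T_def test_fn_def by auto
qed

lemma
  fixes \<psi> :: "real^'n \<Rightarrow> real"
  assumes smooth_\<psi>: "smooth_fun \<psi>" and smooth_\<eta>: "smooth_fun \<eta>"
  shows dt_T_mult: "dt_T (\<lambda>x s. \<psi> x * \<eta> s) x s = \<psi> x * deriv \<eta> s"
    and dx_T_mult: "dx_T (\<lambda>x s. \<psi> x * \<eta> s) i x s = pdx \<psi> i x * \<eta> s"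
proof -
  have deriv_\<psi>: "((\<lambda>z. \<psi> (fst z)) has_derivative
      (\<lambda>h. frechet_derivative \<psi> (at x) (fst h))) (at (x, s))"
    using has_derivative_compose_linear[OF bounded_linear_fst, of \<psi> "(x, s)"]
      smooth_fun_differentiable[OF smooth_\<psi>] by simp
  have deriv_\<eta>: "((\<lambda>z :: (real^'n) \<times> real. \<eta> (snd z)) has_derivative
      (\<lambda>h. deriv \<eta> s * snd h)) (at (x, s))"
    using has_derivative_compose_real[of \<eta> "deriv \<eta> s" snd "(x, s)" snd]
      smooth_fun_DERIV[OF smooth_\<eta>]
    by (simp add: bounded_linear_imp_has_derivative bounded_linear_snd)
  note deriv = frechet_derivative_at[OF has_derivative_mult[OF deriv_\<psi> deriv_\<eta>], symmetric]
  have "linear (frechet_derivative \<psi> (at x))"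
    by (rule linear_frechet_derivative[OF smooth_fun_differentiable[OF smooth_\<psi>]])
  then show "dt_T (\<lambda>x s. \<psi> x * \<eta> s) x s = \<psi> x * deriv \<eta> s"
    by (simp add: dt_T_def deriv linear_0)
  show "dx_T (\<lambda>x s. \<psi> x * \<eta> s) i x s = pdx \<psi> i x * \<eta> s"
    by (simp add: dx_T_def deriv pdx_def)
qed

lemma has_derivative_radial:
  fixes \<Psi> :: "real \<Rightarrow> real"
  assumes "smooth_fun \<Psi>"
  shows "((\<lambda>x. \<Psi> (x \<bullet> x)) has_derivative (\<lambda>h. deriv \<Psi> (x \<bullet> x) * (2 * (x \<bullet> h)))) (at x)"
  by (rule has_derivative_compose_real[OF smooth_fun_DERIV[OF assms]])
    (auto intro!: derivative_eq_intros simp: inner_commute)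

lemma pdx_radial:
  assumes "smooth_fun \<Psi>"
  shows "pdx (\<lambda>x :: real^'n. \<Psi> (x \<bullet> x)) i x = 2 * x $ i * deriv \<Psi> (x \<bullet> x)"
  using frechet_derivative_at[OF has_derivative_radial[OF assms, of x], symmetric]
  by (simp add: pdx_def inner_axis)

lemma laplacian_radial:
  assumes "smooth_fun \<Psi>"
  shows "laplacian (\<lambda>x :: real^'n. \<Psi> (x \<bullet> x)) x =
    4 * (x \<bullet> x) * deriv (deriv \<Psi>) (x \<bullet> x) + 2 * real CARD('n) * deriv \<Psi> (x \<bullet> x)"
proof -
  have "pdx (pdx (\<lambda>x :: real^'n. \<Psi> (x \<bullet> x)) i) i x =
      2 * deriv \<Psi> (x \<bullet> x) + 4 * (x $ i)\<^sup>2 * deriv (deriv \<Psi>) (x \<bullet> x)" for i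
  proof -
    have "((\<lambda>x :: real^'n. 2 * x $ i * deriv \<Psi> (x \<bullet> x)) has_derivative
        (\<lambda>h. 2 * x $ i * (deriv (deriv \<Psi>) (x \<bullet> x) * (2 * (x \<bullet> h))) + (2 * h $ i) * deriv \<Psi> (x \<bullet> x)))
          (at x)"
      by (intro has_derivative_mult has_derivative_mult_right has_derivative_radial
          smooth_fun_deriv assms bounded_linear_imp_has_derivative bounded_linear_vec_nth)
    from frechet_derivative_at[OF this, symmetric] show ?thesis
      unfolding pdx_radial[OF assms, abs_def] pdx_def
      by (simp add: inner_axis power2_eq_square)
  qed
  then show ?thesis
    by (simp add: laplacian_def sum.distrib inner_vec_def power2_eq_square sum_distrib_left
        sum_distrib_right mult_ac)
qed

lemma smooth_fun_eig: "smooth_fun (eig :: 'a::euclidean_space \<Rightarrow> real)"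
  unfolding eig_def[abs_def]
  by (rule smooth_fun_compose[OF smooth_radial_fun[OF DIM_positive] smooth_fun_inner_self])

lemma laplacian_eig: "laplacian eig x = eig (x :: real^'n)"
  using laplacian_radial[OF smooth_radial_fun[of "CARD('n)"], of x]
    radial_fun_ode[of "CARD('n)" "x \<bullet> x"]
  by (simp add: eig_def[abs_def])

text \<open>The weight \<open>eig\<close> is not compactly supported, so it has to be cut off outside the light cone of
  the solution before it can be used in the weak formulation.\<close>

definition eig_cutoff :: "real \<Rightarrow> (real^'n \<Rightarrow> real) \<Rightarrow> bool" where
  "eig_cutoff r \<psi> \<longleftrightarrow> test_fn \<psi> \<and> (\<forall>x. norm x \<le> r \<longrightarrow> \<psi> x = eig x \<and> laplacian \<psi> x = eig x)"

lemma eig_cutoff_exists: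
  assumes "r \<ge> 0"
  shows "\<exists>\<psi> :: real^'n \<Rightarrow> real. eig_cutoff r \<psi>"
proof -
  have "(r + 1)\<^sup>2 < (r + 2)\<^sup>2"
    using assms by (intro power_strict_mono) auto
  then obtain \<zeta> :: "real \<Rightarrow> real" where \<zeta>_cutoff: "smooth_fun \<zeta>"
    "\<And>z. z \<le> (r + 1)\<^sup>2 \<Longrightarrow> \<zeta> z = 1" "\<And>z. (r + 2)\<^sup>2 \<le> z \<Longrightarrow> \<zeta> z = 0"
    by (rule smooth_cutoff_exists) blast
  define \<psi> :: "real^'n \<Rightarrow> real" where "\<psi> x = eig x * \<zeta> (x \<bullet> x)" for x
  have smooth: "smooth_fun \<psi>"
    unfolding \<psi>_def
    by (intro smooth_fun_mult smooth_fun_eig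
        smooth_fun_compose[OF \<zeta>_cutoff(1) smooth_fun_inner_self])
  have "\<psi> x = 0" if "r + 2 \<le> norm x" for x
    using \<zeta>_cutoff(3)[of "x \<bullet> x"] power_mono[OF that, of 2] assms
    by (simp add: \<psi>_def power2_norm_eq_inner)
  with smooth have "test_fn \<psi>"
    unfolding test_fn_def by blast
  moreover have eq: "\<psi> x = eig x" if "x \<in> ball 0 (r + 1)" for x
    using \<zeta>_cutoff(2)[of "x \<bullet> x"] power_mono[of "norm x" "r + 1" 2] that
    by (simp add: \<psi>_def power2_norm_eq_inner)
  moreover have "laplacian \<psi> x = eig x" if "x \<in> ball 0 (r + 1)" for x
    using laplacian_cong_open[OF smooth open_ball that eq] laplacian_eig by simp
  ultimately show ?thesis
    by (intro exI[of _ \<psi>]) (auto simp: eig_cutoff_def)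
qed

section \<open>Lower right Dini derivatives\<close>

definition right_dini_ge :: "(real \<Rightarrow> real) \<Rightarrow> real \<Rightarrow> real \<Rightarrow> bool" where
  "right_dini_ge f t d \<longleftrightarrow> (\<forall>e>0. \<forall>\<^sub>F s in at_right t. f t + (d - e) * (s - t) \<le> f s)"

lemma right_dini_ge_mono:
  assumes "right_dini_ge f t d" "d' \<le> d"
  shows "right_dini_ge f t d'"
  unfolding right_dini_ge_def
proof (intro allI impI)
  fix e :: real assume "e > 0"
  with assms(1) have "\<forall>\<^sub>F s in at_right t. f t + (d - e) * (s - t) \<le> f s"
    by (auto simp: right_dini_ge_def)
  then show "\<forall>\<^sub>F s in at_right t. f t + (d' - e) * (s - t) \<le> f s"
    using eventually_at_right_less[of t]
  proof eventually_elim
    case (elim s)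
    have "(d' - e) * (s - t) \<le> (d - e) * (s - t)"
      using elim assms(2) by (intro mult_right_mono) auto
    with elim show ?case by linarith
  qed
qed

lemma DERIV_imp_right_dini_ge:
  assumes "(f has_real_derivative d) (at_right t)"
  shows "right_dini_ge f t d"
  unfolding right_dini_ge_def
proof (intro allI impI)
  fix e :: real assume "e > 0"
  moreover have "((\<lambda>s. (f s - f t) / (s - t)) \<longlongrightarrow> d) (at_right t)"
    using assms by (simp add: has_field_derivative_iff)
  ultimately have "\<forall>\<^sub>F s in at_right t. (f s - f t) / (s - t) > d - e"
    by (intro order_tendstoD(1)) auto
  then show "\<forall>\<^sub>F s in at_right t. f t + (d - e) * (s - t) \<le> f s"
    using eventually_at_right_less[of t] by eventually_elim (auto simp: field_simps)
qed

lemma right_dini_geI: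
  assumes "\<And>e. e > 0 \<Longrightarrow> \<exists>k D. k t = f t \<and> (k has_real_derivative D) (at_right t) \<and> d - e \<le> D \<and>
    (\<forall>\<^sub>F s in at_right t. k s \<le> f s)"
  shows "right_dini_ge f t d"
  unfolding right_dini_ge_def
proof (intro allI impI)
  fix e :: real assume e_pos: "e > 0"
  then obtain k D where minorant: "k t = f t" "(k has_real_derivative D) (at_right t)"
    "d - e / 2 \<le> D"
    "\<forall>\<^sub>F s in at_right t. k s \<le> f s"
    using assms[of "e / 2"] by auto
  have "right_dini_ge k t (d - e / 2)"
    using DERIV_imp_right_dini_ge[OF minorant(2)] minorant(3) by (rule right_dini_ge_mono)
  then have "\<forall>\<^sub>F s in at_right t. k t + (d - e / 2 - e / 2) * (s - t) \<le> k s"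
    using e_pos half_gt_zero unfolding right_dini_ge_def by blast
  with minorant(4) show "\<forall>\<^sub>F s in at_right t. f t + (d - e) * (s - t) \<le> f s"
    by eventually_elim (use minorant(1) in auto)
qed

lemma right_dini_ge_add:
  assumes "right_dini_ge f t d" "right_dini_ge g t d'"
  shows "right_dini_ge (\<lambda>s. f s + g s) t (d + d')"
  unfolding right_dini_ge_def
proof (intro allI impI)
  fix e :: real assume "e > 0"
  then have "\<forall>\<^sub>F s in at_right t. f t + (d - e / 2) * (s - t) \<le> f s"
    "\<forall>\<^sub>F s in at_right t. g t + (d' - e / 2) * (s - t) \<le> g s"
    using assms half_gt_zero unfolding right_dini_ge_def by blast+
  then show "\<forall>\<^sub>F s in at_right t. f t + g t + (d + d' - e) * (s - t) \<le> f s + g s"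
    by eventually_elim (auto simp: field_simps)
qed

lemma right_dini_ge_mult:
  assumes dini_f: "right_dini_ge f t d" and deriv_w: "(w has_real_derivative w') (at_right t)"
    and pos: "w t > 0"
  shows "right_dini_ge (\<lambda>s. w s * f s) t (w t * d + w' * f t)"
proof (rule right_dini_geI)
  fix e :: real assume "e > 0"
  define e' where "e' = e / w t"
  have e'_pos: "e' > 0"
    using \<open>e > 0\<close> pos by (simp add: e'_def)
  define k where "k = (\<lambda>s. w s * (f t + (d - e') * (s - t)))"
  have "(k has_real_derivative w' * f t + w t * (d - e')) (at_right t)"
    unfolding k_def by (auto intro!: derivative_eq_intros deriv_w)
  moreover have "w t * d + w' * f t - e \<le> w' * f t + w t * (d - e')"
    using pos by (simp add: e'_def algebra_simps)
  moreover have "\<forall>\<^sub>F s in at_right t. k s \<le> w s * f s"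
  proof -
    have "(w \<longlongrightarrow> w t) (at_right t)"
      using DERIV_continuous[OF deriv_w] by (simp add: continuous_within)
    then have "\<forall>\<^sub>F s in at_right t. w s > 0"
      using pos by (rule order_tendstoD(1))
    moreover have "\<forall>\<^sub>F s in at_right t. f t + (d - e') * (s - t) \<le> f s"
      using dini_f e'_pos unfolding right_dini_ge_def by blast
    ultimately show ?thesis
      by eventually_elim (auto simp: k_def)
  qed
  ultimately show "\<exists>k D. k t = w t * f t \<and> (k has_real_derivative D) (at_right t) \<and>
      w t * d + w' * f t - e \<le> D \<and> (\<forall>\<^sub>F s in at_right t. k s \<le> w s * f s)"
    by (intro exI[of _ k] exI[of _ "w' * f t + w t * (d - e')"]) (simp add: k_def)
qed

lemma right_dini_ge_compose:
  assumes dini_f: "right_dini_ge f t d" and pos: "f t > 0"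
    and deriv_h: "(h has_real_derivative h') (at (f t))" "h' > 0"
    and mono: "\<And>x y. 0 < x \<Longrightarrow> x \<le> y \<Longrightarrow> h x \<le> h y"
  shows "right_dini_ge (\<lambda>s. h (f s)) t (h' * d)"
proof (rule right_dini_geI)
  fix e :: real assume "e > 0"
  define e' where "e' = e / h'"
  have e'_pos: "e' > 0"
    using \<open>e > 0\<close> deriv_h(2) by (simp add: e'_def)
  define l where "l = (\<lambda>s. f t + (d - e') * (s - t))"
  have deriv_l: "(l has_real_derivative d - e') (at_right t)" and l_t: "l t = f t"
    unfolding l_def by (auto intro!: derivative_eq_intros)
  have "((\<lambda>s. h (l s)) has_real_derivative h' * (d - e')) (at_right t)"
    using deriv_h(1) l_t by (intro DERIV_chain2[OF _ deriv_l]) simp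
  moreover have "h' * d - e \<le> h' * (d - e')"
    using deriv_h(2) by (simp add: e'_def algebra_simps)
  moreover have "\<forall>\<^sub>F s in at_right t. h (l s) \<le> h (f s)"
  proof -
    have "(l \<longlongrightarrow> f t) (at_right t)"
      using DERIV_continuous[OF deriv_l] l_t by (simp add: continuous_within)
    then have "\<forall>\<^sub>F s in at_right t. l s > 0"
      using pos by (rule order_tendstoD(1))
    moreover have "\<forall>\<^sub>F s in at_right t. l s \<le> f s"
      using dini_f e'_pos unfolding right_dini_ge_def l_def by blast
    ultimately show ?thesis
      by eventually_elim (rule mono)
  qed
  ultimately show "\<exists>k D. k t = h (f t) \<and> (k has_real_derivative D) (at_right t) \<and>
      h' * d - e \<le> D \<and> (\<forall>\<^sub>F s in at_right t. k s \<le> h (f s))"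
    by (intro exI[of _ "\<lambda>s. h (l s)"] exI[of _ "h' * (d - e')"]) (simp add: l_t)
qed

lemma compact_sublevel_Icc:
  fixes f :: "real \<Rightarrow> real"
  assumes "continuous_on {a..b} f"
  shows "compact {t \<in> {a..b}. f t \<le> c}"
proof -
  have "closed {t \<in> {a..b}. f t \<le> c}"
    using assms by (intro continuous_on_closed_Collect_le continuous_on_const) auto
  moreover have "bounded {t \<in> {a..b}. f t \<le> c}"
    by (rule bounded_subset[OF bounded_closed_interval[of a b]]) auto
  ultimately show ?thesis
    by (simp add: compact_eq_bounded_closed)
qed

lemma nonneg_by_right_continuation:
  fixes f :: "real \<Rightarrow> real"
  assumes "a \<le> b" and cont: "continuous_on {a..b} f" and start: "f a \<ge> 0"
    and step: "\<And>t. a \<le> t \<Longrightarrow> t < b \<Longrightarrow> f t \<ge> 0 \<Longrightarrow> \<forall>\<^sub>F s in at_right t. f s \<ge> 0"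
  shows "f b \<ge> 0"
proof -
  define S where "S = {t \<in> {a..b}. - f t \<le> 0}"
  have "compact S"
    unfolding S_def by (intro compact_sublevel_Icc continuous_on_minus cont)
  moreover have "a \<in> S"
    using assms(1) start by (simp add: S_def)
  ultimately obtain c where "c \<in> S" and max: "\<And>t. t \<in> S \<Longrightarrow> t \<le> c"
    using compact_attains_sup[of S] by blast
  then have c_bounds: "a \<le> c" "c \<le> b" and nonneg: "f c \<ge> 0"
    by (auto simp: S_def)
  have "c = b"
  proof (rule ccontr)
    assume "c \<noteq> b"
    with c_bounds have "c < b"
      by simp
    then have "\<forall>\<^sub>F s in at_right c. c < s \<and> s < b"
      using eventually_at_right_field by blast
    with step[OF c_bounds(1) \<open>c < b\<close> nonneg] have "\<forall>\<^sub>F s in at_right c. s \<in> S \<and> c < s"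
      by eventually_elim (use c_bounds in \<open>auto simp: S_def\<close>)
    then obtain s where "s \<in> S" "c < s"
      using eventually_happens trivial_limit_at_right_real by blast
    with max show False
      by fastforce
  qed
  with nonneg show ?thesis
    by simp
qed

lemma right_dini_ge_imp_mono:
  fixes f :: "real \<Rightarrow> real"
  assumes "a \<le> b" and cont: "continuous_on {a..b} f"
    and dini: "\<And>t. a < t \<Longrightarrow> t < b \<Longrightarrow> right_dini_ge f t 0"
  shows "f a \<le> f b"
proof -
  \<comment> \<open>The slack \<open>e * 1\<close> lets \<open>f\<close> leave \<open>a\<close>, where no Dini derivative is assumed.\<close>
  have slack: "0 \<le> f b - f a + e * (b - a + 1)" if "e > 0" for e
  proof (rule nonneg_by_right_continuation[OF assms(1),
        where f = "\<lambda>t. f t - f a + e * (t - a + 1)"])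
    show "continuous_on {a..b} (\<lambda>t. f t - f a + e * (t - a + 1))"
      by (intro continuous_intros cont)
    fix t assume t_bounds: "a \<le> t" "t < b" and nonneg: "0 \<le> f t - f a + e * (t - a + 1)"
    show "\<forall>\<^sub>F s in at_right t. 0 \<le> f s - f a + e * (s - a + 1)"
    proof (cases "t = a")
      case True
      have "(f \<longlongrightarrow> f a) (at_right a)"
        using continuous_on_Icc_at_rightD[OF cont] t_bounds True by simp
      then have "\<forall>\<^sub>F s in at_right a. f a - e < f s"
        by (rule order_tendstoD(1)) (use that in simp)
      then show ?thesis
        using eventually_at_right_less[of a] unfolding True
      proof eventually_elim
        case (elim s)
        have "e * 1 \<le> e * (s - a + 1)"
          using elim that by (intro mult_left_mono) auto
        with elim show ?case by simp
      qed
    next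
      case False
      then have "\<forall>\<^sub>F s in at_right t. f t + (0 - e) * (s - t) \<le> f s"
        using dini[of t] t_bounds that unfolding right_dini_ge_def by simp
      then show ?thesis
        by eventually_elim (use nonneg in \<open>auto simp: algebra_simps\<close>)
    qed
  qed (use that in simp)
  have length_pos: "b - a + 1 > 0"
    using assms(1) by simp
  have "f a \<le> f b + e" if "e > 0" for e
    using slack[OF divide_pos_pos[OF that length_pos]] length_pos by simp
  then show ?thesis
    by (rule field_le_epsilon)
qed

lemma pos_by_continuation:
  fixes f :: "real \<Rightarrow> real"
  assumes cont: "continuous_on {a..<b} f"
    and step: "\<And>t. a \<le> t \<Longrightarrow> t < b \<Longrightarrow> (\<And>s. a \<le> s \<Longrightarrow> s < t \<Longrightarrow> f s > 0) \<Longrightarrow> f t > 0"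
    and t_bounds: "a \<le> t" "t < b"
  shows "f t > 0"
proof (rule ccontr)
  define S where "S = {s \<in> {a..t}. f s \<le> 0}"
  assume "\<not> f t > 0"
  then have "t \<in> S"
    using t_bounds by (simp add: S_def)
  moreover have "compact S"
    unfolding S_def using t_bounds
    by (intro compact_sublevel_Icc continuous_on_subset[OF cont]) auto
  ultimately obtain c where c_mem: "c \<in> S" and min: "\<And>s. s \<in> S \<Longrightarrow> c \<le> s"
    using compact_attains_inf[of S] by blast
  have "f c > 0"
  proof (rule step)
    show "a \<le> c" "c < b"
      using c_mem t_bounds by (auto simp: S_def)
    show "f s > 0" if "a \<le> s" "s < c" for s
      using min[of s] that c_mem by (force simp: S_def not_less)
  qed
  with c_mem show False
    by (simp add: S_def)
qed

lemma right_dini_bernoulli: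
  fixes f k :: "real \<Rightarrow> real"
  assumes p_gt_1: "p > 1" and a_le_b: "a \<le> b"
    and cont: "continuous_on {a..b} f" "continuous_on {a..b} k"
    and pos: "\<And>t. a \<le> t \<Longrightarrow> t \<le> b \<Longrightarrow> f t > 0"
    and dini: "\<And>t. a < t \<Longrightarrow> t < b \<Longrightarrow> right_dini_ge f t (k t * f t powr p)"
  shows "(p - 1) * integral {a..b} k \<le> f a powr (1 - p)"
proof -
  define h where "h z = - (z powr (1 - p))" for z :: real
  define F where "F t = h (f t) + - (p - 1) * integral {a..t} k" for t
  have "F a \<le> F b"
  proof (rule right_dini_ge_imp_mono[OF a_le_b])
    have "\<forall>t\<in>{a..b}. f t \<noteq> 0"
      using pos by force
    then show "continuous_on {a..b} F"
      unfolding F_def h_def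
      by (intro continuous_intros cont indefinite_integral_continuous_1 integrable_continuous_real)
    fix t assume t_bounds: "a < t" "t < b"
    have f_pos: "f t > 0"
      using pos[of t] t_bounds by simp
    have "(h has_real_derivative (p - 1) * f t powr (- p)) (at (f t))"
      unfolding h_def using f_pos by (auto intro!: derivative_eq_intros simp: field_simps)
    moreover have "h x \<le> h y" if "0 < x" "x \<le> y" for x y
      unfolding h_def using that p_gt_1 by (auto intro: powr_mono2')
    ultimately have "right_dini_ge (\<lambda>s. h (f s)) t ((p - 1) * f t powr (- p) * (k t * f t powr p))"
      using p_gt_1 f_pos by (intro right_dini_ge_compose dini t_bounds) auto
    moreover have "((\<lambda>s. - (p - 1) * integral {a..s} k) has_real_derivative
        - (p - 1) * k t) (at_right t)"
      using integral_has_real_derivative[OF cont(2), of t] t_bounds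
      by (intro DERIV_cmult) (auto simp: at_within_Icc_at intro: has_field_derivative_at_within)
    ultimately have "right_dini_ge F t
        ((p - 1) * f t powr (- p) * (k t * f t powr p) + - (p - 1) * k t)"
      unfolding F_def by (rule right_dini_ge_add[OF _ DERIV_imp_right_dini_ge])
    moreover have "(p - 1) * f t powr (- p) * (k t * f t powr p) + - (p - 1) * k t = 0"
      using f_pos by (simp add: powr_minus field_simps)
    ultimately show "right_dini_ge F t 0"
      by (simp only:)
  qed
  then have "(p - 1) * integral {a..b} k \<le> f a powr (1 - p) - f b powr (1 - p)"
    by (simp add: F_def h_def algebra_simps)
  then show ?thesis
    by (rule order_trans) simp
qed

lemma at_right_le_at_within:
  fixes t :: real
  assumes "a \<le> t" "t < b"
  shows "at_right t \<le> at t within {a..<b}"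
proof -
  have "at_right t = at t within {t<..<b}"
    using assms(2)
    by (simp add: at_within_nhd[of t "{..<b}" "{t<..}" "{t<..<b}"] Int_def set_eq_iff)
  also have "\<dots> \<le> at t within {a..<b}"
    using assms by (intro at_le) auto
  finally show ?thesis .
qed

lemma DERIV_within_imp_at_right:
  fixes t :: real
  assumes "(f has_real_derivative d) (at t within {a..<b})" "a \<le> t" "t < b"
  shows "(f has_real_derivative d) (at_right t)"
  using assms(1) tendsto_mono[OF at_right_le_at_within[OF assms(2,3)]]
  unfolding has_field_derivative_iff by blast

lemma increments_imp_right_dini_ge:
  fixes f k :: "real \<Rightarrow> real"
  assumes cont_k: "continuous_on {a<..<b} k"
    and increment: "\<And>s t. a < s \<Longrightarrow> s < t \<Longrightarrow> t < b \<Longrightarrow> integral {s..t} k \<le> f t - f s"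
    and t_bounds: "a < t" "t < b"
  shows "right_dini_ge f t (k t)"
proof (rule right_dini_geI)
  fix e :: real assume "e > 0"
  obtain b' where b'_bounds: "t < b'" "b' < b"
    using dense[OF t_bounds(2)] by blast
  have "continuous_on {t..b'} k"
    by (rule continuous_on_subset[OF cont_k]) (use t_bounds b'_bounds in auto)
  from integral_has_real_derivative[OF this, of t]
  have "((\<lambda>s. f t + integral {t..s} k) has_real_derivative k t) (at_right t)"
    using b'_bounds by (auto intro!: derivative_eq_intros simp: at_within_Icc_at_right)
  moreover have "\<forall>\<^sub>F s in at_right t. f t + integral {t..s} k \<le> f s"
    unfolding eventually_at_right_field using increment[of t] t_bounds
    by (intro exI[of _ b]) (auto simp: algebra_simps)
  ultimately show "\<exists>K D. K t = f t \<and> (K has_real_derivative D) (at_right t) \<and> k t - e \<le> D \<and>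
      (\<forall>\<^sub>F s in at_right t. K s \<le> f s)"
    using \<open>e > 0\<close> by (intro exI[of _ "\<lambda>s. f t + integral {t..s} k"] exI[of _ "k t"]) auto
qed

section \<open>The scalar differential inequality\<close>

lemma DERIV_phi_m:
  assumes "m \<ge> 0" "t > 0"
  shows "(phi_m m has_real_derivative t powr m) (at t within S)"
  unfolding phi_m_def using assms by (auto intro!: derivative_eq_intros)

lemma continuous_on_phi_m: "m \<ge> 0 \<Longrightarrow> S \<subseteq> {0<..} \<Longrightarrow> continuous_on S (phi_m m)"
  by (rule DERIV_continuous_on[where D = "\<lambda>t. t powr m"]) (auto intro: DERIV_phi_m)

lemma phi_m_pos: "m \<ge> 0 \<Longrightarrow> t > 0 \<Longrightarrow> phi_m m t > 0"
  by (simp add: phi_m_def)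

lemma phi_m_mono: "m \<ge> 0 \<Longrightarrow> 0 \<le> s \<Longrightarrow> s \<le> t \<Longrightarrow> phi_m m s \<le> phi_m m t"
  unfolding phi_m_def by (intro divide_right_mono powr_mono2) auto

lemma phi_m_diff_ge:
  assumes "m \<ge> 0" "1 \<le> s" "s \<le> t"
  shows "t - s \<le> phi_m m t - phi_m m s"
proof -
  have "phi_m m s - s \<le> phi_m m t - t"
  proof (rule DERIV_nonneg_imp_nondecreasing[OF assms(3)])
    fix x assume x_bounds: "s \<le> x" "x \<le> t"
    have "((\<lambda>x. phi_m m x - x) has_real_derivative x powr m - 1) (at x)"
      using assms x_bounds by (auto intro!: derivative_eq_intros DERIV_phi_m)
    moreover have "x powr m \<ge> 1"
      using assms x_bounds by (intro ge_one_powr_ge_zero) auto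
    ultimately show "\<exists>y. ((\<lambda>x. phi_m m x - x) has_real_derivative y) (at x) \<and> 0 \<le> y"
      by (intro exI[of _ "x powr m - 1"]) auto
  qed
  then show ?thesis by linarith
qed

locale tricomi_coefficients =
  fixes m \<mu> \<nu> :: real
  assumes m_nonneg: "m \<ge> 0" and discriminant: "(\<mu> - 1)\<^sup>2 - 4 * \<nu>\<^sup>2 \<ge> 0"
begin

text \<open>The Euler equation \<open>t\<^sup>2 U'' + \<mu> t U' + \<nu>\<^sup>2 U = 0\<close> is solved by \<open>t powr (- l)\<close> iff
  \<open>indicial l = 0\<close>.\<close>

definition indicial :: "real \<Rightarrow> real" where "indicial l = l\<^sup>2 - (\<mu> - 1) * l + \<nu>\<^sup>2"

definition \<alpha> :: real where "\<alpha> = (\<mu> - 1 - sqrt ((\<mu> - 1)\<^sup>2 - 4 * \<nu>\<^sup>2)) / 2"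

definition \<beta> :: real where "\<beta> = (\<mu> + m) / 2"

definition threshold :: real where "threshold = max 1 (max (2 * \<bar>indicial \<beta>\<bar>) (12 * \<beta>))"

definition growth_weight :: "real \<Rightarrow> real" where
  "growth_weight t = exp (- phi_m m t - \<bar>indicial \<beta>\<bar> / t)"

lemma indicial_\<alpha>: "indicial \<alpha> = 0"
proof -
  have "4 * indicial \<alpha> = (sqrt ((\<mu> - 1)\<^sup>2 - 4 * \<nu>\<^sup>2))\<^sup>2 - ((\<mu> - 1)\<^sup>2 - 4 * \<nu>\<^sup>2)"
    by (simp add: indicial_def \<alpha>_def power2_eq_square field_simps)
  then show ?thesis
    using discriminant by simp
qed

lemma \<alpha>_less_\<beta>: "\<alpha> < \<beta>"
  using m_nonneg real_sqrt_ge_zero[OF discriminant] unfolding \<alpha>_def \<beta>_def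
  by (intro divide_strict_right_mono) linarith+

lemma threshold_ge: "1 \<le> threshold" "2 * \<bar>indicial \<beta>\<bar> \<le> threshold" "12 * \<beta> \<le> threshold"
  by (auto simp: threshold_def)

lemma growth_weight_pos: "growth_weight t > 0"
  by (simp add: growth_weight_def)

lemma growth_weight_le: "t > 0 \<Longrightarrow> growth_weight t \<le> exp (- phi_m m t)"
  by (simp add: growth_weight_def)

lemma growth_weight_ge: "t \<ge> 1 \<Longrightarrow> exp (- phi_m m t - \<bar>indicial \<beta>\<bar>) \<le> growth_weight t"
  by (simp add: growth_weight_def divide_le_eq mult_le_cancel_left1)

lemma DERIV_growth_weight:
  assumes "t > 0"
  shows "(growth_weight has_real_derivative
    growth_weight t * (- (t powr m) + \<bar>indicial \<beta>\<bar> / t\<^sup>2)) (at t within S)"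
  unfolding growth_weight_def[abs_def] using assms m_nonneg
  by (auto intro!: derivative_eq_intros DERIV_phi_m simp: power2_eq_square)

lemma indicial_\<beta>_small:
  assumes "threshold \<le> t"
  shows "indicial \<beta> * t powr (- m - 2) \<le> t powr m / 2"
proof -
  have t_ge: "1 \<le> t" "2 * \<bar>indicial \<beta>\<bar> \<le> t"
    using assms threshold_ge by linarith+
  have "indicial \<beta> * t powr (- m - 2) \<le> \<bar>indicial \<beta>\<bar> * t powr (- 1)"
    using t_ge m_nonneg by (intro mult_mono powr_mono) auto
  also have "\<dots> \<le> 1 / 2"
    using t_ge by (simp add: powr_minus field_simps)
  also have "\<dots> \<le> t powr m / 2"
    using t_ge m_nonneg by (simp add: ge_one_powr_ge_zero)
  finally show ?thesis .
qed

end

locale damped_tricomi = tricomi_coefficients +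
  fixes T :: real and U V H :: "real \<Rightarrow> real"
  assumes DERIV_U: "1 \<le> t \<Longrightarrow> t < T \<Longrightarrow> (U has_real_derivative V t) (at t within {1..<T})"
    and cont_V: "continuous_on {1..<T} V"
    and dini_V: "1 < t \<Longrightarrow> t < T \<Longrightarrow>
      right_dini_ge V t ((t powr (2 * m) - \<nu>\<^sup>2 / t\<^sup>2) * U t - \<mu> / t * V t + H t)"
    and H_nonneg: "1 < t \<Longrightarrow> t < T \<Longrightarrow> H t \<ge> 0"
    and U_1: "U 1 \<ge> 0" and data_pos: "V 1 + \<alpha> * U 1 > 0"
begin

lemma cont_U: "continuous_on {1..<T} U"
  by (rule DERIV_continuous_on) (use DERIV_U in auto)

definition flux :: "real \<Rightarrow> real \<Rightarrow> real" where
  "flux l t = t powr (\<mu> - 1 - l) * (t * V t + l * U t)"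

lemma cont_flux: "continuous_on {1..<T} (flux l)"
  unfolding flux_def[abs_def] by (intro continuous_intros cont_U cont_V) auto

lemma DERIV_powr_mult_U:
  assumes "1 \<le> t" "t < T"
  shows "((\<lambda>t. t powr l * U t) has_real_derivative
      t powr (2 * l - \<mu>) * flux l t) (at t within {1..<T})"
proof -
  have "((\<lambda>t. t powr l * U t) has_real_derivative
      l * t powr (l - 1) * U t + V t * t powr l) (at t within {1..<T})"
    using assms by (auto intro!: derivative_eq_intros DERIV_U)
  moreover have "t powr (2 * l - \<mu>) * flux l t = t powr (l - 1) * (t * V t + l * U t)"
    unfolding flux_def mult.assoc[symmetric] powr_add[symmetric] by simp
  moreover have "t powr l = t powr (l - 1) * t"
    using assms by (simp add: powr_diff)
  ultimately show ?thesis
    by (simp add: algebra_simps)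
qed

text \<open>The exponent \<open>\<mu> - 1 - l\<close> is the one for which \<open>V\<close> drops out on the right-hand side.\<close>

lemma dini_flux:
  assumes "1 < t" "t < T"
  shows "right_dini_ge (flux l) t
    (t powr (\<mu> - 1 - l) * ((t * t powr (2 * m) - indicial l / t) * U t + t * H t))"
proof -
  define P where "P = t powr (\<mu> - 1 - l)"
  have t_bounds: "0 < t" "1 \<le> t"
    using assms by auto
  have "right_dini_ge (\<lambda>s. s * V s + l * U s) t
      (t * ((t powr (2 * m) - \<nu>\<^sup>2 / t\<^sup>2) * U t - \<mu> / t * V t + H t) + 1 * V t + l * V t)"
    using assms t_bounds
    by (intro right_dini_ge_add right_dini_ge_mult[OF dini_V] DERIV_imp_right_dini_ge DERIV_cmult
        DERIV_within_imp_at_right[OF DERIV_U] DERIV_ident) auto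
  moreover have "((\<lambda>s. s powr (\<mu> - 1 - l)) has_real_derivative (\<mu> - 1 - l) * (P / t)) (at_right t)"
  proof -
    have P_div: "P / t = t powr (\<mu> - 1 - l - 1)"
      using t_bounds powr_diff[of t "\<mu> - 1 - l" 1] by (simp add: P_def)
    show ?thesis
      unfolding P_div
      by (rule has_field_derivative_at_within[OF has_real_derivative_powr[OF t_bounds(1)]])
  qed
  ultimately have "right_dini_ge (flux l) t
      (P * (t * ((t powr (2 * m) - \<nu>\<^sup>2 / t\<^sup>2) * U t - \<mu> / t * V t + H t) + 1 * V t + l * V t)
      + (\<mu> - 1 - l) * (P / t) * (t * V t + l * U t))"
    unfolding flux_def[abs_def] P_def using t_bounds by (intro right_dini_ge_mult) auto
  also have "P * (t * ((t powr (2 * m) - \<nu>\<^sup>2 / t\<^sup>2) * U t - \<mu> / t * V t + H t) + 1 * V t + l * V t)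
      + (\<mu> - 1 - l) * (P / t) * (t * V t + l * U t) =
      P * ((t * t powr (2 * m) - indicial l / t) * U t + t * H t)"
    using t_bounds by (simp add: indicial_def field_simps power2_eq_square)
  finally show ?thesis
    by (simp only: P_def)
qed

lemma flux_\<alpha>_1: "flux \<alpha> 1 = V 1 + \<alpha> * U 1"
  by (simp add: flux_def)

lemma U_nonneg_if_flux_\<alpha>_pos:
  assumes t_bounds: "1 \<le> t" "t < T" and pos: "\<And>s. 1 < s \<Longrightarrow> s < t \<Longrightarrow> flux \<alpha> s > 0"
  shows "U t \<ge> 0"
proof -
  have "1 powr \<alpha> * U 1 \<le> t powr \<alpha> * U t"
  proof (rule right_dini_ge_imp_mono[OF t_bounds(1)])
    show "continuous_on {1..t} (\<lambda>t. t powr \<alpha> * U t)"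
      using t_bounds by (intro continuous_intros continuous_on_subset[OF cont_U]) auto
    fix s assume s_bounds: "1 < s" "s < t"
    then have "right_dini_ge (\<lambda>t. t powr \<alpha> * U t) s (s powr (2 * \<alpha> - \<mu>) * flux \<alpha> s)"
      using t_bounds
      by (intro DERIV_imp_right_dini_ge DERIV_within_imp_at_right[OF DERIV_powr_mult_U]) auto
    then show "right_dini_ge (\<lambda>t. t powr \<alpha> * U t) s 0"
      by (rule right_dini_ge_mono) (use pos[OF s_bounds] in simp)
  qed
  with U_1 have "0 \<le> t powr \<alpha> * U t"
    by simp
  then show ?thesis
    using t_bounds by (simp add: zero_le_mult_iff)
qed

lemma flux_\<alpha>_ge_if_pos:
  assumes t_bounds: "1 \<le> t" "t < T" and pos: "\<And>s. 1 < s \<Longrightarrow> s < t \<Longrightarrow> flux \<alpha> s > 0"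
  shows "flux \<alpha> 1 \<le> flux \<alpha> t"
proof (rule right_dini_ge_imp_mono[OF t_bounds(1)])
  show "continuous_on {1..t} (flux \<alpha>)"
    using t_bounds by (intro continuous_on_subset[OF cont_flux]) auto
  fix s assume s_bounds: "1 < s" "s < t"
  have "U s \<ge> 0"
    using s_bounds t_bounds pos by (intro U_nonneg_if_flux_\<alpha>_pos) auto
  then show "right_dini_ge (flux \<alpha>) s 0"
    using s_bounds t_bounds H_nonneg[of s] indicial_\<alpha>
    by (intro right_dini_ge_mono[OF dini_flux]) auto
qed

lemma flux_\<alpha>_pos:
  assumes "1 \<le> t" "t < T"
  shows "flux \<alpha> t > 0"
  using cont_flux _ assms
proof (rule pos_by_continuation)
  fix t assume t_bounds: "1 \<le> t" "t < T" and pos: "\<And>s. 1 \<le> s \<Longrightarrow> s < t \<Longrightarrow> flux \<alpha> s > 0"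
  have "flux \<alpha> 1 \<le> flux \<alpha> t"
    using pos by (intro flux_\<alpha>_ge_if_pos t_bounds) auto
  then show "flux \<alpha> t > 0"
    using data_pos by (simp add: flux_\<alpha>_1)
qed

lemma U_nonneg: "1 \<le> t \<Longrightarrow> t < T \<Longrightarrow> U t \<ge> 0"
  using flux_\<alpha>_pos by (intro U_nonneg_if_flux_\<alpha>_pos) auto

lemma flux_\<alpha>_ge: "1 \<le> t \<Longrightarrow> t < T \<Longrightarrow> flux \<alpha> 1 \<le> flux \<alpha> t"
  using flux_\<alpha>_pos by (intro flux_\<alpha>_ge_if_pos) auto

text \<open>Liouville transform: with respect to the new time \<open>phi_m m t\<close> the derivative of \<open>g\<close> is
  \<open>\<gamma>\<close>, and \<open>g\<close> solves \<open>g'' = (1 + O(t powr (- 2 * m - 2))) g\<close> up to the nonnegative forcing.\<close>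

definition g :: "real \<Rightarrow> real" where "g t = t powr \<beta> * U t"

definition \<gamma> :: "real \<Rightarrow> real" where "\<gamma> = flux \<beta>"

lemma cont_g: "continuous_on {1..<T} g"
  unfolding g_def[abs_def] by (intro continuous_intros cont_U) auto

lemma cont_\<gamma>: "continuous_on {1..<T} \<gamma>"
  unfolding \<gamma>_def by (rule cont_flux)

lemma DERIV_g:
  assumes "1 \<le> t" "t < T"
  shows "(g has_real_derivative t powr m * \<gamma> t) (at t within {1..<T})"
proof -
  have "2 * \<beta> - \<mu> = m"
    by (simp add: \<beta>_def field_simps)
  with DERIV_powr_mult_U[OF assms, of \<beta>] show ?thesis
    by (simp add: g_def[abs_def] \<gamma>_def)
qed

lemma dini_g: "1 \<le> t \<Longrightarrow> t < T \<Longrightarrow> right_dini_ge g t (t powr m * \<gamma> t)"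
  by (intro DERIV_imp_right_dini_ge DERIV_within_imp_at_right[OF DERIV_g])

lemma dini_\<gamma>:
  assumes "1 < t" "t < T"
  shows "right_dini_ge \<gamma> t
    ((t powr m - indicial \<beta> * t powr (- m - 2)) * g t + t powr (\<beta> - m) * H t)"
proof -
  have exponent: "\<mu> - 1 - \<beta> = \<beta> - m - 1"
    by (simp add: \<beta>_def field_simps)
  have "t powr (\<mu> - 1 - \<beta>) * ((t * t powr (2 * m) - indicial \<beta> / t) * U t + t * H t) =
      (t powr m - indicial \<beta> * t powr (- m - 2)) * g t + t powr (\<beta> - m) * H t"
  proof -
    define M i j X where "M = t powr m" and "i = 1 / t" and "j = 1 / t powr m" and "X = t powr \<beta>"
    have "t * i = 1" "M * j = 1"
      using assms by (simp_all add: M_def i_def j_def)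
    then have "X * j * i * ((t * (M * M) - indicial \<beta> * i) * U t + t * H t) =
        (M - indicial \<beta> * (j * i * i)) * (X * U t) + X * j * H t"
      by algebra
    moreover have "t powr (2 * m) = M * M"
      by (simp add: M_def powr_add[symmetric])
    moreover have "t powr (- m - 2) = j * i * i" "t powr (\<beta> - m) = X * j"
      "t powr (\<beta> - m - 1) = X * j * i"
      using assms
      by (simp_all add: i_def j_def X_def powr_diff powr_add powr_minus power2_eq_square
          field_simps)
    ultimately show ?thesis
      unfolding exponent g_def by (simp add: i_def M_def X_def)
  qed
  with dini_flux[OF assms, of \<beta>] show ?thesis
    by (simp only: \<gamma>_def)
qed

lemma g_nonneg: "1 \<le> t \<Longrightarrow> t < T \<Longrightarrow> g t \<ge> 0"
  by (simp add: g_def U_nonneg)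

lemma \<gamma>_ge:
  assumes "1 \<le> t" "t < T"
  shows "t powr (\<alpha> - \<beta>) * (V 1 + \<alpha> * U 1) \<le> \<gamma> t"
proof -
  have "t powr (\<alpha> - \<beta>) * (V 1 + \<alpha> * U 1) \<le> t powr (\<alpha> - \<beta>) * flux \<alpha> t"
    using flux_\<alpha>_ge[OF assms] by (intro mult_left_mono) (auto simp: flux_\<alpha>_1)
  also have "\<dots> = t powr (\<mu> - 1 - \<beta>) * (t * V t + \<alpha> * U t)"
    unfolding flux_def mult.assoc[symmetric] powr_add[symmetric] by simp
  also have "\<dots> \<le> t powr (\<mu> - 1 - \<beta>) * (t * V t + \<beta> * U t)"
    using U_nonneg[OF assms] \<alpha>_less_\<beta> by (intro mult_left_mono add_left_mono mult_right_mono) auto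
  finally show ?thesis
    by (simp add: \<gamma>_def flux_def)
qed

lemma \<gamma>_pos:
  assumes "1 \<le> t" "t < T"
  shows "\<gamma> t > 0"
proof -
  have "0 < t powr (\<alpha> - \<beta>) * (V 1 + \<alpha> * U 1)"
    using data_pos assms by simp
  also have "\<dots> \<le> \<gamma> t"
    by (rule \<gamma>_ge[OF assms])
  finally show ?thesis .
qed

lemma g_mono:
  assumes "1 \<le> s" "s \<le> t" "t < T"
  shows "g s \<le> g t"
proof (rule right_dini_ge_imp_mono[OF assms(2)])
  show "continuous_on {s..t} g"
    using assms by (intro continuous_on_subset[OF cont_g]) auto
  fix x assume "s < x" "x < t"
  then show "right_dini_ge g x 0"
    using assms less_imp_le[OF \<gamma>_pos[of x]] by (intro right_dini_ge_mono[OF dini_g]) auto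
qed

text \<open>The solutions \<open>exp (\<plusminus> phi_m m t)\<close> of \<open>g'' = g\<close> have \<open>\<gamma> = \<plusminus> g\<close>; the decaying one is negligible
  after unit time.\<close>

lemma exp_mult_\<gamma>_minus_half_g_mono:
  assumes "threshold \<le> s" "s \<le> t" "t < T"
  shows "exp (phi_m m s / 2) * (\<gamma> s - g s / 2) \<le> exp (phi_m m t / 2) * (\<gamma> t - g t / 2)"
proof (rule right_dini_ge_imp_mono[OF assms(2)])
  show "continuous_on {s..t} (\<lambda>t. exp (phi_m m t / 2) * (\<gamma> t - g t / 2))"
    using assms threshold_ge m_nonneg
    by (intro continuous_intros continuous_on_phi_m continuous_on_subset[OF cont_g]
        continuous_on_subset[OF cont_\<gamma>]) auto
  fix x assume "s < x" "x < t"
  then have x_gt: "threshold \<le> x" "1 < x" "1 \<le> x" "x < T"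
    using assms threshold_ge by auto
  define E where "E t = exp (phi_m m t / 2)" for t
  define \<gamma>' where "\<gamma>' = (x powr m - indicial \<beta> * x powr (- m - 2)) * g x + x powr (\<beta> - m) * H x"
  have "((\<lambda>t. - (1 / 2) * g t) has_real_derivative - (1 / 2) * (x powr m * \<gamma> x)) (at_right x)"
    using x_gt by (intro DERIV_cmult DERIV_within_imp_at_right[OF DERIV_g]) auto
  then have "right_dini_ge (\<lambda>t. \<gamma> t + - (1 / 2) * g t) x (\<gamma>' + - (1 / 2) * (x powr m * \<gamma> x))"
    unfolding \<gamma>'_def using x_gt by (intro right_dini_ge_add dini_\<gamma> DERIV_imp_right_dini_ge) auto
  moreover have "(E has_real_derivative E x * (x powr m / 2)) (at_right x)"
    unfolding E_def using x_gt m_nonneg by (auto intro!: derivative_eq_intros DERIV_phi_m)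
  ultimately have "right_dini_ge (\<lambda>t. E t * (\<gamma> t + - (1 / 2) * g t)) x
      (E x * (\<gamma>' + - (1 / 2) * (x powr m * \<gamma> x)) + E x * (x powr m / 2) * (\<gamma> x + - (1 / 2) * g x))"
    by (rule right_dini_ge_mult) (simp add: E_def)
  moreover have "indicial \<beta> * x powr (- m - 2) \<le> 3 / 4 * x powr m"
    using indicial_\<beta>_small[OF x_gt(1)] powr_ge_zero[of x m] by linarith
  then have "0 \<le>
      E x * ((3 / 4 * x powr m - indicial \<beta> * x powr (- m - 2)) * g x + x powr (\<beta> - m) * H x)"
    using g_nonneg[of x] H_nonneg[of x] x_gt
    by (intro mult_nonneg_nonneg add_nonneg_nonneg) (auto simp: E_def)
  ultimately have "right_dini_ge (\<lambda>t. E t * (\<gamma> t + - (1 / 2) * g t)) x 0"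
    by (elim right_dini_ge_mono) (simp add: \<gamma>'_def algebra_simps)
  then show "right_dini_ge (\<lambda>t. exp (phi_m m t / 2) * (\<gamma> t - g t / 2)) x 0"
    by (simp add: E_def)
qed

lemma g_le_6_\<gamma>:
  assumes "threshold + 1 \<le> t" "t < T"
  shows "g t \<le> 6 * \<gamma> t"
proof -
  define E where "E t = exp (phi_m m t / 2)" for t
  have threshold_bounds: "1 \<le> threshold" "threshold \<le> t" "threshold < T"
    using assms threshold_ge by auto
  have "3 / 2 \<le> exp (1 / 2 :: real)"
    using exp_ge_add_one_self[of "1 / 2 :: real"] by simp
  also have "\<dots> \<le> exp ((phi_m m t - phi_m m threshold) / 2)"
    using phi_m_diff_ge[OF m_nonneg threshold_bounds(1,2)] assms by simp
  finally have "E threshold * (3 / 2) \<le> E threshold * exp ((phi_m m t - phi_m m threshold) / 2)"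
    by (intro mult_left_mono) (auto simp: E_def)
  also have "\<dots> = E t"
    by (simp add: E_def exp_add[symmetric] diff_divide_distrib)
  finally have "E threshold * (g t / 2) \<le> E t * (g t / 3)"
    using mult_right_mono[of "E threshold * (3 / 2)" "E t" "g t / 3"] g_nonneg[of t]
      threshold_bounds assms by (simp add: mult_ac)
  moreover have "- (E threshold * (g t / 2)) \<le> E threshold * (\<gamma> threshold - g threshold / 2)"
    unfolding mult_minus_right[symmetric]
    using g_mono[of threshold t] \<gamma>_pos[of threshold] threshold_bounds assms
    by (intro mult_left_mono) (auto simp: E_def)
  ultimately have "0 \<le> E t * (\<gamma> t - g t / 2) + E t * (g t / 3)"
    using exp_mult_\<gamma>_minus_half_g_mono[OF order_refl threshold_bounds(2) assms(2)] unfolding E_def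
    by linarith
  then show ?thesis
    unfolding distrib_left[symmetric] by (simp add: E_def zero_le_mult_iff)
qed

lemma V_ge:
  assumes "threshold + 1 \<le> t" "t < T"
  shows "t powr (m - \<beta>) * (\<gamma> t + g t) / 14 \<le> V t"
proof -
  have t_ge: "1 \<le> t" "12 * \<beta> \<le> t"
    using assms threshold_ge by auto
  have "\<beta> \<le> t powr 1 / 12"
    using t_ge by simp
  also have "\<dots> \<le> t powr (m + 1) / 12"
    using t_ge m_nonneg by (intro divide_right_mono powr_mono) auto
  finally have "\<beta> * t powr (- m - 1) \<le> 1 / 12"
    using t_ge by (simp add: powr_diff powr_minus powr_add field_simps)
  from mult_right_mono[OF this g_nonneg[OF t_ge(1) assms(2)]]
  have "(\<gamma> t + g t) / 14 \<le> \<gamma> t - \<beta> * t powr (- m - 1) * g t"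
    using g_le_6_\<gamma>[OF assms] by simp
  then have "t powr (m - \<beta>) * ((\<gamma> t + g t) / 14)
      \<le> t powr (m - \<beta>) * (\<gamma> t - \<beta> * t powr (- m - 1) * g t)"
    by (intro mult_left_mono) auto
  also have "\<dots> = V t"
  proof -
    have exponent: "\<mu> - 1 - \<beta> = \<beta> - m - 1"
      by (simp add: \<beta>_def field_simps)
    show ?thesis
      using t_ge unfolding \<gamma>_def flux_def exponent
      by (simp add: g_def powr_diff powr_minus powr_add field_simps)
  qed
  finally show ?thesis by simp
qed

definition Z :: "real \<Rightarrow> real" where "Z t = growth_weight t * (\<gamma> t + g t)"

lemma Z_pos: "1 \<le> t \<Longrightarrow> t < T \<Longrightarrow> Z t > 0"
  using \<gamma>_pos[of t] g_nonneg[of t] growth_weight_pos[of t] by (simp add: Z_def add_pos_nonneg)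

lemma cont_Z: "continuous_on {1..<T} Z"
  unfolding Z_def[abs_def] growth_weight_def using m_nonneg
  by (intro continuous_intros continuous_on_phi_m cont_g cont_\<gamma>) auto

lemma dini_Z:
  assumes "1 < t" "t < T"
  shows "right_dini_ge Z t (growth_weight t * (t powr (\<beta> - m) * H t))"
proof -
  define w where "w = growth_weight t"
  define q where "q = indicial \<beta>"
  have "right_dini_ge Z t (w * (((t powr m - q * t powr (- m - 2)) * g t + t powr (\<beta> - m) * H t)
      + t powr m * \<gamma> t) + w * (- (t powr m) + \<bar>q\<bar> / t\<^sup>2) * (\<gamma> t + g t))"
    unfolding Z_def[abs_def] w_def q_def using assms
    by (intro right_dini_ge_mult right_dini_ge_add dini_\<gamma> dini_g DERIV_growth_weight
        growth_weight_pos) auto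
  moreover have "0 \<le> (\<bar>q\<bar> / t\<^sup>2 - q * t powr (- m - 2)) * g t + \<bar>q\<bar> / t\<^sup>2 * \<gamma> t"
  proof -
    have "q * t powr (- m - 2) \<le> \<bar>q\<bar> * t powr (- 2)"
      using assms m_nonneg by (intro mult_mono powr_mono) auto
    also have "\<dots> = \<bar>q\<bar> / t\<^sup>2"
      using assms by (simp add: powr_minus divide_inverse)
    finally show ?thesis
      using g_nonneg[of t] \<gamma>_pos[of t] assms by simp
  qed
  then have "0 \<le> w * ((\<bar>q\<bar> / t\<^sup>2 - q * t powr (- m - 2)) * g t + \<bar>q\<bar> / t\<^sup>2 * \<gamma> t)"
    by (simp add: w_def less_imp_le[OF growth_weight_pos])
  ultimately show ?thesis
    unfolding w_def[symmetric] by (elim right_dini_ge_mono) (simp add: algebra_simps)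
qed

lemma V_ge_Z:
  assumes "threshold + 1 \<le> t" "t < T"
  shows "t powr (m - \<beta>) * (exp (phi_m m t) * Z t) / 14 \<le> V t"
proof -
  have t_ge: "1 \<le> t" "0 < t"
    using assms threshold_ge by auto
  have "Z t \<le> exp (- phi_m m t) * (\<gamma> t + g t)"
    unfolding Z_def using growth_weight_le[OF t_ge(2)] \<gamma>_pos[OF t_ge(1)] g_nonneg[OF t_ge(1)] assms
    by (intro mult_right_mono) auto
  then have "exp (phi_m m t) * Z t \<le> \<gamma> t + g t"
    by (simp add: exp_minus field_simps)
  then have "t powr (m - \<beta>) * (exp (phi_m m t) * Z t) / 14 \<le> t powr (m - \<beta>) * (\<gamma> t + g t) / 14"
    by (intro divide_right_mono mult_left_mono) auto
  also have "\<dots> \<le> V t"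
    by (rule V_ge[OF assms])
  finally show ?thesis .
qed

lemma dini_Z_superlinear:
  assumes p_gt_1: "p > 1" and c_nonneg: "c \<ge> 0" and t_bounds: "threshold + 1 \<le> t" "t < T"
    and H_ge: "c * \<bar>V t\<bar> powr p * (exp (phi_m m t) * t powr d) powr (1 - p) \<le> H t"
  shows "right_dini_ge Z t
    (c * exp (- \<bar>indicial \<beta>\<bar>) * 14 powr (- p) * t powr ((1 - p) * (\<beta> - m + d)) * Z t powr p)"
proof (rule right_dini_ge_mono[OF dini_Z])
  define F where "F = phi_m m t"
  define M where "M =
      (t powr (m - \<beta>) * (exp F * Z t) / 14) powr p * (exp F * t powr d) powr (1 - p)"
  show t_gt: "1 < t" "t < T"
    using t_bounds threshold_ge by auto
  have Z_t_pos: "Z t > 0"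
    using t_gt by (intro Z_pos) auto
  have "t powr (m - \<beta>) * (exp F * Z t) / 14 \<le> \<bar>V t\<bar>"
    using V_ge_Z[OF t_bounds] by (simp add: F_def)
  then have "c * M \<le> c * (\<bar>V t\<bar> powr p * (exp F * t powr d) powr (1 - p))"
    unfolding M_def using Z_t_pos p_gt_1 c_nonneg
    by (intro mult_left_mono mult_right_mono powr_mono2) auto
  also have "\<dots> \<le> H t"
    using H_ge by (simp add: F_def mult.assoc)
  finally have "exp (- F - \<bar>indicial \<beta>\<bar>) * (t powr (\<beta> - m) * (c * M))
      \<le> growth_weight t * (t powr (\<beta> - m) * H t)"
    using growth_weight_ge[of t] growth_weight_pos[of t] c_nonneg t_gt unfolding F_def
    by (intro mult_mono mult_left_mono) (auto simp: M_def)
  moreover have "M = t powr ((m - \<beta>) * p) * (exp (F * p) * Z t powr p) * 14 powr (- p) *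
      (exp (F * (1 - p)) * t powr (d * (1 - p)))"
    unfolding M_def using Z_t_pos
    by (simp add: powr_divide powr_mult powr_powr exp_powr_real powr_minus divide_simps)
  moreover have "t powr ((1 - p) * (\<beta> - m + d)) =
      t powr (\<beta> - m) * t powr ((m - \<beta>) * p) * t powr (d * (1 - p))"
    by (simp add: powr_add[symmetric] algebra_simps)
  moreover have "exp (- \<bar>indicial \<beta>\<bar>) = exp (- F - \<bar>indicial \<beta>\<bar>) * exp (F * p) * exp (F * (1 - p))"
    by (simp add: exp_add[symmetric] algebra_simps)
  ultimately show
    "c * exp (- \<bar>indicial \<beta>\<bar>) * 14 powr (- p) * t powr ((1 - p) * (\<beta> - m + d)) * Z t powr p
      \<le> growth_weight t * (t powr (\<beta> - m) * H t)"
    by (simp only: mult_ac)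
qed

lemma lifespan_integral_bound:
  assumes p_gt_1: "p > 1" and c_nonneg: "c \<ge> 0" and t_bounds: "threshold + 1 \<le> t" "t < T"
    and H_ge: "\<And>t. 1 < t \<Longrightarrow> t < T \<Longrightarrow>
        c * \<bar>V t\<bar> powr p * (exp (phi_m m t) * t powr d) powr (1 - p) \<le> H t"
  defines "t1 \<equiv> threshold + 1"
  shows "(p - 1) * (c * exp (- \<bar>indicial \<beta>\<bar>) * 14 powr (- p)) *
      integral {t1..t} (\<lambda>s. s powr ((1 - p) * (\<beta> - m + d)))
    \<le> (growth_weight t1 * t1 powr (\<alpha> - \<beta>) * (V 1 + \<alpha> * U 1)) powr (1 - p)"
proof -
  define c' where "c' = c * exp (- \<bar>indicial \<beta>\<bar>) * 14 powr (- p)"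
  have t1_bounds: "1 \<le> t1" "t1 \<le> t" "t1 < T"
    using threshold_ge t_bounds by (auto simp: t1_def)
  have "(p - 1) * integral {t1..t} (\<lambda>s. c' * s powr ((1 - p) * (\<beta> - m + d))) \<le> Z t1 powr (1 - p)"
  proof (rule right_dini_bernoulli[OF p_gt_1 t1_bounds(2)])
    show "continuous_on {t1..t} Z"
      using t1_bounds t_bounds by (intro continuous_on_subset[OF cont_Z]) auto
    show "continuous_on {t1..t} (\<lambda>s. c' * s powr ((1 - p) * (\<beta> - m + d)))"
      using t1_bounds by (intro continuous_intros) auto
    show "Z s > 0" if "t1 \<le> s" "s \<le> t" for s
      using that t1_bounds t_bounds by (intro Z_pos) auto
    show "right_dini_ge Z s (c' * s powr ((1 - p) * (\<beta> - m + d)) * Z s powr p)"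
      if "t1 < s" "s < t" for s
      unfolding c'_def using that t1_bounds t_bounds
      by (intro dini_Z_superlinear p_gt_1 c_nonneg H_ge) (auto simp: t1_def)
  qed
  also have "\<dots> \<le> (growth_weight t1 * t1 powr (\<alpha> - \<beta>) * (V 1 + \<alpha> * U 1)) powr (1 - p)"
  proof (rule powr_mono2')
    have "growth_weight t1 * (t1 powr (\<alpha> - \<beta>) * (V 1 + \<alpha> * U 1)) \<le> growth_weight t1 * (\<gamma> t1 + g t1)"
      using \<gamma>_ge[OF t1_bounds(1,3)] g_nonneg[OF t1_bounds(1,3)] growth_weight_pos[of t1]
      by (intro mult_left_mono) auto
    then show "growth_weight t1 * t1 powr (\<alpha> - \<beta>) * (V 1 + \<alpha> * U 1) \<le> Z t1"
      by (simp add: Z_def mult.assoc)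
    show "0 < growth_weight t1 * t1 powr (\<alpha> - \<beta>) * (V 1 + \<alpha> * U 1)"
      using data_pos growth_weight_pos t1_bounds by simp
  qed (use p_gt_1 in simp)
  finally show ?thesis
    by (simp add: c'_def mult.assoc)
qed

end

lemma (in tricomi_coefficients) damped_tricomi_lifespan:
  assumes p_gt_1: "p > 1" and c_pos: "c > 0" and I_pos: "I > 0"
  obtains K where "K > 0"
    "\<And>\<epsilon> T U V H t. damped_tricomi m \<mu> \<nu> T U V H \<Longrightarrow> \<epsilon> > 0 \<Longrightarrow> V 1 + \<alpha> * U 1 = \<epsilon> * I \<Longrightarrow>
      (\<And>t. 1 < t \<Longrightarrow> t < T \<Longrightarrow> c * \<bar>V t\<bar> powr p * (exp (phi_m m t) * t powr d) powr (1 - p) \<le> H t) \<Longrightarrow>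
      threshold + 1 \<le> t \<Longrightarrow> t < T \<Longrightarrow>
      integral {threshold + 1..t} (\<lambda>s. s powr ((1 - p) * ((\<mu> - m) / 2 + d))) \<le> K * \<epsilon> powr (1 - p)"
proof -
  define L where "L = growth_weight (threshold + 1) * (threshold + 1) powr (\<alpha> - \<beta>) * I"
  define c' where "c' = (p - 1) * (c * exp (- \<bar>indicial \<beta>\<bar>) * 14 powr (- p))"
  have pos: "L > 0" "c' > 0"
    using growth_weight_pos threshold_ge I_pos c_pos p_gt_1 by (auto simp: L_def c'_def)
  have exponent: "(\<mu> - m) / 2 + d = \<beta> - m + d"
    by (simp add: \<beta>_def field_simps)
  show ?thesis
  proof (rule that[of "L powr (1 - p) / c'"])
    show "0 < L powr (1 - p) / c'"
      using pos by simp
    fix \<epsilon> T U V H t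
    assume "damped_tricomi m \<mu> \<nu> T U V H" and data_eq: "\<epsilon> > 0" "V 1 + \<alpha> * U 1 = \<epsilon> * I"
      and H_ge: "\<And>t. 1 < t \<Longrightarrow> t < T \<Longrightarrow>
          c * \<bar>V t\<bar> powr p * (exp (phi_m m t) * t powr d) powr (1 - p) \<le> H t"
      and t_bounds: "threshold + 1 \<le> t" "t < T"
    then interpret damped_tricomi m \<mu> \<nu> T U V H
      by blast
    have "c' * integral {threshold + 1..t} (\<lambda>s. s powr ((1 - p) * (\<beta> - m + d)))
        \<le> (L * \<epsilon>) powr (1 - p)"
      using lifespan_integral_bound[OF p_gt_1 less_imp_le[OF c_pos] t_bounds H_ge]
      unfolding data_eq(2)
      by (simp add: c'_def L_def mult_ac)
    then show "integral {threshold + 1..t} (\<lambda>s. s powr ((1 - p) * ((\<mu> - m) / 2 + d)))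
        \<le> L powr (1 - p) / c' * \<epsilon> powr (1 - p)"
      using pos unfolding exponent by (simp add: powr_mult field_simps)
  qed
qed

section \<open>Moments of weak solutions\<close>

lemma set_integral_Icc_diff:
  fixes f :: "real \<Rightarrow> real"
  assumes "a \<le> b" "b \<le> c" and int: "set_integrable lborel {a..c} f"
  shows "(LINT s:{a..c}|lborel. f s) - (LINT s:{a..b}|lborel. f s) = integral {b..c} f"
proof -
  have "set_integrable lborel {a..b} f"
    using int by (rule set_integrable_subset) (use assms(1,2) in auto)
  moreover have "integral {a..b} f + integral {b..c} f = integral {a..c} f"
    using set_borel_integral_eq_integral(1)[OF int]
    by (intro Henstock_Kurzweil_Integration.integral_combine assms)
  ultimately show ?thesis
    using int by (simp add: set_borel_integral_eq_integral(2))
qed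

lemma set_integrable_mult_continuous:
  fixes f w :: "'a::euclidean_space \<Rightarrow> real"
  assumes compact_K: "compact K" and cont_w: "continuous_on K w"
    and int_f: "set_integrable lborel K f"
  shows "set_integrable lborel K (\<lambda>x. f x * w x)"
proof -
  define f' where "f' x = indicator K x *\<^sub>R f x" for x
  define w' where "w' x = indicator K x *\<^sub>R w x" for x
  obtain B where w_bounded: "\<And>x. x \<in> K \<Longrightarrow> \<bar>w x\<bar> \<le> B"
    using compact_imp_bounded[OF compact_continuous_image[OF cont_w compact_K]]
    by (auto simp: bounded_iff)
  have int_f': "integrable lborel f'"
    using int_f by (simp add: f'_def[abs_def] set_integrable_def)
  have "integrable lborel (\<lambda>x. f' x * w' x)"
  proof (rule Bochner_Integration.integrable_bound[OF integrable_mult_right[OF int_f', of B]])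
    have "w' \<in> borel_measurable lborel"
      unfolding w'_def[abs_def]
      using borel_measurable_continuous_on_indicator[OF borel_compact[OF compact_K] cont_w] by simp
    with int_f' show "(\<lambda>x. f' x * w' x) \<in> borel_measurable lborel"
      by (intro borel_measurable_times) auto
    have "\<bar>f x * w x\<bar> \<le> \<bar>B * f x\<bar>" if "x \<in> K" for x
      using mult_left_mono[OF order_trans[OF w_bounded[OF that] abs_ge_self[of B]], of "\<bar>f x\<bar>"]
      by (simp add: abs_mult mult.commute)
    then show "AE x in lborel. norm (f' x * w' x) \<le> norm (B * f' x)"
      by (intro always_eventually) (auto simp: f'_def w'_def indicator_def)
  qed
  moreover have "(\<lambda>x. f' x * w' x) = (\<lambda>x. indicator K x *\<^sub>R (f x * w x))"
    by (auto simp: f'_def w'_def indicator_def)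
  ultimately show ?thesis by (simp add: set_integrable_def)
qed

lemma integral_mult_cong_supp:
  fixes f \<psi> \<psi>' :: "'a::euclidean_space \<Rightarrow> real"
  assumes supp: "AE x in lborel. r < norm x \<longrightarrow> f x = 0" and eq: "\<And>x. norm x \<le> r \<Longrightarrow> \<psi> x = \<psi>' x"
    and [measurable]: "f \<in> borel_measurable borel" "\<psi> \<in> borel_measurable borel"
      "\<psi>' \<in> borel_measurable borel"
  shows "(LINT x|lborel. f x * \<psi> x) = (LINT x|lborel. f x * \<psi>' x)"
proof (rule integral_cong_AE)
  show "AE x in lborel. f x * \<psi> x = f x * \<psi>' x"
    using supp by eventually_elim (use eq in \<open>auto simp: not_less[symmetric]\<close>)
qed measurable

definition moment :: "(real^'n \<Rightarrow> real \<Rightarrow> real) \<Rightarrow> (real^'n \<Rightarrow> real) \<Rightarrow> real \<Rightarrow> real" where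
  "moment w \<psi> t = (LINT x|lborel. w x t * \<psi> x)"

locale weak_solution =
  fixes m \<mu> \<nu> p \<epsilon> T :: real and u0 u1 :: "real^'n \<Rightarrow> real"
    and u v :: "real^'n \<Rightarrow> real \<Rightarrow> real" and G :: "real^'n \<Rightarrow> real \<Rightarrow> real^'n"
  assumes T_gt_1: "1 < T"
    and L2_u: "\<And>t. 1 \<le> t \<Longrightarrow> t < T \<Longrightarrow> L2 (\<lambda>x. u x t)"
    and grad_u: "\<And>t. 1 \<le> t \<Longrightarrow> t < T \<Longrightarrow> weak_grad (\<lambda>x. u x t) (\<lambda>x. G x t)"
    and L2_G: "\<And>t i. 1 \<le> t \<Longrightarrow> t < T \<Longrightarrow> L2 (\<lambda>x. G x t $ i)"
    and L2_v: "\<And>t. 1 \<le> t \<Longrightarrow> t < T \<Longrightarrow> L2 (\<lambda>x. v x t)"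
    and deriv_u: "\<And>t. 1 \<le> t \<Longrightarrow> t < T \<Longrightarrow>
      ((\<lambda>s. L2dist2 (\<lambda>x. (u x s - u x t) / (s - t)) (\<lambda>x. v x t)) \<longlongrightarrow> 0) (at t within {1..<T})"
    and cont_v: "\<And>t. 1 \<le> t \<Longrightarrow> t < T \<Longrightarrow>
      ((\<lambda>s. L2dist2 (\<lambda>x. v x s) (\<lambda>x. v x t)) \<longlongrightarrow> 0) (at t within {1..<T})"
    and Lp_v: "\<And>K. compact K \<Longrightarrow> K \<subseteq> UNIV \<times> {1<..<T} \<Longrightarrow>
      set_integrable lborel K (\<lambda>z. \<bar>v (fst z) (snd z)\<bar> powr p)"
    and init: "AE x in lborel. u x 1 = \<epsilon> * u0 x"
    and weak: "\<And>\<Phi> t. test_fn_T T \<Phi> \<Longrightarrow> 1 \<le> t \<Longrightarrow> t < T \<Longrightarrow>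
        (LINT x|lborel. v x t * \<Phi> x t)
        - \<epsilon> * (LINT x|lborel. u1 x * \<Phi> x 1)
        - (LINT s:{1..t}|lborel. (LINT x|lborel. v x s * dt_T \<Phi> x s))
        + (LINT s:{1..t}|lborel.
          (LINT x|lborel. s powr (2 * m) * (\<Sum>i\<in>UNIV. G x s $ i * dx_T \<Phi> i x s)))
        + (LINT s:{1..t}|lborel. (LINT x|lborel. \<mu> / s * v x s * \<Phi> x s))
        + (LINT s:{1..t}|lborel. (LINT x|lborel. \<nu>^2 / s^2 * u x s * \<Phi> x s))
        = (LINT s:{1..t}|lborel. (LINT x|lborel. \<bar>v x s\<bar> powr p * \<Phi> x s))"

lemma weak_sol_imp_weak_solution:
  assumes "weak_sol m \<mu> \<nu> p \<epsilon> u0 u1 T u"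
  obtains v G where "weak_solution m \<mu> \<nu> p \<epsilon> T u0 u1 u v G"
proof -
  have mem: "t \<in> {1..<T}" if "1 \<le> t" "t < T" for t
    using that by simp
  from assms show thesis
    unfolding weak_sol_def
  proof (elim conjE exE, goal_cases)
    case (1 G v)
    have "weak_solution m \<mu> \<nu> p \<epsilon> T u0 u1 u v G"
      by unfold_locales (use 1 mem in \<open>blast+\<close>)
    then show ?case by (rule that)
  qed
qed

context weak_solution
begin

lemma eventually_at_within_Ico: "\<forall>\<^sub>F s in at t within {1..<T}. 1 \<le> s \<and> s < T"
  by (simp add: eventually_at_filter)

lemma L2_difference_quotient:
  assumes "1 \<le> s" "s < T" "1 \<le> t" "t < T"
  shows "L2 (\<lambda>x. (u x s - u x t) / (s - t))"
  using L2_cmult[OF L2_diff[OF L2_u[OF assms(1,2)] L2_u[OF assms(3,4)]], of "1 / (s - t)"] by simp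

lemma DERIV_moment_u:
  assumes L2_\<psi>: "L2 \<psi>" and t_bounds: "1 \<le> t" "t < T"
  shows "(moment u \<psi> has_real_derivative moment v \<psi> t) (at t within {1..<T})"
  unfolding has_field_derivative_iff
proof (rule Lim_transform_eventually)
  show "((\<lambda>s. LINT x|lborel. (u x s - u x t) / (s - t) * \<psi> x) \<longlongrightarrow> moment v \<psi> t) (at t within {1..<T})"
    unfolding moment_def
  proof (intro L2_tendsto_integral deriv_u L2_v t_bounds L2_\<psi>)
    show "\<forall>\<^sub>F s in at t within {1..<T}. L2 (\<lambda>x. (u x s - u x t) / (s - t))"
      using eventually_at_within_Ico by eventually_elim (simp add: L2_difference_quotient t_bounds)
  qed
  show "\<forall>\<^sub>F s in at t within {1..<T}.
      (LINT x|lborel. (u x s - u x t) / (s - t) * \<psi> x) = (moment u \<psi> s - moment u \<psi> t) / (s - t)"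
    using eventually_at_within_Ico
  proof eventually_elim
    case (elim s)
    then have "integrable lborel (\<lambda>x. u x s * \<psi> x)" "integrable lborel (\<lambda>x. u x t * \<psi> x)"
      using t_bounds by (auto intro!: L2_mult_integrable L2_u L2_\<psi>)
    then show ?case
      by (simp add: moment_def left_diff_distrib)
  qed
qed

lemma cont_moment_u: "L2 \<psi> \<Longrightarrow> continuous_on {1..<T} (moment u \<psi>)"
  by (rule DERIV_continuous_on) (use DERIV_moment_u in auto)

lemma cont_moment_v:
  assumes "L2 \<psi>"
  shows "continuous_on {1..<T} (moment v \<psi>)"
  unfolding continuous_on_def moment_def
proof (intro ballI L2_tendsto_integral cont_v L2_v assms)
  show "\<forall>\<^sub>F s in at t within {1..<T}. L2 (\<lambda>x. v x s)" for t
    using eventually_at_within_Ico by eventually_elim (simp add: L2_v)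
qed auto

lemma moment_grad:
  assumes test_\<psi>: "test_fn \<psi>" and s_bounds: "1 \<le> s" "s < T"
  shows "(LINT x|lborel. (\<Sum>i\<in>UNIV. G x s $ i * pdx \<psi> i x)) = - moment u (laplacian \<psi>) s"
proof -
  have "(LINT x|lborel. (\<Sum>i\<in>UNIV. G x s $ i * pdx \<psi> i x)) =
      (\<Sum>i\<in>UNIV. LINT x|lborel. G x s $ i * pdx \<psi> i x)"
    by (intro Bochner_Integration.integral_sum L2_mult_integrable L2_G s_bounds test_fn_L2
        test_fn_pdx test_\<psi>)
  also have "\<dots> = (\<Sum>i\<in>UNIV. - (LINT x|lborel. u x s * pdx (pdx \<psi> i) i x))"
    using grad_u[OF s_bounds] test_fn_pdx[OF test_\<psi>] by (auto simp: weak_grad_def)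
  also have "\<dots> = - (LINT x|lborel. (\<Sum>i\<in>UNIV. u x s * pdx (pdx \<psi> i) i x))"
    unfolding sum_negf
    by (subst Bochner_Integration.integral_sum)
      (auto intro!: L2_mult_integrable[OF L2_u test_fn_L2] test_fn_pdx test_\<psi> s_bounds)
  finally show ?thesis
    by (simp add: moment_def laplacian_def sum_distrib_left)
qed

definition linear_moment :: "(real^'n \<Rightarrow> real) \<Rightarrow> real \<Rightarrow> real" where
  "linear_moment \<psi> s =
    s powr (2 * m) * moment u (laplacian \<psi>) s - \<nu>\<^sup>2 / s\<^sup>2 * moment u \<psi> s - \<mu> / s * moment v \<psi> s"

definition nonlinear_moment :: "(real^'n \<Rightarrow> real) \<Rightarrow> real \<Rightarrow> real" where
  "nonlinear_moment = moment (\<lambda>x s. \<bar>v x s\<bar> powr p)"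

lemma cont_linear_moment: "test_fn \<psi> \<Longrightarrow> continuous_on {1..<T} (linear_moment \<psi>)"
  unfolding linear_moment_def[abs_def]
  by (intro continuous_intros cont_moment_u cont_moment_v test_fn_L2 test_fn_laplacian) auto

lemma moment_grad_scaled:
  assumes "test_fn \<psi>" "1 \<le> s" "s < T"
  shows "(LINT x|lborel. c * (\<Sum>i\<in>UNIV. G x s $ i * (pdx \<psi> i x * d))) =
      - (c * moment u (laplacian \<psi>) s * d)"
proof -
  have "(\<Sum>i\<in>UNIV. G x s $ i * (pdx \<psi> i x * d)) = (\<Sum>i\<in>UNIV. G x s $ i * pdx \<psi> i x) * d" for x
    by (simp add: sum_distrib_right mult.assoc)
  then show ?thesis
    using moment_grad[OF assms] by simp
qed

lemma set_integral_linear_moment: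
  assumes test_\<psi>: "test_fn \<psi>" and cont_\<eta>: "continuous_on {1..\<tau>} \<eta>" and \<tau>_less: "\<tau> < T"
  shows "(LINT s:{1..\<tau>}|lborel. linear_moment \<psi> s * \<eta> s) =
    (LINT s:{1..\<tau>}|lborel. s powr (2 * m) * moment u (laplacian \<psi>) s * \<eta> s)
    - (LINT s:{1..\<tau>}|lborel. \<nu>\<^sup>2 / s\<^sup>2 * moment u \<psi> s * \<eta> s)
    - (LINT s:{1..\<tau>}|lborel. \<mu> / s * moment v \<psi> s * \<eta> s)"
proof -
  have "continuous_on {1..\<tau>} (moment u \<psi>)" "continuous_on {1..\<tau>} (moment v \<psi>)"
    "continuous_on {1..\<tau>} (moment u (laplacian \<psi>))"
    using \<tau>_less
    by (auto intro!: continuous_on_subset[OF cont_moment_u] continuous_on_subset[OF cont_moment_v]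
        test_fn_L2 test_fn_laplacian test_\<psi>)
  then have "set_integrable lborel {1..\<tau>} (\<lambda>s. s powr (2 * m) * moment u (laplacian \<psi>) s * \<eta> s)"
    "set_integrable lborel {1..\<tau>} (\<lambda>s. \<nu>\<^sup>2 / s\<^sup>2 * moment u \<psi> s * \<eta> s)"
    "set_integrable lborel {1..\<tau>} (\<lambda>s. \<mu> / s * moment v \<psi> s * \<eta> s)"
    by (intro borel_integrable_atLeastAtMost' continuous_intros cont_\<eta>; auto)+
  then show ?thesis
    by (simp add: linear_moment_def left_diff_distrib set_integral_diff)
qed

lemma weak_moment_identity:
  assumes test_\<psi>: "test_fn \<psi>" and \<eta>_props: "smooth_fun \<eta>" "T' < T" "\<And>s. T' \<le> s \<Longrightarrow> \<eta> s = 0"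
    and \<tau>_bounds: "1 \<le> \<tau>" "\<tau> < T"
  shows "moment v \<psi> \<tau> * \<eta> \<tau> - \<epsilon> * (LINT x|lborel. u1 x * \<psi> x) * \<eta> 1 =
    (LINT s:{1..\<tau>}|lborel. moment v \<psi> s * deriv \<eta> s) +
    (LINT s:{1..\<tau>}|lborel. linear_moment \<psi> s * \<eta> s) +
    (LINT s:{1..\<tau>}|lborel. nonlinear_moment \<psi> s * \<eta> s)"
proof -
  have test_\<Phi>: "test_fn_T T (\<lambda>x s. \<psi> x * \<eta> s)"
    using test_\<psi> \<eta>_props by (rule test_fn_T_mult)
  have factor: "(LINT x|lborel. f x * (\<psi> x * d)) = (LINT x|lborel. f x * \<psi> x) * d"
    "(LINT x|lborel. c * f x * (\<psi> x * d)) = c * (LINT x|lborel. f x * \<psi> x) * d" for f c d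
    by (simp_all add: mult.assoc[symmetric]) (simp add: mult.assoc)
  have gradient:
    "(LINT s:{1..\<tau>}|lborel. LINT x|lborel.
        s powr (2 * m) * (\<Sum>i\<in>UNIV. G x s $ i * (pdx \<psi> i x * \<eta> s))) =
      (LINT s:{1..\<tau>}|lborel. - (s powr (2 * m) * moment u (laplacian \<psi>) s * \<eta> s))"
    using moment_grad_scaled[OF test_\<psi>] \<tau>_bounds by (intro set_lebesgue_integral_cong) auto
  show ?thesis
    using weak[OF test_\<Phi> \<tau>_bounds]
    unfolding dt_T_mult[OF test_fn_smooth[OF test_\<psi>] \<eta>_props(1)]
      dx_T_mult[OF test_fn_smooth[OF test_\<psi>] \<eta>_props(1)] factor gradient
      set_integral_linear_moment[OF test_\<psi> smooth_fun_continuous_on[OF \<eta>_props(1)] \<tau>_bounds(2)]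
    by (simp add: moment_def nonlinear_moment_def set_lebesgue_integral_def mult.assoc)
qed

lemma integrable_nonlinear_moment:
  assumes test_\<psi>: "test_fn \<psi>" and t_bounds: "1 < a" "t < T"
  shows "set_integrable lborel {a..t} (nonlinear_moment \<psi>)"
    and "AE s in lborel. s \<in> {a..t} \<longrightarrow> integrable lborel (\<lambda>x. \<bar>v x s\<bar> powr p * \<psi> x)"
proof -
  obtain r where vanishes: "\<And>x. r \<le> norm x \<Longrightarrow> \<psi> x = 0"
    using test_\<psi> by (auto simp: test_fn_def)
  define K where "K = cball (0 :: real^'n) r \<times> {a..t}"
  have compact_K: "compact K"
    unfolding K_def by (intro compact_Times compact_cball compact_Icc)
  have "continuous_on K (\<lambda>z. \<psi> (fst z))"
    by (intro continuous_on_compose2[OF smooth_fun_continuous_on[OF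
            test_fn_smooth[OF test_\<psi>], of UNIV]]
        continuous_intros) auto
  moreover have "set_integrable lborel K (\<lambda>z. \<bar>v (fst z) (snd z)\<bar> powr p)"
    using t_bounds by (intro Lp_v compact_K) (auto simp: K_def)
  ultimately have "set_integrable lborel K (\<lambda>z. \<bar>v (fst z) (snd z)\<bar> powr p * \<psi> (fst z))"
    by (intro set_integrable_mult_continuous compact_K)
  moreover have "(\<lambda>z. indicator K z *\<^sub>R (\<bar>v (fst z) (snd z)\<bar> powr p * \<psi> (fst z))) =
      (\<lambda>(x, s). indicator {a..t} s * (\<bar>v x s\<bar> powr p * \<psi> x))"
    using vanishes by (auto simp: fun_eq_iff K_def indicator_def not_le intro: less_imp_le)
  ultimately have int: "integrable (lborel \<Otimes>\<^sub>M lborel)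
      (\<lambda>(x, s). indicator {a..t} s * (\<bar>v x s\<bar> powr p * \<psi> x))"
    by (simp add: set_integrable_def lborel_prod)
  show "set_integrable lborel {a..t} (nonlinear_moment \<psi>)"
    using lborel_pair.integrable_snd[OF int]
    by (simp add: set_integrable_def nonlinear_moment_def moment_def)
  show "AE s in lborel. s \<in> {a..t} \<longrightarrow> integrable lborel (\<lambda>x. \<bar>v x s\<bar> powr p * \<psi> x)"
    using lborel_pair.AE_integrable_snd[OF int] by eventually_elim auto
qed

lemma weak_increment:
  assumes test_\<psi>: "test_fn \<psi>"
    and \<eta>_props: "smooth_fun \<eta>" "\<And>s. s \<le> a \<Longrightarrow> \<eta> s = 0" "\<And>s. T' \<le> s \<Longrightarrow> \<eta> s = 0"
    and a_gt_1: "1 < a" and T'_less: "T' < T" and t_bounds: "1 < t1" "t1 \<le> t2" "t2 < T"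
  shows "moment v \<psi> t2 * \<eta> t2 - moment v \<psi> t1 * \<eta> t1 =
    integral {t1..t2} (\<lambda>s. moment v \<psi> s * deriv \<eta> s) +
    integral {t1..t2} (\<lambda>s. linear_moment \<psi> s * \<eta> s) +
    integral {t1..t2} (\<lambda>s. nonlinear_moment \<psi> s * \<eta> s)"
proof -
  have "{1..t2} \<subseteq> {1..<T}"
    using t_bounds by auto
  then have "continuous_on {1..t2} (moment v \<psi>)" "continuous_on {1..t2} (linear_moment \<psi>)"
    by (blast intro: continuous_on_subset[OF cont_moment_v[OF test_fn_L2[OF test_\<psi>]]]
        continuous_on_subset[OF cont_linear_moment[OF test_\<psi>]])+
  then have "set_integrable lborel {1..t2} (\<lambda>s. moment v \<psi> s * deriv \<eta> s)"
    "set_integrable lborel {1..t2} (\<lambda>s. linear_moment \<psi> s * \<eta> s)"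
    by (auto intro!: borel_integrable_atLeastAtMost' continuous_on_mult
        smooth_fun_continuous_on[OF \<eta>_props(1)]
        smooth_fun_continuous_on[OF smooth_fun_deriv[OF \<eta>_props(1)]])
  moreover have "set_integrable lborel {1..t2} (\<lambda>s. nonlinear_moment \<psi> s * \<eta> s)"
  proof -
    have "set_integrable lborel {a..t2} (\<lambda>s. nonlinear_moment \<psi> s * \<eta> s)"
      by (intro set_integrable_mult_continuous compact_Icc smooth_fun_continuous_on \<eta>_props(1)
          integrable_nonlinear_moment(1) test_\<psi> a_gt_1 t_bounds(3))
    moreover have "(\<lambda>s. indicator {a..t2} s *\<^sub>R (nonlinear_moment \<psi> s * \<eta> s)) =
        (\<lambda>s. indicator {1..t2} s *\<^sub>R (nonlinear_moment \<psi> s * \<eta> s))"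
      using \<eta>_props(2) a_gt_1 by (auto simp: fun_eq_iff indicator_def)
    ultimately show ?thesis
      by (simp add: set_integrable_def)
  qed
  moreover note weak_moment_identity[OF test_\<psi> \<eta>_props(1) T'_less \<eta>_props(3), of t1]
    weak_moment_identity[OF test_\<psi> \<eta>_props(1) T'_less \<eta>_props(3), of t2]
  ultimately show ?thesis
    using t_bounds by (simp add: set_integral_Icc_diff[symmetric, of 1])
qed

text \<open>The time cutoff vanishes near \<open>t = 1\<close>, where no local integrability of \<open>|v|\<close> to the power
  \<open>p\<close> is available.\<close>

lemma moment_v_increment:
  assumes test_\<psi>: "test_fn \<psi>" and t_bounds: "1 < t1" "t1 \<le> t2" "t2 < T"
  shows "moment v \<psi> t2 - moment v \<psi> t1 =
    integral {t1..t2} (linear_moment \<psi>) + integral {t1..t2} (nonlinear_moment \<psi>)"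
proof -
  obtain a b where ab_order: "1 < a" "a < b" "b < t1"
    using dense[OF t_bounds(1)] dense[of _ t1] by metis
  obtain c T' where c_order: "t2 < c" "c < T'" "T' < T"
    using dense[OF t_bounds(3)] dense[of _ T] by metis
  obtain \<eta> :: "real \<Rightarrow> real" where \<eta>_bump: "smooth_fun \<eta>" "\<And>s. s \<le> a \<Longrightarrow> \<eta> s = 0"
    "\<And>s. b \<le> s \<Longrightarrow> s \<le> c \<Longrightarrow> \<eta> s = 1" "\<And>s. T' \<le> s \<Longrightarrow> \<eta> s = 0"
    by (rule smooth_bump_exists[OF ab_order(2) c_order(2)]) blast
  have one: "\<eta> s = 1" if "s \<in> {t1..t2}" for s
    using that \<eta>_bump(3) ab_order c_order by auto
  have deriv_zero: "deriv \<eta> s = 0" if "s \<in> {t1..t2}" for s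
  proof (rule DERIV_imp_deriv)
    show "(\<eta> has_real_derivative 0) (at s)"
      by (rule has_field_derivative_transform_within_open[of "\<lambda>_. 1" 0 s "{b<..<c}"])
        (use that ab_order c_order \<eta>_bump(3) in auto)
  qed
  have "integral {t1..t2} (\<lambda>s. moment v \<psi> s * deriv \<eta> s) = integral {t1..t2} (\<lambda>_. 0)"
    by (rule Henstock_Kurzweil_Integration.integral_cong) (simp add: deriv_zero)
  moreover have "integral {t1..t2} (\<lambda>s. linear_moment \<psi> s * \<eta> s) =
      integral {t1..t2} (linear_moment \<psi>)"
    "integral {t1..t2} (\<lambda>s. nonlinear_moment \<psi> s * \<eta> s) = integral {t1..t2} (nonlinear_moment \<psi>)"
    by (auto intro!: Henstock_Kurzweil_Integration.integral_cong simp: one)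
  ultimately show ?thesis
    using weak_increment[OF test_\<psi> \<eta>_bump(1,2,4) ab_order(1) c_order(3) t_bounds]
      one[of t1] one[of t2] t_bounds by simp
qed

lemma moment_v_1:
  assumes test_\<psi>: "test_fn \<psi>"
  shows "moment v \<psi> 1 = \<epsilon> * (LINT x|lborel. u1 x * \<psi> x)"
proof -
  obtain T' where T'_bounds: "1 < T'" "T' < T"
    using dense[OF T_gt_1] by blast
  obtain \<eta> :: "real \<Rightarrow> real" where \<eta>_cutoff: "smooth_fun \<eta>" "\<And>s. s \<le> 1 \<Longrightarrow> \<eta> s = 1"
    "\<And>s. T' \<le> s \<Longrightarrow> \<eta> s = 0"
    by (rule smooth_cutoff_exists[OF T'_bounds(1)]) blast
  have "(LINT s:{1..1}|lborel. f s) = 0" for f :: "real \<Rightarrow> real"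
    unfolding set_lebesgue_integral_def
    by (intro integral_eq_zero_AE eventually_mono[OF AE_lborel_singleton[of 1]]) simp
  then show ?thesis
    using weak_moment_identity[OF test_\<psi> \<eta>_cutoff(1) T'_bounds(2) \<eta>_cutoff(3) order_refl T_gt_1]
      \<eta>_cutoff(2)[of 1] by simp
qed

end

locale cone_weak_solution = weak_solution m \<mu> \<nu> p \<epsilon> T u0 u1 u v G
  for m \<mu> \<nu> p \<epsilon> T :: real and u0 u1 :: "real^'n \<Rightarrow> real"
    and u v :: "real^'n \<Rightarrow> real \<Rightarrow> real" and G :: "real^'n \<Rightarrow> real \<Rightarrow> real^'n" +
  fixes R :: real
  assumes m_nonneg: "m \<ge> 0" and p_gt_1: "p > 1" and R_pos: "R > 0"
    and L2_u0: "L2 u0" and L2_u1: "L2 u1"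
    and supp_u1: "AE x in lborel. R < norm x \<longrightarrow> u1 x = 0"
    and supp_u: "\<And>t. 1 \<le> t \<Longrightarrow> t < T \<Longrightarrow>
      AE x in lborel. R + phi_m m t - phi_m m 1 < norm x \<longrightarrow> u x t = 0"
begin

definition cone_radius :: "real \<Rightarrow> real" where "cone_radius t = R + phi_m m t"

lemma cone_radius_gt: "1 \<le> t \<Longrightarrow> cone_radius t > R"
  using phi_m_pos[OF m_nonneg, of t] by (simp add: cone_radius_def)

lemma cone_radius_mono: "1 \<le> s \<Longrightarrow> s \<le> t \<Longrightarrow> cone_radius s \<le> cone_radius t"
  using phi_m_mono[OF m_nonneg] by (simp add: cone_radius_def)

lemma supp_u_cone:
  assumes "1 \<le> s" "s \<le> t" "s < T"
  shows "AE x in lborel. cone_radius t < norm x \<longrightarrow> u x s = 0"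
  using supp_u[OF assms(1,3)]
proof eventually_elim
  case (elim x)
  have "R + phi_m m s - phi_m m 1 \<le> cone_radius t"
    using cone_radius_mono[OF assms(1,2)] phi_m_pos[OF m_nonneg, of 1]
    by (simp add: cone_radius_def)
  with elim show ?case by auto
qed

lemma supp_v_cone_same_time:
  assumes t_bounds: "1 \<le> t" "t < T"
  shows "AE x in lborel. cone_radius t < norm x \<longrightarrow> v x t = 0"
proof (rule L2_limit_vanishes[OF deriv_u[OF t_bounds] _ _ L2_v[OF t_bounds]])
  show "at t within {1..<T} \<noteq> bot"
    using at_right_le_at_within[OF t_bounds] trivial_limit_at_right_real[of t]
    by (metis bot.extremum_uniqueI)
  show "{x :: real^'n. cone_radius t < norm x} \<in> sets borel"
    by measurable
  have "(phi_m m \<longlongrightarrow> phi_m m t) (at t within {1..<T})"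
    using DERIV_continuous[OF DERIV_phi_m[OF m_nonneg, of t "{1..<T}"]] t_bounds
    by (simp add: continuous_within)
  then have "\<forall>\<^sub>F s in at t within {1..<T}. phi_m m s < phi_m m t + phi_m m 1"
    by (rule order_tendstoD(2)) (use phi_m_pos[OF m_nonneg, of 1] in simp)
  then show "\<forall>\<^sub>F s in at t within {1..<T}. L2 (\<lambda>x. (u x s - u x t) / (s - t)) \<and>
      (AE x in lborel. cone_radius t < norm x \<longrightarrow> (u x s - u x t) / (s - t) = 0)"
    using eventually_at_within_Ico
  proof eventually_elim
    case (elim s)
    then have "AE x in lborel. cone_radius t < norm x \<longrightarrow> (u x s - u x t) / (s - t) = 0"
      using supp_u[of s] supp_u_cone[OF t_bounds(1) order_refl t_bounds(2)]
      by (auto simp: cone_radius_def elim!: eventually_elim2)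
    with elim t_bounds show ?case by (auto intro!: L2_difference_quotient)
  qed
qed

lemma supp_v_cone:
  assumes "1 \<le> s" "s \<le> t" "s < T"
  shows "AE x in lborel. cone_radius t < norm x \<longrightarrow> v x s = 0"
  using supp_v_cone_same_time[OF assms(1,3)] cone_radius_mono[OF assms(1,2)]
  by (auto elim!: eventually_mono)

lemma
  assumes "1 \<le> s" "s \<le> t" "s < T" and eq: "\<And>x. norm x \<le> cone_radius t \<Longrightarrow> \<psi> x = \<psi>' x"
    and meas: "\<psi> \<in> borel_measurable borel" "\<psi>' \<in> borel_measurable borel"
  shows moment_u_cong_cone: "moment u \<psi> s = moment u \<psi>' s"
    and moment_v_cong_cone: "moment v \<psi> s = moment v \<psi>' s"
  unfolding moment_def using assms L2_u[of s] L2_v[of s]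
  by (auto intro!: integral_mult_cong_supp supp_u_cone supp_v_cone eq meas simp: L2_def)

lemma
  assumes cutoff: "eig_cutoff (cone_radius t) \<psi>" and s_bounds: "1 \<le> s" "s \<le> t" "s < T"
  shows moment_u_eig_cutoff: "moment u \<psi> s = moment u eig s"
    and moment_v_eig_cutoff: "moment v \<psi> s = moment v eig s"
    and moment_u_laplacian_eig_cutoff: "moment u (laplacian \<psi>) s = moment u eig s"
  using cutoff test_fn_laplacian[of \<psi>]
  by (auto simp: eig_cutoff_def intro!: moment_u_cong_cone[OF s_bounds]
      moment_v_cong_cone[OF s_bounds]
      test_fn_borel_measurable borel_measurable_eig)

lemma cone_cutoff_exists: "1 \<le> t \<Longrightarrow> \<exists>\<psi> :: real^'n \<Rightarrow> real. eig_cutoff (cone_radius t) \<psi>"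
  using cone_radius_gt[of t] R_pos by (intro eig_cutoff_exists) simp

lemma DERIV_moment_u_eig:
  assumes t_bounds: "1 \<le> t" "t < T"
  shows "(moment u eig has_real_derivative moment v eig t) (at t within {1..<T})"
proof -
  obtain t' where t'_bounds: "t < t'" "t' < T"
    using dense[OF t_bounds(2)] by blast
  obtain \<psi> :: "real^'n \<Rightarrow> real" where cutoff: "eig_cutoff (cone_radius t') \<psi>"
    using cone_cutoff_exists[of t'] t_bounds t'_bounds by auto
  then have "(moment u \<psi> has_real_derivative moment v \<psi> t) (at t within {1..<T})"
    using t_bounds by (intro DERIV_moment_u test_fn_L2) (simp add: eig_cutoff_def)
  then have "(moment u eig has_real_derivative moment v \<psi> t) (at t within {1..<T})"
    by (rule has_field_derivative_transform_within[of _ _ _ _ "t' - t"])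
      (use t_bounds t'_bounds in \<open>auto simp: dist_real_def intro!: moment_u_eig_cutoff[OF cutoff]\<close>)
  then show ?thesis
    using moment_v_eig_cutoff[OF cutoff, of t] t_bounds t'_bounds by simp
qed

lemma cont_moment_u_eig: "continuous_on {1..<T} (moment u eig)"
  by (rule DERIV_continuous_on) (use DERIV_moment_u_eig in auto)

lemma cont_moment_v_eig: "continuous_on {1..<T} (moment v eig)"
  unfolding continuous_on_eq_continuous_within
proof
  fix t assume "t \<in> {1..<T}"
  then have t_bounds: "1 \<le> t" "t < T" by auto
  obtain t' where t'_bounds: "t < t'" "t' < T"
    using dense[OF t_bounds(2)] by blast
  obtain \<psi> :: "real^'n \<Rightarrow> real" where cutoff: "eig_cutoff (cone_radius t') \<psi>"
    using cone_cutoff_exists[of t'] t_bounds t'_bounds by auto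
  then have "continuous (at t within {1..<T}) (moment v \<psi>)"
    using cont_moment_v[of \<psi>] t_bounds
    by (auto simp: eig_cutoff_def test_fn_L2 continuous_on_eq_continuous_within)
  then show "continuous (at t within {1..<T}) (moment v eig)"
    by (rule continuous_transform_within[of _ _ _ "t' - t"])
      (use t_bounds t'_bounds in \<open>auto simp: dist_real_def intro!: moment_v_eig_cutoff[OF cutoff]\<close>)
qed

lemma moment_u_eig_1: "moment u eig 1 = \<epsilon> * (LINT x|lborel. u0 x * eig x)"
proof -
  have "moment u eig 1 = (LINT x|lborel. \<epsilon> * (u0 x * eig x))"
    unfolding moment_def
  proof (rule integral_cong_AE)
    show "AE x in lborel. u x 1 * eig x = \<epsilon> * (u0 x * eig x)"
      using init by eventually_elim simp
  qed (use L2_u[of 1] L2_u0 T_gt_1 in \<open>auto simp: L2_def\<close>)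
  then show ?thesis by simp
qed

lemma moment_v_eig_1: "moment v eig 1 = \<epsilon> * (LINT x|lborel. u1 x * eig x)"
proof -
  obtain \<psi> :: "real^'n \<Rightarrow> real" where cutoff: "eig_cutoff (cone_radius 1) \<psi>"
    using cone_cutoff_exists[of 1] by auto
  then have test: "test_fn \<psi>"
    by (simp add: eig_cutoff_def)
  have "(LINT x|lborel. u1 x * \<psi> x) = (LINT x|lborel. u1 x * eig x)"
  proof (rule integral_mult_cong_supp)
    show "AE x in lborel. cone_radius 1 < norm x \<longrightarrow> u1 x = 0"
      using supp_u1 cone_radius_gt[of 1] by (auto elim!: eventually_mono)
  qed (use cutoff L2_u1 test_fn_borel_measurable[OF test] in \<open>auto simp: eig_cutoff_def L2_def\<close>)
  then show ?thesis
    using moment_v_1[OF test] moment_v_eig_cutoff[OF cutoff, of 1] T_gt_1 by simp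
qed

lemma nonlinear_moment_ge:
  assumes cutoff: "eig_cutoff (cone_radius t) \<psi>" and s_bounds: "1 \<le> s" "s \<le> t" "s < T"
    and int: "integrable lborel (\<lambda>x. \<bar>v x s\<bar> powr p * \<psi> x)"
  shows "\<bar>moment v eig s\<bar> powr p * eig_mass TYPE(real^'n) (cone_radius s) powr (1 - p)
    \<le> nonlinear_moment \<psi> s"
proof -
  define w :: "real^'n \<Rightarrow> real" where "w = ball_eig (cone_radius s)"
  have test: "test_fn \<psi>"
    using cutoff by (simp add: eig_cutoff_def)
  have \<psi>_eq_w: "\<psi> x = w x" if "norm x \<le> cone_radius s" for x
    using cutoff that cone_radius_mono[OF s_bounds(1,2)]
    by (simp add: eig_cutoff_def w_def ball_eig_inside)
  have [measurable]: "\<psi> \<in> borel_measurable borel" "(\<lambda>x. v x s) \<in> borel_measurable borel"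
      "w \<in> borel_measurable borel"
    using test_fn_borel_measurable[OF test] L2_v[OF s_bounds(1,3)] by (auto simp: L2_def w_def)
  have mult_eq: "AE x in lborel. h (v x s) * \<psi> x = h (v x s) * w x"
    if "h 0 = 0" for h :: "real \<Rightarrow> real"
    using supp_v_cone_same_time[OF s_bounds(1,3)]
    by eventually_elim (use \<psi>_eq_w that in \<open>auto simp: not_less[symmetric]\<close>)
  have int_powr: "integrable lborel (\<lambda>x. \<bar>v x s\<bar> powr p * w x)"
    using int integrable_cong_AE[OF _ _ mult_eq[of "\<lambda>y. \<bar>y\<bar> powr p"]] by simp
  have "integrable lborel (\<lambda>x. v x s * \<psi> x)"
    using s_bounds by (intro L2_mult_integrable L2_v test_fn_L2 test)
  then have int_v: "integrable lborel (\<lambda>x. v x s * w x)"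
    using integrable_cong_AE[OF _ _ mult_eq[of "\<lambda>y. y"]] by simp
  have "(LINT x|lborel. w x) > 0"
    using eig_mass_pos[of "cone_radius s", where 'a = "real^'n"] cone_radius_gt[OF s_bounds(1)]
      R_pos
    by (simp add: w_def eig_mass_def)
  then have "\<bar>LINT x|lborel. v x s * w x\<bar> powr p * (LINT x|lborel. w x) powr (1 - p)
      \<le> (LINT x|lborel. \<bar>v x s\<bar> powr p * w x)"
    by (intro weighted_power_mean p_gt_1 int_powr int_v)
      (simp_all add: w_def integrable_ball_eig ball_eig_nonneg)
  also have "(LINT x|lborel. v x s * w x) = moment v \<psi> s"
    unfolding moment_def using mult_eq[of "\<lambda>y. y"] by (intro integral_cong_AE) auto
  also have "\<dots> = moment v eig s"
    by (rule moment_v_eig_cutoff[OF cutoff s_bounds])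
  also have "(LINT x|lborel. \<bar>v x s\<bar> powr p * w x) = nonlinear_moment \<psi> s"
    unfolding nonlinear_moment_def moment_def using mult_eq[of "\<lambda>y. \<bar>y\<bar> powr p"]
    by (intro integral_cong_AE) auto
  finally show ?thesis
    by (simp only: w_def eig_mass_def)
qed

definition power_bound :: "real \<Rightarrow> real \<Rightarrow> real \<Rightarrow> real" where
  "power_bound C d s =
    C powr (1 - p) * \<bar>moment v eig s\<bar> powr p * (exp (phi_m m s) * s powr d) powr (1 - p)"

lemma cont_power_bound: "continuous_on {1..<T} (power_bound C d)"
proof -
  have "continuous_on {1..<T} (\<lambda>s. \<bar>moment v eig s\<bar> powr p)"
    using p_gt_1
    by (intro continuous_on_powr' continuous_on_rabs cont_moment_v_eig continuous_on_const) auto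
  moreover have "continuous_on {1..<T} (\<lambda>s. (exp (phi_m m s) * s powr d) powr (1 - p))"
    using m_nonneg by (intro continuous_intros continuous_on_phi_m) auto
  ultimately show ?thesis
    unfolding power_bound_def[abs_def] by (intro continuous_on_mult continuous_on_const)
qed

lemma power_bound_le:
  assumes C_pos: "C > 0"
    and mass_le: "eig_mass TYPE(real^'n) (cone_radius s) \<le> C * (exp (phi_m m s) * s powr d)"
    and s_ge_1: "1 \<le> s"
  shows "power_bound C d s
      \<le> \<bar>moment v eig s\<bar> powr p * eig_mass TYPE(real^'n) (cone_radius s) powr (1 - p)"
proof -
  have "eig_mass TYPE(real^'n) (cone_radius s) > 0"
    using cone_radius_gt[OF s_ge_1] R_pos by (intro eig_mass_pos) simp
  then have "(C * (exp (phi_m m s) * s powr d)) powr (1 - p)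
      \<le> eig_mass TYPE(real^'n) (cone_radius s) powr (1 - p)"
    using mass_le C_pos p_gt_1 by (intro powr_mono2') auto
  then have "\<bar>moment v eig s\<bar> powr p * (C * (exp (phi_m m s) * s powr d)) powr (1 - p)
      \<le> \<bar>moment v eig s\<bar> powr p * eig_mass TYPE(real^'n) (cone_radius s) powr (1 - p)"
    by (rule mult_left_mono) simp
  moreover have "power_bound C d s =
      \<bar>moment v eig s\<bar> powr p * (C * (exp (phi_m m s) * s powr d)) powr (1 - p)"
    by (simp add: power_bound_def powr_mult)
  ultimately show ?thesis
    by simp
qed

lemma integral_power_bound_le:
  assumes C_pos: "C > 0"
    and mass_le: "\<And>s. 1 \<le> s \<Longrightarrow>
      eig_mass TYPE(real^'n) (cone_radius s) \<le> C * (exp (phi_m m s) * s powr d)"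
    and cutoff: "eig_cutoff (cone_radius t2) \<psi>" and t_bounds: "1 < t1" "t1 \<le> t2" "t2 < T"
  shows "integral {t1..t2} (power_bound C d) \<le> integral {t1..t2} (nonlinear_moment \<psi>)"
proof -
  have test: "test_fn \<psi>"
    using cutoff by (simp add: eig_cutoff_def)
  have "set_integrable lborel {t1..t2} (power_bound C d)"
    using t_bounds
    by (auto intro!: borel_integrable_atLeastAtMost' continuous_on_subset[OF cont_power_bound])
  note int = this integrable_nonlinear_moment(1)[OF test t_bounds(1,3)]
  have "AE s \<in> {t1..t2} in lborel. power_bound C d s \<le> nonlinear_moment \<psi> s"
    using integrable_nonlinear_moment(2)[OF test t_bounds(1,3)]
  proof eventually_elim
    case (elim s)
    show ?case
    proof
      assume s_mem: "s \<in> {t1..t2}"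
      then have "1 \<le> s" "s \<le> t2" "s < T"
        using t_bounds by auto
      then have "\<bar>moment v eig s\<bar> powr p * eig_mass TYPE(real^'n) (cone_radius s) powr (1 - p)
          \<le> nonlinear_moment \<psi> s"
        using elim s_mem by (intro nonlinear_moment_ge[OF cutoff]) auto
      moreover have "power_bound C d s
          \<le> \<bar>moment v eig s\<bar> powr p * eig_mass TYPE(real^'n) (cone_radius s) powr (1 - p)"
        using \<open>1 \<le> s\<close> by (intro power_bound_le C_pos mass_le)
      ultimately show "power_bound C d s \<le> nonlinear_moment \<psi> s"
        by linarith
    qed
  qed
  then have "(LINT s:{t1..t2}|lborel. power_bound C d s)
      \<le> (LINT s:{t1..t2}|lborel. nonlinear_moment \<psi> s)"
    by (rule set_integral_mono_AE[OF int])
  then show ?thesis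
    by (simp add: set_borel_integral_eq_integral(2) int)
qed

lemma dini_moment_v_eig:
  assumes C_pos: "C > 0"
    and mass_le: "\<And>s. 1 \<le> s \<Longrightarrow>
      eig_mass TYPE(real^'n) (cone_radius s) \<le> C * (exp (phi_m m s) * s powr d)"
    and t_bounds: "1 < t" "t < T"
  shows "right_dini_ge (moment v eig) t
    ((t powr (2 * m) - \<nu>\<^sup>2 / t\<^sup>2) * moment u eig t - \<mu> / t * moment v eig t + power_bound C d t)"
proof (rule increments_imp_right_dini_ge[OF _ _ t_bounds])
  define L where "L s = (s powr (2 * m) - \<nu>\<^sup>2 / s\<^sup>2) * moment u eig s - \<mu> / s * moment v eig s" for s
  have cont_L: "continuous_on {1..<T} L"
    unfolding L_def by (intro continuous_intros cont_moment_u_eig cont_moment_v_eig) auto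
  then show "continuous_on {1<..<T} (\<lambda>s. L s + power_bound C d s)"
    by (intro continuous_on_add continuous_on_subset[OF cont_L]
        continuous_on_subset[OF cont_power_bound]) auto
  fix t1 t2 assume t_order: "1 < t1" "t1 < t2" "t2 < T"
  obtain \<psi> :: "real^'n \<Rightarrow> real" where cutoff: "eig_cutoff (cone_radius t2) \<psi>"
    using cone_cutoff_exists[of t2] t_order by auto
  have "L integrable_on {t1..t2}" "power_bound C d integrable_on {t1..t2}"
    using t_order by (auto intro!: integrable_continuous_real continuous_on_subset[OF cont_L]
        continuous_on_subset[OF cont_power_bound])
  then have "integral {t1..t2} (\<lambda>s. L s + power_bound C d s) =
      integral {t1..t2} L + integral {t1..t2} (power_bound C d)"
    by (rule Henstock_Kurzweil_Integration.integral_add)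
  also have "\<dots> \<le> integral {t1..t2} L + integral {t1..t2} (nonlinear_moment \<psi>)"
    using t_order by (intro add_left_mono integral_power_bound_le C_pos mass_le cutoff) auto
  also have "integral {t1..t2} L = integral {t1..t2} (linear_moment \<psi>)"
    using t_order moment_u_eig_cutoff[OF cutoff] moment_v_eig_cutoff[OF cutoff]
      moment_u_laplacian_eig_cutoff[OF cutoff]
    by (intro Henstock_Kurzweil_Integration.integral_cong)
      (simp add: L_def linear_moment_def left_diff_distrib)
  also have "integral {t1..t2} (linear_moment \<psi>) + integral {t1..t2} (nonlinear_moment \<psi>) =
      moment v \<psi> t2 - moment v \<psi> t1"
    using cutoff t_order by (subst moment_v_increment) (auto simp: eig_cutoff_def)
  also have "\<dots> = moment v eig t2 - moment v eig t1"
    using t_order moment_v_eig_cutoff[OF cutoff] by simp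
  finally show "integral {t1..t2} (\<lambda>s. L s + power_bound C d s)
      \<le> moment v eig t2 - moment v eig t1" .
qed

end

section \<open>Lifespan estimates\<close>

lemma eig_mass_cone_le:
  assumes m_nonneg: "m \<ge> 0" and R_pos: "R > 0"
  obtains C where "C > 0" "\<And>t. t \<ge> 1 \<Longrightarrow> eig_mass TYPE('a::euclidean_space) (R + phi_m m t) \<le>
    C * (exp (phi_m m t) * t powr ((1 + m) * (real DIM('a) - 1) / 2))"
proof -
  define k where "k = DIM('a) - 1"
  define C where "C = 2 * eig_mass_const TYPE('a)"
  have C_pos: "C > 0"
    using eig_mass_const_pos[where 'a = 'a] by (simp add: C_def)
  show ?thesis
  proof (rule that[of "C * (sqrt ((R + 2) ^ k) * exp (R + 1))"])
    show "C * (sqrt ((R + 2) ^ k) * exp (R + 1)) > 0"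
      using C_pos R_pos by simp
    fix t :: real assume t_ge_1: "t \<ge> 1"
    define r where "r = R + phi_m m t"
    have r_pos: "r > 0"
      using R_pos m_nonneg t_ge_1 phi_m_pos[of m t] by (simp add: r_def)
    have "phi_m m t \<le> t powr (1 + m)"
      using m_nonneg by (simp add: phi_m_def divide_le_eq mult_le_cancel_left1)
    moreover have "(R + 1) * 1 \<le> (R + 1) * t powr (1 + m)"
      using R_pos t_ge_1 m_nonneg by (intro mult_left_mono ge_one_powr_ge_zero) auto
    ultimately have "r + 1 \<le> (R + 2) * t powr (1 + m)"
      by (simp add: r_def algebra_simps)
    then have "sqrt ((r + 1) ^ k) \<le> sqrt (((R + 2) * t powr (1 + m)) ^ k)"
      using r_pos by (intro real_sqrt_le_mono power_mono) auto
    also have "\<dots> = sqrt ((R + 2) ^ k) * t powr ((1 + m) * real k / 2)"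
      using t_ge_1
      by (simp add: power_mult_distrib real_sqrt_mult powr_power powr_half_sqrt[symmetric] powr_powr
          mult.commute)
    finally have "C * (sqrt ((r + 1) ^ k) * exp (r + 1)) \<le>
        C * (sqrt ((R + 2) ^ k) * t powr ((1 + m) * real k / 2) * exp (r + 1))"
      using C_pos by (intro mult_left_mono mult_right_mono) auto
    also have "\<dots> =
        C * (sqrt ((R + 2) ^ k) * exp (R + 1)) * (exp (phi_m m t) * t powr ((1 + m) * real k / 2))"
      by (simp add: r_def exp_add mult_ac)
    finally show "eig_mass TYPE('a) (R + phi_m m t) \<le>
        C * (sqrt ((R + 2) ^ k) * exp (R + 1)) *
          (exp (phi_m m t) * t powr ((1 + m) * (real DIM('a) - 1) / 2))"
      using eig_mass_le[of r, where 'a = 'a] r_pos by (simp add: r_def k_def C_def of_nat_diff)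
  qed
qed

lemma L2_ball_eig: "L2 (ball_eig r)"
proof -
  have "integrable lborel (\<lambda>x :: real^'n. indicator (cball 0 r) x *\<^sub>R (eig x)\<^sup>2)"
    by (intro borel_integrable_compact compact_cball continuous_intros continuous_on_eig)
  also have "(\<lambda>x :: real^'n. indicator (cball 0 r) x *\<^sub>R (eig x)\<^sup>2) = (\<lambda>x. (ball_eig r x)\<^sup>2)"
    by (auto simp: ball_eig_def indicator_def)
  finally show ?thesis
    by (simp add: L2_def)
qed

lemma integrable_mult_eig:
  fixes f :: "real^'n \<Rightarrow> real"
  assumes L2_f: "L2 f" and supp: "AE x in lborel. r < norm x \<longrightarrow> f x = 0"
  shows "integrable lborel (\<lambda>x. f x * eig x)"
proof -
  have [measurable]: "f \<in> borel_measurable borel"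
    using L2_f by (simp add: L2_def)
  have "AE x in lborel. f x * ball_eig r x = f x * eig x"
    using supp by eventually_elim (auto simp: ball_eig_def indicator_def)
  then show ?thesis
    using L2_mult_integrable[OF L2_f L2_ball_eig[of r]]
      integrable_cong_AE[of "\<lambda>x. f x * ball_eig r x" lborel "\<lambda>x. f x * eig x"] by simp
qed

lemma integral_mult_eig_pos:
  fixes f :: "real^'n \<Rightarrow> real"
  assumes R_pos: "R > 0" and int: "integrable lborel (\<lambda>x. f x * eig x)"
    and supp: "AE x in lborel. R < norm x \<longrightarrow> f x = 0" and pos: "AE x in lborel. norm x < R \<longrightarrow> f x > 0"
  shows "(LINT x|lborel. f x * eig x) > 0"
proof (rule integral_pos_if_pos_on_ball[OF int _ _ R_pos])
  show "AE x in lborel. x \<in> ball 0 R \<longrightarrow> 0 < f x * eig x"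
    using pos by eventually_elim (simp add: eig_pos)
  have "AE x in lborel. (x :: real^'n) \<notin> sphere 0 R"
    by (intro AE_not_in
        negligible_iff_null_sets[THEN iffD1, THEN null_sets_completion_iff[THEN iffD1, rotated]]
        negligible_sphere) simp
  then show "AE x in lborel. 0 \<le> f x * eig x"
    using supp pos
  proof eventually_elim
    case (elim x)
    then have "0 \<le> f x"
      by (cases "norm x < R") auto
    then show ?case
      by (simp add: less_imp_le[OF eig_pos])
  qed
qed

lemma integral_powr_Icc:
  fixes a b e :: real
  assumes "0 < a" "a \<le> b" "e \<noteq> - 1"
  shows "integral {a..b} (\<lambda>s. s powr e) = (b powr (e + 1) - a powr (e + 1)) / (e + 1)"
proof -
  have "((\<lambda>s. s powr (e + 1) / (e + 1)) has_real_derivative s powr e) (at s within {a..b})"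
    if "s \<in> {a..b}" for s
    using assms that by (auto intro!: derivative_eq_intros)
  then have "((\<lambda>s. s powr e) has_integral
      b powr (e + 1) / (e + 1) - a powr (e + 1) / (e + 1)) {a..b}"
    by (intro fundamental_theorem_of_calculus assms(2))
      (simp add: has_real_derivative_iff_has_vector_derivative)
  then show ?thesis
    by (simp add: integral_unique diff_divide_distrib)
qed

lemma integral_inverse_Icc:
  fixes a b :: real
  assumes "0 < a" "a \<le> b"
  shows "integral {a..b} (\<lambda>s. s powr (- 1)) = ln b - ln a"
proof -
  have "(ln has_real_derivative s powr (- 1)) (at s within {a..b})" if "s \<in> {a..b}" for s
    using assms that by (auto intro!: derivative_eq_intros simp: powr_minus divide_inverse)
  then have "((\<lambda>s. s powr (- 1)) has_integral ln b - ln a) {a..b}"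
    by (intro fundamental_theorem_of_calculus assms(2))
      (simp add: has_real_derivative_iff_has_vector_derivative)
  then show ?thesis
    by (rule integral_unique)
qed

lemma le_powr_if_integral_powr_le:
  fixes b B T t1 :: real
  assumes t1_pos: "t1 > 0" and b_pos: "b > 0" and B_nonneg: "B \<ge> 0"
    and bound: "\<And>t. t1 \<le> t \<Longrightarrow> t < T \<Longrightarrow> integral {t1..t} (\<lambda>s. s powr (b - 1)) \<le> B"
  shows "T \<le> (t1 powr b + b * B) powr (1 / b)"
proof (rule dense_le)
  fix t assume "t < T"
  have "(max t1 t) powr b \<le> t1 powr b + b * B"
  proof (cases "t1 \<le> t")
    case True
    have "(t powr b - t1 powr b) / b \<le> B"
      using bound[OF True \<open>t < T\<close>] integral_powr_Icc[of t1 t "b - 1"] True t1_pos b_pos by simp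
    with True b_pos show ?thesis
      by (simp add: field_simps)
  qed (use b_pos B_nonneg in simp)
  then have "((max t1 t) powr b) powr (1 / b) \<le> (t1 powr b + b * B) powr (1 / b)"
    using b_pos by (intro powr_mono2) auto
  then show "t \<le> (t1 powr b + b * B) powr (1 / b)"
    using t1_pos b_pos by (simp add: powr_powr)
qed

lemma le_exp_if_integral_inverse_le:
  fixes B T t1 :: real
  assumes t1_pos: "t1 > 0" and B_nonneg: "B \<ge> 0"
    and bound: "\<And>t. t1 \<le> t \<Longrightarrow> t < T \<Longrightarrow> integral {t1..t} (\<lambda>s. s powr (- 1)) \<le> B"
  shows "T \<le> exp (ln t1 + B)"
proof (rule dense_le)
  fix t assume "t < T"
  have "ln (max t1 t) \<le> ln t1 + B"
  proof (cases "t1 \<le> t")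
    case True
    then show ?thesis
      using bound[OF True \<open>t < T\<close>] integral_inverse_Icc[of t1 t] t1_pos by simp
  qed (use B_nonneg in simp)
  then have "exp (ln (max t1 t)) \<le> exp (ln t1 + B)"
    by simp
  then show "t \<le> exp (ln t1 + B)"
    using t1_pos by simp
qed

lemma affine_le_mult_powr:
  fixes a b q \<epsilon> :: real
  assumes "a \<ge> 0" "q \<le> 0" "0 < \<epsilon>" "\<epsilon> \<le> 1"
  shows "a + b * \<epsilon> powr q \<le> (a + b) * \<epsilon> powr q"
proof -
  have "a * 1 \<le> a * \<epsilon> powr q"
    using assms powr_mono2'[of q \<epsilon> 1] by (intro mult_left_mono) auto
  then show ?thesis
    by (simp add: distrib_right)
qed

lemma lifespan_subcritical:
  fixes t1 K p \<kappa> :: real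
  assumes t1_pos: "t1 > 0" and K_pos: "K > 0" and p_gt_1: "p > 1"
    and subcritical: "\<kappa> * (p - 1) < 2"
  obtains C where "C > 0"
    "\<And>\<epsilon> T. 0 < \<epsilon> \<Longrightarrow> \<epsilon> \<le> 1 \<Longrightarrow>
      (\<And>t. t1 \<le> t \<Longrightarrow> t < T \<Longrightarrow>
        integral {t1..t} (\<lambda>s. s powr ((1 - p) * (\<kappa> / 2))) \<le> K * \<epsilon> powr (1 - p)) \<Longrightarrow>
      T \<le> C * \<epsilon> powr (- (2 * (p - 1) / (2 - \<kappa> * (p - 1))))"
proof -
  define b where "b = (1 - p) * (\<kappa> / 2) + 1"
  have two_b: "2 - \<kappa> * (p - 1) = 2 * b"
    by (simp add: b_def field_simps)
  then have b_pos: "b > 0"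
    using subcritical by simp
  define A where "A = t1 powr b + b * K"
  have A_pos: "A > 0"
    using K_pos b_pos t1_pos by (simp add: A_def add_pos_pos)
  have exponent: "- (2 * (p - 1) / (2 - \<kappa> * (p - 1))) = (1 - p) * (1 / b)"
    unfolding two_b using b_pos by (simp add: field_simps)
  show ?thesis
  proof (rule that[of "A powr (1 / b)"])
    show "A powr (1 / b) > 0"
      using A_pos by simp
    fix \<epsilon> T :: real
    assume \<epsilon>_bounds: "0 < \<epsilon>" "\<epsilon> \<le> 1"
      and bound: "\<And>t. t1 \<le> t \<Longrightarrow> t < T \<Longrightarrow>
        integral {t1..t} (\<lambda>s. s powr ((1 - p) * (\<kappa> / 2))) \<le> K * \<epsilon> powr (1 - p)"
    have "T \<le> (t1 powr b + b * (K * \<epsilon> powr (1 - p))) powr (1 / b)"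
      using K_pos bound by (intro le_powr_if_integral_powr_le t1_pos b_pos) (simp_all add: b_def)
    also have "\<dots> \<le> (A * \<epsilon> powr (1 - p)) powr (1 / b)"
      using affine_le_mult_powr[of "t1 powr b" "1 - p" \<epsilon> "b * K"] K_pos b_pos p_gt_1 \<epsilon>_bounds
      by (intro powr_mono2) (auto simp: A_def mult.assoc)
    also have "\<dots> = A powr (1 / b) * \<epsilon> powr ((1 - p) * (1 / b))"
      by (simp add: powr_mult powr_powr)
    finally show "T \<le> A powr (1 / b) * \<epsilon> powr (- (2 * (p - 1) / (2 - \<kappa> * (p - 1))))"
      unfolding exponent .
  qed
qed

lemma lifespan_critical:
  fixes t1 K p \<kappa> :: real
  assumes t1_ge_1: "t1 \<ge> 1" and K_pos: "K > 0" and p_gt_1: "p > 1"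
    and critical: "\<kappa> * (p - 1) = 2"
  obtains C where "C > 0"
    "\<And>\<epsilon> T. 0 < \<epsilon> \<Longrightarrow> \<epsilon> \<le> 1 \<Longrightarrow>
      (\<And>t. t1 \<le> t \<Longrightarrow> t < T \<Longrightarrow>
        integral {t1..t} (\<lambda>s. s powr ((1 - p) * (\<kappa> / 2))) \<le> K * \<epsilon> powr (1 - p)) \<Longrightarrow>
      T \<le> exp (C * \<epsilon> powr (- (p - 1)))"
proof (rule that[of "ln t1 + K"])
  show "ln t1 + K > 0"
    using K_pos t1_ge_1 by (simp add: add_nonneg_pos)
  have exponent: "(1 - p) * (\<kappa> / 2) = - 1"
    using critical by (simp add: algebra_simps)
  fix \<epsilon> T :: real
  assume \<epsilon>_bounds: "0 < \<epsilon>" "\<epsilon> \<le> 1"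
    and bound: "\<And>t. t1 \<le> t \<Longrightarrow> t < T \<Longrightarrow>
      integral {t1..t} (\<lambda>s. s powr ((1 - p) * (\<kappa> / 2))) \<le> K * \<epsilon> powr (1 - p)"
  have "T \<le> exp (ln t1 + K * \<epsilon> powr (1 - p))"
    using K_pos t1_ge_1 bound unfolding exponent by (intro le_exp_if_integral_inverse_le) auto
  also have "\<dots> \<le> exp ((ln t1 + K) * \<epsilon> powr (1 - p))"
    using affine_le_mult_powr[of "ln t1" "1 - p" \<epsilon> K] t1_ge_1 p_gt_1 \<epsilon>_bounds by simp
  finally show "T \<le> exp ((ln t1 + K) * \<epsilon> powr (- (p - 1)))"
    by simp
qed

definition cone_weak_sol ::
  "real \<Rightarrow> real \<Rightarrow> real \<Rightarrow> real \<Rightarrow> real \<Rightarrow> real \<Rightarrow> (real^'n \<Rightarrow> real) \<Rightarrow> (real^'n \<Rightarrow> real)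
   \<Rightarrow> real \<Rightarrow> (real^'n \<Rightarrow> real \<Rightarrow> real) \<Rightarrow> bool" where
  "cone_weak_sol R m \<mu> \<nu> p \<epsilon> u0 u1 T u \<longleftrightarrow> weak_sol m \<mu> \<nu> p \<epsilon> u0 u1 T u \<and>
   (\<forall>t\<in>{1..<T}. AE x in lborel. R + phi_m m t - phi_m m 1 < norm x \<longrightarrow> u x t = 0)"

locale blowup_data = tricomi_coefficients m \<mu> \<nu> for m \<mu> \<nu> :: real +
  fixes u0 u1 :: "real^'n \<Rightarrow> real" and p R :: real
  assumes p_gt_1: "p > 1" and R_pos: "R > 0" and L2_u0: "L2 u0" and L2_u1: "L2 u1"
    and u0_nonneg: "AE x in lborel. u0 x \<ge> 0"
    and supp_u0: "AE x in lborel. R < norm x \<longrightarrow> u0 x = 0"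
    and supp_u1: "AE x in lborel. R < norm x \<longrightarrow> u1 x = 0"
    and data_pos: "AE x in lborel. norm x < R \<longrightarrow> \<alpha> * u0 x + u1 x > 0"
begin

definition \<kappa> :: real where "\<kappa> = (1 + m) * (real CARD('n) - 1) - m + \<mu>"

definition initial_mass :: real where
  "initial_mass = (LINT x|lborel. u1 x * eig x) + \<alpha> * (LINT x|lborel. u0 x * eig x)"

lemma initial_mass_pos: "initial_mass > 0"
proof -
  note int = integrable_mult_eig[OF L2_u0 supp_u0] integrable_mult_eig[OF L2_u1 supp_u1]
  have "(\<lambda>x. (\<alpha> * u0 x + u1 x) * eig x) = (\<lambda>x. \<alpha> * (u0 x * eig x) + u1 x * eig x)"
    by (simp add: algebra_simps)
  then have "integrable lborel (\<lambda>x. (\<alpha> * u0 x + u1 x) * eig x)"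
    "initial_mass = (LINT x|lborel. (\<alpha> * u0 x + u1 x) * eig x)"
    using int by (simp_all add: initial_mass_def)
  moreover have "AE x in lborel. R < norm x \<longrightarrow> \<alpha> * u0 x + u1 x = 0"
    using supp_u0 supp_u1 by eventually_elim auto
  ultimately show ?thesis
    using integral_mult_eig_pos[OF R_pos _ _ data_pos] by simp
qed

lemma cone_weak_sol_imp_cone_weak_solution:
  assumes "cone_weak_sol R m \<mu> \<nu> p \<epsilon> u0 u1 T u"
  obtains v G where "cone_weak_solution m \<mu> \<nu> p \<epsilon> T u0 u1 u v G R"
proof -
  obtain v G where "weak_solution m \<mu> \<nu> p \<epsilon> T u0 u1 u v G"
    using weak_sol_imp_weak_solution assms unfolding cone_weak_sol_def by blast
  then interpret weak_solution m \<mu> \<nu> p \<epsilon> T u0 u1 u v G .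
  have "cone_weak_solution m \<mu> \<nu> p \<epsilon> T u0 u1 u v G R"
    by unfold_locales
      (use assms m_nonneg p_gt_1 R_pos L2_u0 L2_u1 supp_u1 in \<open>auto simp: cone_weak_sol_def\<close>)
  then show ?thesis
    by (rule that)
qed

lemma cone_weak_sol_integral_bound:
  obtains K where "K > 0"
    "\<And>\<epsilon> T u t. 0 < \<epsilon> \<Longrightarrow> cone_weak_sol R m \<mu> \<nu> p \<epsilon> u0 u1 T u \<Longrightarrow> threshold + 1 \<le> t \<Longrightarrow> t < T \<Longrightarrow>
      integral {threshold + 1..t} (\<lambda>s. s powr ((1 - p) * (\<kappa> / 2))) \<le> K * \<epsilon> powr (1 - p)"
proof -
  define d where "d = (1 + m) * (real CARD('n) - 1) / 2"
  obtain C where C_pos: "C > 0" and mass_le: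
    "\<And>t. t \<ge> 1 \<Longrightarrow> eig_mass TYPE(real^'n) (R + phi_m m t) \<le> C * (exp (phi_m m t) * t powr d)"
    using eig_mass_cone_le[OF m_nonneg R_pos, where 'a = "real^'n"] unfolding d_def by auto
  then have "C powr (1 - p) > 0"
    by simp
  then obtain K where K_pos: "K > 0" and bound:
    "\<And>\<epsilon> T U V H t. damped_tricomi m \<mu> \<nu> T U V H \<Longrightarrow> \<epsilon> > 0 \<Longrightarrow> V 1 + \<alpha> * U 1 = \<epsilon> * initial_mass \<Longrightarrow>
      (\<And>t. 1 < t \<Longrightarrow> t < T \<Longrightarrow>
        C powr (1 - p) * \<bar>V t\<bar> powr p * (exp (phi_m m t) * t powr d) powr (1 - p) \<le> H t) \<Longrightarrow>
      threshold + 1 \<le> t \<Longrightarrow> t < T \<Longrightarrow>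
      integral {threshold + 1..t} (\<lambda>s. s powr ((1 - p) * ((\<mu> - m) / 2 + d))) \<le> K * \<epsilon> powr (1 - p)"
    using damped_tricomi_lifespan[OF p_gt_1 _ initial_mass_pos, of "C powr (1 - p)" d] by blast
  have \<kappa>_half: "\<kappa> / 2 = (\<mu> - m) / 2 + d"
    by (simp add: \<kappa>_def d_def field_simps)
  show ?thesis
  proof (rule that[OF K_pos])
    fix \<epsilon> T u t
    assume \<epsilon>_pos: "0 < \<epsilon>" and sol: "cone_weak_sol R m \<mu> \<nu> p \<epsilon> u0 u1 T u"
      and t_bounds: "threshold + 1 \<le> t" "t < T"
    obtain v G where "cone_weak_solution m \<mu> \<nu> p \<epsilon> T u0 u1 u v G R"
      using cone_weak_sol_imp_cone_weak_solution[OF sol] .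
    then interpret cone_weak_solution m \<mu> \<nu> p \<epsilon> T u0 u1 u v G R .
    have mass: "moment v eig 1 + \<alpha> * moment u eig 1 = \<epsilon> * initial_mass"
      by (simp add: moment_u_eig_1 moment_v_eig_1 initial_mass_def algebra_simps)
    have "(LINT x|lborel. u0 x * eig x) \<ge> 0"
      by (intro integral_nonneg_AE eventually_mono[OF u0_nonneg])
        (simp add: less_imp_le[OF eig_pos])
    then have "damped_tricomi m \<mu> \<nu> T (moment u eig) (moment v eig) (power_bound C d)"
      using DERIV_moment_u_eig cont_moment_v_eig dini_moment_v_eig[OF C_pos, of d]
        mass_le \<epsilon>_pos initial_mass_pos mass
      by unfold_locales (auto simp: cone_radius_def power_bound_def moment_u_eig_1)
    then show "integral {threshold + 1..t} (\<lambda>s. s powr ((1 - p) * (\<kappa> / 2))) \<le> K * \<epsilon> powr (1 - p)"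
      unfolding \<kappa>_half
      by (rule bound[where U = "moment u eig" and V = "moment v eig", OF _ \<epsilon>_pos mass _ t_bounds])
        (simp add: power_bound_def)
  qed
qed

lemma \<kappa>_pos:
  assumes "CARD('n) \<ge> 2" "\<mu> \<ge> 0"
  shows "\<kappa> > 0"
proof -
  have "(1 + m) * 1 \<le> (1 + m) * (real CARD('n) - 1)"
    using assms(1) m_nonneg by (intro mult_left_mono) auto
  with assms(2) show ?thesis
    by (simp add: \<kappa>_def)
qed

lemma \<kappa>_dim_1: "CARD('n) = 1 \<Longrightarrow> \<kappa> = \<mu> - m"
  by (simp add: \<kappa>_def)

lemma subcritical_iff: "\<kappa> * (p - 1) < 2 \<longleftrightarrow> \<kappa> \<le> 0 \<or> p < 1 + 2 / \<kappa>"
proof (cases "\<kappa> \<le> 0")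
  case True
  then have "\<kappa> * (p - 1) \<le> 0"
    using p_gt_1 by (intro mult_nonpos_nonneg) auto
  with True show ?thesis by auto
qed (auto simp: field_simps)

lemma critical_iff: "\<kappa> * (p - 1) = 2 \<longleftrightarrow> \<kappa> > 0 \<and> p = 1 + 2 / \<kappa>"
  using p_gt_1 subcritical_iff by (cases "\<kappa> > 0") (auto simp: field_simps)

lemma cone_weak_sol_lifespan:
  obtains C where "C > 0"
    "\<And>\<epsilon> T u. 0 < \<epsilon> \<Longrightarrow> \<epsilon> \<le> 1 \<Longrightarrow> cone_weak_sol R m \<mu> \<nu> p \<epsilon> u0 u1 T u \<Longrightarrow> \<kappa> * (p - 1) < 2 \<Longrightarrow>
      T \<le> C * \<epsilon> powr (- (2 * (p - 1) / (2 - \<kappa> * (p - 1))))"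
    "\<And>\<epsilon> T u. 0 < \<epsilon> \<Longrightarrow> \<epsilon> \<le> 1 \<Longrightarrow> cone_weak_sol R m \<mu> \<nu> p \<epsilon> u0 u1 T u \<Longrightarrow> \<kappa> * (p - 1) = 2 \<Longrightarrow>
      T \<le> exp (C * \<epsilon> powr (- (p - 1)))"
proof -
  obtain K where K_pos: "K > 0" and bound:
    "\<And>\<epsilon> T u t. 0 < \<epsilon> \<Longrightarrow> cone_weak_sol R m \<mu> \<nu> p \<epsilon> u0 u1 T u \<Longrightarrow> threshold + 1 \<le> t \<Longrightarrow> t < T \<Longrightarrow>
      integral {threshold + 1..t} (\<lambda>s. s powr ((1 - p) * (\<kappa> / 2))) \<le> K * \<epsilon> powr (1 - p)"
    using cone_weak_sol_integral_bound by blast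
  have start_ge: "threshold + 1 \<ge> 1" "threshold + 1 > 0"
    using threshold_ge(1) by simp_all
  consider "\<kappa> * (p - 1) < 2" | "\<kappa> * (p - 1) = 2" | "\<kappa> * (p - 1) > 2"
    by linarith
  then show ?thesis
  proof cases
    case 1
    then show ?thesis
      by (rule lifespan_subcritical[OF start_ge(2) K_pos p_gt_1])
        (use bound 1 in \<open>auto intro!: that\<close>)
  next
    case 2
    then show ?thesis
      by (rule lifespan_critical[OF start_ge(1) K_pos p_gt_1]) (use bound 2 in \<open>auto intro!: that\<close>)
  next
    case 3
    then show ?thesis
      by (intro that[of 1]) auto
  qed
qed

end

theorem theorem2p1:
  fixes u0 u1 :: "real^'n \<Rightarrow> real" and p m \<mu> \<nu> R :: real
  assumes "p > 1" and "m \<ge> 0" and "\<mu> \<ge> 0" and "\<nu> \<ge> 0"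
    and "(\<mu> - 1)^2 - 4 * \<nu>^2 \<ge> 0" and "R > 0"
    and "H1 u0" and "L2 u1"
    and "AE x in lborel. u0 x \<ge> 0" and "AE x in lborel. u1 x \<ge> 0"
    and "AE x in lborel. R < norm x \<longrightarrow> u0 x = 0"
    and "AE x in lborel. R < norm x \<longrightarrow> u1 x = 0"
    and "\<not> ((AE x in lborel. u0 x = 0) \<and> (AE x in lborel. u1 x = 0))"
    and "AE x in lborel. norm x < R \<longrightarrow>
           (\<mu> - 1 - sqrt ((\<mu> - 1)^2 - 4 * \<nu>^2)) / 2 * u0 x + u1 x > 0"
  shows "\<exists>\<epsilon>0>0. \<exists>C>0. \<forall>\<epsilon> T u. 0 < \<epsilon> \<and> \<epsilon> \<le> \<epsilon>0
           \<and> weak_sol m \<mu> \<nu> p \<epsilon> u0 u1 T u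
           \<and> (\<forall>t\<in>{1..<T}. AE x in lborel. R + phi_m m t - phi_m m 1 < norm x \<longrightarrow> u x t = 0)
         \<longrightarrow>
           (CARD('n) \<ge> 2 \<longrightarrow>
              (p < 1 + 2 / ((1 + m) * (real CARD('n) - 1) - m + \<mu>) \<longrightarrow>
                 T \<le> C * \<epsilon> powr (- (2 * (p - 1) / (2 - ((1 + m) * (real CARD('n) - 1) - m + \<mu>) * (p - 1)))))
            \<and> (p = 1 + 2 / ((1 + m) * (real CARD('n) - 1) - m + \<mu>) \<longrightarrow>
                 T \<le> exp (C * \<epsilon> powr (- (p - 1)))))
         \<and> (CARD('n) = 1 \<longrightarrow>
              ((\<mu> \<le> m \<or> (\<mu> > m \<and> p < 1 + 2 / (\<mu> - m))) \<longrightarrow>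
                 T \<le> C * \<epsilon> powr (- (2 * (p - 1) / (2 - (\<mu> - m) * (p - 1)))))
            \<and> ((\<mu> > m \<and> p = 1 + 2 / (\<mu> - m)) \<longrightarrow>
                 T \<le> exp (C * \<epsilon> powr (- (p - 1)))))"
proof -
  interpret tricomi_coefficients m \<mu> \<nu>
    by unfold_locales (use assms in auto)
  interpret blowup_data m \<mu> \<nu> u0 u1 p R
    by unfold_locales (use assms in \<open>auto simp: H1_def \<alpha>_def\<close>)
  obtain C where C_pos: "C > 0"
    and subcritical: "\<And>\<epsilon> T u. 0 < \<epsilon> \<Longrightarrow> \<epsilon> \<le> 1 \<Longrightarrow> cone_weak_sol R m \<mu> \<nu> p \<epsilon> u0 u1 T u \<Longrightarrow>
      \<kappa> * (p - 1) < 2 \<Longrightarrow> T \<le> C * \<epsilon> powr (- (2 * (p - 1) / (2 - \<kappa> * (p - 1))))"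
    and critical: "\<And>\<epsilon> T u. 0 < \<epsilon> \<Longrightarrow> \<epsilon> \<le> 1 \<Longrightarrow> cone_weak_sol R m \<mu> \<nu> p \<epsilon> u0 u1 T u \<Longrightarrow>
      \<kappa> * (p - 1) = 2 \<Longrightarrow> T \<le> exp (C * \<epsilon> powr (- (p - 1)))"
    using cone_weak_sol_lifespan by blast
  show ?thesis
  proof (rule exI[of _ 1], rule conjI[OF zero_less_one], rule exI[of _ C], rule conjI[OF C_pos],
      intro allI impI, goal_cases)
    case (1 \<epsilon> T u)
    then have \<epsilon>_bounds: "0 < \<epsilon>" "\<epsilon> \<le> 1" and sol: "cone_weak_sol R m \<mu> \<nu> p \<epsilon> u0 u1 T u"
      by (auto simp: cone_weak_sol_def)
    show ?case
      using subcritical[OF \<epsilon>_bounds sol] critical[OF \<epsilon>_bounds sol] \<kappa>_pos \<kappa>_dim_1 assms(3)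
      unfolding subcritical_iff critical_iff by (auto simp: \<kappa>_def)
  qed
qed

end
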